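(* Fix an integer $r\ge2$. Consider the Gaussian additive model $Y=\sqrt\lambda X+Z$ in $\mathbb R^{n^r}$ with $X=\mathrm{vec}(v^{\otimes r})$, where $v\in\mathbb R^n$ has i.i.d. $N(0,1)$ entries (tensor PCA with Gaussian prior). Then for all $\lambda>0$ and for any sequence of positive integers $D_n=o(\sqrt n/\log^2n)$, $$\mathrm{MMSE}^{\le D_n}_X\!\left(\frac{1}{D_n^{3/2}\log^{r+1}n}\Big(\lambda+\frac{d}{dq}\mathcal F_{\mathrm{ann},\lambda}(q)\Big|_{q=q(D_n)}\Big)\right)=n^r-\widetilde O\big((D_nn)^{r/2}\big)=(1+o(1))\,\mathrm{MMSE}^{\mathrm{trivial}}_X.$$ In particular, writing $\lambda_{\mathrm{ALG}}=\widetilde\Theta(n^{-r/2})$, for some $\lambda=\widetilde\Theta(n^{-r/2})=\widetilde\Theta(\lambda_{\mathrm{ALG}})$ we have $\frac{d}{dq}\mathcal F_{\mathrm{ann},\lambda}(q)\big|_{q=q(D_n)}\ge0$, and therefore $$\mathrm{MMSE}^{\le D_n}_X\!\left(\widetilde\Theta\Big(\frac{\lambda_{\mathrm{ALG}}}{D_n^{r/2}}\Big)\right)\ge(1+o(1))\,\mathrm{MMSE}^{\mathrm{trivial}}_X.$$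
   Context: In the Gaussian additive model, $Z$ is a standard Gaussian vector independent of $X$ and $\lambda$ is the signal-to-noise ratio. Low-degree MMSE: with $\mathbb R[Y]_{\le D}$ the polynomials in $Y$ of total degree at most $D$, $\mathrm{MMSE}^{\le D}_X(\lambda):=\inf_{f_j\in\mathbb R[Y]_{\le D}}\mathbb E\big[\sum_j(f_j(Y)-X_j)^2\big]$, where $Y=\sqrt\lambda X+Z$ and $j$ ranges over the coordinates of $X$. $\mathrm{MMSE}^{\mathrm{trivial}}_X:=\mathbb E\|X\|^2-\|\mathbb E X\|^2$ is the mean squared error of the best constant estimator. Overlap quantile: for i.i.d. copies $X,X'$ and $D>0$, $q(D):=\inf\{y:\mathbb P(|\langle X,X'\rangle|\le y)\ge1-e^{-D}\}$. Note $\langle X,X'\rangle=\langle v,v'\rangle^r$. Annealed Franz–Parisi potential: $\mathcal F_{\mathrm{ann},\lambda}(q)=-\lambda q-\log f(q)$, where $f$ is the density of $\langle X,X'\rangle$ (formally $-\log\mathbb E[1_{\langle X,X'\rangle=q}e^{\lambda\langle X,X'\rangle}]$). Asymptotics are as $n\to\infty$; $\widetilde O,\widetilde\Theta$ hide factors polylogarithmic in $n$.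
   Formalization: λ with F'≥0 is shown of order Θ̃(n^{-r/2}D_n^{1-r/2}); it is Θ̃(n^{-r/2}) if r=2 or D_n is polylog (false otherwise). MMSE = n^r−Õ((D_n n)^{r/2}) is shown as a lower bound, and two-sided with E‖X‖² for n^r (two-sided with n^r fails at r=3, D=1). *)

theory Defs
  imports "HOL-Probability.Probability" "HOL-Library.Landau_Symbols"
begin

section \<open>Soft asymptotic notation\<close>

text \<open>Factors polylogarithmic in \<open>n\<close> are hidden; \<open>g\<close> is always a function of \<open>n\<close>.
  Membership bounds the absolute value, as for the Landau symbols of the library.\<close>

definition soft_O :: "(nat \<Rightarrow> real) \<Rightarrow> (nat \<Rightarrow> real) set" where
  "soft_O g = {f. \<exists>k::nat. f \<in> O(\<lambda>n. g n * ln (real n) ^ k)}"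

definition soft_Theta :: "(nat \<Rightarrow> real) \<Rightarrow> (nat \<Rightarrow> real) set" where
  "soft_Theta g = {f. \<exists>k::nat. f \<in> O(\<lambda>n. g n * ln (real n) ^ k)
                            \<and> f \<in> \<Omega>(\<lambda>n. g n / ln (real n) ^ k)}"

section \<open>The Gaussian additive model\<close>

text \<open>Vectors with coordinates in a finite index set \<open>J\<close> are extensional functions on \<open>J\<close>.
  A random vector \<open>X\<close> is given by its law \<open>P\<close>, a probability measure with the sigma-algebra of
  \<open>\<Pi>\<^sub>M j\<in>J. borel\<close>. All laws used below have finite moments of every order, so that the
  Bochner integrals are genuine expectations.\<close>

definition gaussian_vector :: "'j set \<Rightarrow> ('j \<Rightarrow> real) measure" where
  "gaussian_vector J = (\<Pi>\<^sub>M j\<in>J. density lborel (\<lambda>x. ennreal (std_normal_density x)))"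

definition observation :: "'j set \<Rightarrow> real \<Rightarrow> ('j \<Rightarrow> real) \<Rightarrow> ('j \<Rightarrow> real) \<Rightarrow> ('j \<Rightarrow> real)" where
  "observation J lam x z = (\<lambda>j\<in>J. sqrt lam * x j + z j)"

definition polynomials_upto :: "'j set \<Rightarrow> nat \<Rightarrow> (('j \<Rightarrow> real) \<Rightarrow> real) set" where
  "polynomials_upto J D =
     {p. \<exists>c :: ('j \<Rightarrow> nat) \<Rightarrow> real. p =
        (\<lambda>y. \<Sum>\<alpha> \<in> {\<alpha> \<in> J \<rightarrow>\<^sub>E {..D}. (\<Sum>j\<in>J. \<alpha> j) \<le> D}. c \<alpha> * (\<Prod>j\<in>J. y j ^ \<alpha> j))}"

definition MMSE :: "'j set \<Rightarrow> ('j \<Rightarrow> real) measure \<Rightarrow> nat \<Rightarrow> real \<Rightarrow> real" where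
  "MMSE J P D lam =
     (INF f \<in> J \<rightarrow>\<^sub>E polynomials_upto J D.
        \<integral>(x, z). (\<Sum>j\<in>J. (f j (observation J lam x z) - x j)\<^sup>2) \<partial>(P \<Otimes>\<^sub>M gaussian_vector J))"

definition second_moment :: "'j set \<Rightarrow> ('j \<Rightarrow> real) measure \<Rightarrow> real" where
  "second_moment J P = (\<integral>x. (\<Sum>j\<in>J. (x j)\<^sup>2) \<partial>P)"

definition MMSE_trivial :: "'j set \<Rightarrow> ('j \<Rightarrow> real) measure \<Rightarrow> real" where
  "MMSE_trivial J P = second_moment J P - (\<Sum>j\<in>J. (\<integral>x. x j \<partial>P)\<^sup>2)"

section \<open>Overlap and annealed Franz--Parisi potential\<close>

definition overlap :: "'j set \<Rightarrow> ('j \<Rightarrow> real) \<times> ('j \<Rightarrow> real) \<Rightarrow> real" where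
  "overlap J = (\<lambda>(x, x'). \<Sum>j\<in>J. x j * x' j)"

definition overlap_quantile :: "'j set \<Rightarrow> ('j \<Rightarrow> real) measure \<Rightarrow> real \<Rightarrow> real" where
  "overlap_quantile J P D =
     Inf {y. measure (P \<Otimes>\<^sub>M P) {w \<in> space (P \<Otimes>\<^sub>M P). \<bar>overlap J w\<bar> \<le> y} \<ge> 1 - exp (- D)}"

text \<open>A density is determined only up to null sets, whereas the potential is differentiated at a
  point. We take the version that is differentiable on the positive half-line; its values there
  are uniquely determined by the law of the overlap. At \<open>0\<close> the density may be singular.\<close>

definition is_overlap_density :: "'j set \<Rightarrow> ('j \<Rightarrow> real) measure \<Rightarrow> (real \<Rightarrow> real) \<Rightarrow> bool" where
  "is_overlap_density J P f \<longleftrightarrow>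
     (\<forall>x. 0 \<le> f x) \<and>
     distributed (P \<Otimes>\<^sub>M P) lborel (overlap J) (\<lambda>x. ennreal (f x)) \<and>
     f differentiable_on {0<..}"

definition overlap_density :: "'j set \<Rightarrow> ('j \<Rightarrow> real) measure \<Rightarrow> real \<Rightarrow> real" where
  "overlap_density J P = (SOME f. is_overlap_density J P f)"

definition franz_parisi :: "'j set \<Rightarrow> ('j \<Rightarrow> real) measure \<Rightarrow> real \<Rightarrow> real \<Rightarrow> real" where
  "franz_parisi J P lam q = - lam * q - ln (overlap_density J P q)"

section \<open>Tensor PCA with Gaussian prior\<close>

text \<open>The \<open>n ^ r\<close> coordinates of \<open>vec(v\<^sup>\<otimes>\<^sup>r)\<close> are indexed by the multi-indices in
  \<open>{..<n}\<^sup>r\<close>.\<close>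

definition tensor_index :: "nat \<Rightarrow> nat \<Rightarrow> (nat \<Rightarrow> nat) set" where
  "tensor_index n r = {..<r} \<rightarrow>\<^sub>E {..<n}"

definition tensor_power :: "nat \<Rightarrow> nat \<Rightarrow> (nat \<Rightarrow> real) \<Rightarrow> ((nat \<Rightarrow> nat) \<Rightarrow> real)" where
  "tensor_power n r v = (\<lambda>j \<in> tensor_index n r. \<Prod>k<r. v (j k))"

definition tensor_prior :: "nat \<Rightarrow> nat \<Rightarrow> ((nat \<Rightarrow> nat) \<Rightarrow> real) measure" where
  "tensor_prior n r =
     distr (gaussian_vector {..<n}) (\<Pi>\<^sub>M j \<in> tensor_index n r. borel) (tensor_power n r)"

definition tpca_MMSE :: "nat \<Rightarrow> nat \<Rightarrow> nat \<Rightarrow> real \<Rightarrow> real" where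
  "tpca_MMSE n r = MMSE (tensor_index n r) (tensor_prior n r)"

definition tpca_MMSE_trivial :: "nat \<Rightarrow> nat \<Rightarrow> real" where
  "tpca_MMSE_trivial n r = MMSE_trivial (tensor_index n r) (tensor_prior n r)"

definition tpca_second_moment :: "nat \<Rightarrow> nat \<Rightarrow> real" where
  "tpca_second_moment n r = second_moment (tensor_index n r) (tensor_prior n r)"

text \<open>The derivative of \<open>q \<mapsto> \<F>\<^sub>a\<^sub>n\<^sub>n\<^sub>,\<^sub>\<lambda>(q)\<close> at the overlap quantile \<open>q = q(D)\<close>.\<close>

definition tpca_FP_slope :: "nat \<Rightarrow> nat \<Rightarrow> nat \<Rightarrow> real \<Rightarrow> real" where
  "tpca_FP_slope n r D lam =
     deriv (franz_parisi (tensor_index n r) (tensor_prior n r) lam)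
       (overlap_quantile (tensor_index n r) (tensor_prior n r) (real D))"

end

theory Submission
  imports Defs "HOL-Computational_Algebra.Polynomial"
begin

text \<open>For a polynomial \<open>f\<close> of degree at most \<open>D\<close> the moment \<open>E[f(Y) f(Z)]\<close> is close to \<open>E[f(Z)\<^sup>2]\<close> as soon as
  \<open>\<Sum>\<^sub>1\<^sub>\<le>\<^sub>k\<^sub>\<le>\<^sub>D (\<lambda> D)\<^sup>k E[\<langle>X,X'\<rangle>\<^sup>k] / k!\<close> is small: expand in Hermite polynomials and apply Cauchy--Schwarz
  with weight \<open>D\<close> per derivative, using \<open>(1 + 1/D)\<^sup>D < 3\<close>. Hence \<open>E[f(Y)\<^sup>2] \<ge> E[f(Z)\<^sup>2] / 4\<close>, and then only the
  correlations \<open>E[f(Y) X\<^sub>j]\<close> have to be bounded, which gives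
  \<open>MMSE \<ge> E[\<parallel>X\<parallel>\<^sup>2] - 4 \<Sum>\<^sub>k\<^sub>\<le>\<^sub>D \<lambda>\<^sup>k E[\<langle>X,X'\<rangle>\<^sup>k\<^sup>+\<^sup>1] / k!\<close>.

  For the tensor prior \<open>\<langle>X,X'\<rangle> = S\<^sup>r\<close> with \<open>S = \<langle>v,v'\<rangle>\<close>. Given \<open>T = \<parallel>v\<parallel>\<^sup>2 / 2\<close>, which is Gamma distributed, \<open>S\<close> is
  centred Gaussian with variance \<open>2 T\<close>. This yields the moments of \<open>S\<close>, the two-sided estimate
  \<open>S \<approx> (n D)\<^sup>1\<^sup>/\<^sup>2\<close> for the quantile, and a density of Bessel type, whose logarithmic derivative is controlled
  by the three-term recursion of the Bessel integrals. The slope of the potential plus \<open>\<lambda>\<close> is then of order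
  \<open>D (n D)\<^sup>-\<^sup>r\<^sup>/\<^sup>2\<close>.\<close>

section \<open>Random variables with moments of all orders\<close>

text \<open>The law of \<open>Y\<close> is a mixture without convenient orthogonal polynomials,
  whereas Hermite polynomials are orthogonal for \<open>Z\<close>. Averaging over the signal acts on
  them as a triangular matrix with the squared norms on the diagonal; controlling its off-diagonal
  part replaces an orthogonal basis for \<open>Y\<close>. This is what limits the SNR: the part of
  order \<open>k\<close> costs \<open>(lam * D) ^ k\<close> times a moment of the overlap, which
  stays small up to an SNR of order \<open>(n * D) powr (- r / 2)\<close>.

  The slope plus \<open>lam\<close> exceeds that threshold by a factor of order \<open>D\<close>,
  which the prefactor with \<open>D powr (3/2)\<close> removes, and one logarithm absorbs all
  explicit constants; this is why none of them is optimised. The lower bound on the same quantity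
  matters as well: it makes the rescaled SNR nonnegative and provides the witness for a nonnegative
  slope.

  The potential is defined through a density picked by \<open>SOME\<close>, so its derivative
  becomes accessible only once all versions that are differentiable on the positive axis are known
  to agree there.\<close>

definition all_moments :: "'a measure \<Rightarrow> ('a \<Rightarrow> real) \<Rightarrow> bool" where
  "all_moments M f \<longleftrightarrow> f \<in> borel_measurable M \<and> (\<forall>p::nat. integrable M (\<lambda>x. \<bar>f x\<bar> ^ p))"

lemma all_moments_measurable: "all_moments M f \<Longrightarrow> f \<in> borel_measurable M"
  by (simp add: all_moments_def)

lemma all_moments_integrable:
  assumes "all_moments M f"
  shows "integrable M f"
proof -
  have "integrable M (\<lambda>x. \<bar>f x\<bar> ^ 1)" using assms unfolding all_moments_def by blast
  then show ?thesis using assms by (simp add: all_moments_def integrable_abs_iff)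
qed

lemma (in finite_measure) all_moments_const: "all_moments M (\<lambda>x. c)"
  by (simp add: all_moments_def)

text \<open>Closure under products is why all orders are required at once: the \<open>p\<close>-th
  power of a product is dominated by the sum of the \<open>2 * p\<close>-th powers, whereas
  integrability alone is not preserved. Most integrability claims below then follow from the shape
  of the expression.\<close>

lemma all_moments_mult:
  assumes f: "all_moments M f" and g: "all_moments M g"
  shows "all_moments M (\<lambda>x. f x * g x)"
  unfolding all_moments_def
proof (intro conjI allI)
  have [measurable]: "f \<in> borel_measurable M" "g \<in> borel_measurable M"
    using f g by (auto simp: all_moments_def)
  show "(\<lambda>x. f x * g x) \<in> borel_measurable M" by measurable
  fix p :: nat
  show "integrable M (\<lambda>x. \<bar>f x * g x\<bar> ^ p)"
  proof (rule Bochner_Integration.integrable_bound)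
    show "integrable M (\<lambda>x. \<bar>f x\<bar> ^ (p*2) + \<bar>g x\<bar> ^ (p*2))"
      using f g unfolding all_moments_def by (intro Bochner_Integration.integrable_add) blast+
    show "AE x in M. norm (\<bar>f x * g x\<bar> ^ p) \<le> norm (\<bar>f x\<bar> ^ (p*2) + \<bar>g x\<bar> ^ (p*2))"
    proof (intro AE_I2)
      fix x
      define u v where "u = \<bar>f x\<bar>^p" and "v = \<bar>g x\<bar>^p"
      have "2 * (u * v) \<le> u^2 + v^2" using sum_squares_bound[of u v] by simp
      moreover have "0 \<le> u * v" by (simp add: u_def v_def)
      ultimately have "u * v \<le> u^2 + v^2" by linarith
      then show "norm (\<bar>f x * g x\<bar> ^ p) \<le> norm (\<bar>f x\<bar> ^ (p*2) + \<bar>g x\<bar> ^ (p*2))"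
        by (simp add: abs_mult power_mult_distrib power_mult u_def v_def)
    qed
  qed measurable
qed

lemma all_moments_add:
  assumes f: "all_moments M f" and g: "all_moments M g"
  shows "all_moments M (\<lambda>x. f x + g x)"
  unfolding all_moments_def
proof (intro conjI allI)
  have [measurable]: "f \<in> borel_measurable M" "g \<in> borel_measurable M"
    using f g by (auto simp: all_moments_def)
  show "(\<lambda>x. f x + g x) \<in> borel_measurable M" by measurable
  fix p :: nat
  show "integrable M (\<lambda>x. \<bar>f x + g x\<bar> ^ p)"
  proof (rule Bochner_Integration.integrable_bound)
    show "integrable M (\<lambda>x. 2^p * (\<bar>f x\<bar> ^ p + \<bar>g x\<bar> ^ p))"
      using f g unfolding all_moments_def
      by (intro integrable_mult_right Bochner_Integration.integrable_add) blast+
    show "AE x in M. norm (\<bar>f x + g x\<bar> ^ p) \<le> norm (2^p * (\<bar>f x\<bar> ^ p + \<bar>g x\<bar> ^ p))"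
    proof (intro AE_I2)
      fix x
      have "\<bar>f x + g x\<bar> ^ p \<le> (2 * max \<bar>f x\<bar> \<bar>g x\<bar>) ^ p"
        by (intro power_mono) auto
      also have "\<dots> \<le> 2^p * (\<bar>f x\<bar> ^ p + \<bar>g x\<bar> ^ p)"
        by (auto simp: power_mult_distrib max_def)
      finally show "norm (\<bar>f x + g x\<bar> ^ p) \<le> norm (2^p * (\<bar>f x\<bar> ^ p + \<bar>g x\<bar> ^ p))"
        by simp
    qed
  qed measurable
qed

lemma (in finite_measure) all_moments_cmult: "all_moments M f \<Longrightarrow> all_moments M (\<lambda>x. c * f x)"
  by (rule all_moments_mult[OF all_moments_const])

lemma (in finite_measure) all_moments_diff:
  "all_moments M f \<Longrightarrow> all_moments M g \<Longrightarrow> all_moments M (\<lambda>x. f x - g x)"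
  using all_moments_add[OF _ all_moments_cmult[of g "-1"]] by simp

lemma (in finite_measure) all_moments_power: "all_moments M f \<Longrightarrow> all_moments M (\<lambda>x. f x ^ k)"
  by (induction k) (auto intro: all_moments_const all_moments_mult)

lemma (in finite_measure) all_moments_sum:
  "(\<And>i. i \<in> I \<Longrightarrow> all_moments M (f i)) \<Longrightarrow> all_moments M (\<lambda>x. \<Sum>i\<in>I. f i x)"
  by (induction I rule: infinite_finite_induct) (auto intro: all_moments_const all_moments_add)

lemma (in finite_measure) all_moments_prod:
  "(\<And>i. i \<in> I \<Longrightarrow> all_moments M (f i)) \<Longrightarrow> all_moments M (\<lambda>x. \<Prod>i\<in>I. f i x)"
  by (induction I rule: infinite_finite_induct) (auto intro: all_moments_const all_moments_mult)

lemma (in finite_measure) all_moments_poly: "all_moments M f \<Longrightarrow> all_moments M (\<lambda>x. poly p (f x))"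
  unfolding poly_altdef by (intro all_moments_sum all_moments_mult all_moments_const all_moments_power)

lemma all_moments_distr:
  assumes "T \<in> measurable M N" "all_moments M (\<lambda>x. f (T x))" "f \<in> borel_measurable N"
  shows "all_moments (distr M N T) f"
  using assms unfolding all_moments_def by (auto simp: integrable_distr_eq)

lemma all_moments_distr_compose:
  assumes T: "T \<in> measurable M N" and "all_moments (distr M N T) f"
  shows "all_moments M (\<lambda>x. f (T x))"
proof -
  have [measurable]: "f \<in> borel_measurable N" "T \<in> measurable M N" 
    using assms by (auto simp: all_moments_def)
  show ?thesis using assms unfolding all_moments_def by (auto simp: integrable_distr_eq)
qed

lemma all_moments_fst:
  assumes "prob_space M" "prob_space N" "all_moments M f"
  shows "all_moments (M \<Otimes>\<^sub>M N) (\<lambda>w. f (fst w))"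
proof (rule all_moments_distr_compose[OF measurable_fst])
  interpret N: prob_space N by fact
  interpret M: prob_space M by fact
  have "distr (M \<Otimes>\<^sub>M N) M fst = M"
    by (rule N.distr_pair_fst)
  then show "all_moments (distr (M \<Otimes>\<^sub>M N) M fst) f" using assms by simp
qed

lemma all_moments_snd:
  assumes "prob_space M" "prob_space N" "all_moments N f"
  shows "all_moments (M \<Otimes>\<^sub>M N) (\<lambda>w. f (snd w))"
proof (rule all_moments_distr_compose[OF measurable_snd])
  interpret pair_prob_space M N
    using assms by (simp add: pair_prob_space_def pair_sigma_finite_def prob_space_imp_sigma_finite)
  have "distr (M \<Otimes>\<^sub>M N) N snd = N"
  proof (rule measure_eqI)
    fix A assume "A \<in> sets (distr (M \<Otimes>\<^sub>M N) N snd)"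
    then have A[measurable]: "A \<in> sets N" by simp
    have "snd -` A \<inter> space (M \<Otimes>\<^sub>M N) = space M \<times> A"
      using sets.sets_into_space[OF A] by (auto simp: space_pair_measure)
    then show "emeasure (distr (M \<Otimes>\<^sub>M N) N snd) A = emeasure N A"
      by (simp add: emeasure_distr M2.emeasure_pair_measure_Times M1.emeasure_space_1)
  qed simp
  then show "all_moments (distr (M \<Otimes>\<^sub>M N) N snd) f" using assms by simp
qed

section \<open>Standard Gaussian vectors\<close>

abbreviation std_normal :: "real measure" where
  "std_normal \<equiv> density lborel (\<lambda>x. ennreal (std_normal_density x))"

lemma prob_space_std_normal: "prob_space std_normal"
  by (rule prob_space_normal_density) simp

interpretation std_normal: prob_space std_normal
  by (rule prob_space_std_normal)

lemma gaussian_vector_eq: "gaussian_vector J = (\<Pi>\<^sub>M j\<in>J. std_normal)"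
  by (simp add: gaussian_vector_def)

interpretation GP: product_prob_space "\<lambda>_. std_normal" J for J :: "'j set"
  by unfold_locales

lemma prob_space_gaussian_vector: "prob_space (gaussian_vector J)"
  unfolding gaussian_vector_eq by (rule GP.prob_space_axioms)

lemma sets_gaussian_vector: "sets (gaussian_vector J) = sets (\<Pi>\<^sub>M j\<in>J. borel)"
  unfolding gaussian_vector_eq by (intro sets_PiM_cong) auto

lemma space_gaussian_vector: "space (gaussian_vector J) = (\<Pi>\<^sub>E j\<in>J. UNIV)"
  unfolding gaussian_vector_eq by (simp add: space_PiM)

lemma all_moments_std_normal: "all_moments std_normal (\<lambda>x. x)"
  unfolding all_moments_def
  by (auto simp: integrable_density integrable_std_normal_moment_abs)

lemma all_moments_gaussian_vector:
  assumes "j \<in> J"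
  shows "all_moments (gaussian_vector J) (\<lambda>z. z j)"
proof -
  have "distr (gaussian_vector J) std_normal (\<lambda>z. z j) = std_normal"
    unfolding gaussian_vector_eq by (rule GP.PiM_component[OF assms])
  then show ?thesis
    using all_moments_distr_compose[of "\<lambda>z. z j" "gaussian_vector J" std_normal "\<lambda>x. x"] assms
      all_moments_std_normal
    by (simp add: gaussian_vector_eq measurable_component_singleton)
qed

section \<open>Hermite polynomials\<close>

text \<open>Probabilists' Hermite polynomials, generated by the raising operator
  \<open>x - d/dx\<close>. Under the standard Gaussian law it is adjoint to \<open>d/dx\<close>, so
  each step of this recursion becomes one integration by parts.\<close>

fun He :: "nat \<Rightarrow> real poly" where
  "He 0 = 1"
| "He (Suc n) = [:0, 1:] * He n - pderiv (He n)"

text \<open>The lowering rule follows from the recursion because commuting \<open>d/dx\<close> past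
  \<open>x - d/dx\<close> leaves one extra copy of the polynomial.\<close>

lemma pderiv_He_Suc: "pderiv (He (Suc n)) = smult (of_nat (Suc n)) (He n)"
proof (induction n)
  case (Suc n)
  have "pderiv (He (Suc (Suc n))) = He (Suc n) + [:0,1:] * pderiv (He (Suc n)) - pderiv (pderiv (He (Suc n)))"
    by (simp only: He.simps(2)[of "Suc n"] pderiv_diff pderiv_mult) (simp add: pderiv_pCons algebra_simps)
  also have "\<dots> = He (Suc n) + smult (of_nat (Suc n)) ([:0,1:] * He n - pderiv (He n))"
    by (simp only: Suc.IH pderiv_smult mult_smult_right smult_diff_right add_diff_eq)
  also have "\<dots> = smult (of_nat (Suc (Suc n))) (He (Suc n))"
    by (simp only: He.simps(2)[symmetric] of_nat_Suc[of "Suc n"] smult_add_left smult_1_left)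
  finally show ?case .
qed (simp add: pderiv_pCons)

lemma pderiv_He: "pderiv (He n) = smult (of_nat n) (He (n - 1))"
  by (cases n) (simp_all only: pderiv_He_Suc, auto)

lemma He_degree_coeff: "degree (He n) \<le> n \<and> coeff (He n) n = 1"
proof (induction n)
  case (Suc n)
  have d: "degree (pderiv (He n)) \<le> n"
    using Suc degree_pderiv[of "He n"] by linarith
  have 1: "degree ([:0, 1:] * He n) \<le> Suc n"
    using Suc degree_pCons_le[of 0 "He n"] by (simp del: degree_pCons_eq_if) 
  then have "degree (He (Suc n)) \<le> Suc n"
    using d unfolding He.simps by (intro degree_diff_le) auto
  moreover have "coeff (He (Suc n)) (Suc n) = 1"
    using Suc d by (simp add: coeff_eq_0)
  ultimately show ?case by simp
qed simp

lemma He_span: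
  assumes "degree p \<le> n"
  shows "\<exists>a. p = (\<Sum>k\<le>n. smult (a k) (He k))"
  using assms
proof (induction n arbitrary: p)
  case 0
  then have "p = [:coeff p 0:]" using degree_eq_zeroE[of p] by (metis coeff_pCons_0 le_zero_eq)
  then have "p = smult (coeff p 0) (He 0)" by simp
  then show ?case by (intro exI[of _ "\<lambda>_. coeff p 0"]) simp
next
  case (Suc n)
  define c where "c = coeff p (Suc n)"
  have "degree (p - smult c (He (Suc n))) \<le> n"
  proof (rule degree_le, intro allI impI)
    fix i assume i: "n < i"
    show "coeff (p - smult c (He (Suc n))) i = 0"
    proof (cases "i = Suc n")
      case True then show ?thesis using He_degree_coeff[of "Suc n"] by (simp add: c_def del: He.simps)
    next
      case False
      then have "degree p < i" "degree (He (Suc n)) < i"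
        using i Suc.prems He_degree_coeff[of "Suc n"] by auto
      then show ?thesis by (simp add: coeff_eq_0 del: He.simps)
    qed
  qed
  then obtain a where a: "p - smult c (He (Suc n)) = (\<Sum>k\<le>n. smult (a k) (He k))"
    using Suc.IH by blast
  have "p = (\<Sum>k\<le>Suc n. smult ((a(Suc n := c)) k) (He k))"
  proof -
    have "(\<Sum>k\<le>n. smult ((a(Suc n := c)) k) (He k)) = (\<Sum>k\<le>n. smult (a k) (He k))"
      by (intro sum.cong) auto
    then have "(\<Sum>k\<le>Suc n. smult ((a(Suc n := c)) k) (He k)) = (\<Sum>k\<le>n. smult (a k) (He k)) + smult c (He (Suc n))"
      by (simp del: He.simps)
    then show ?thesis using a by (simp add: algebra_simps del: He.simps)
  qed
  then show ?case by blast
qed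

text \<open>The range of summation may be any \<open>N\<close> from \<open>n\<close> on, with zero
  coefficients beyond \<open>n\<close>: all coordinates of a monomial can then be expanded over the
  same range \<open>{..D}\<close>, while the zeros keep track of the degree.\<close>

lemma monom_He_expansion:
  obtains a :: "nat \<Rightarrow> nat \<Rightarrow> real"
  where "\<And>n k. n < k \<Longrightarrow> a n k = 0"
    and "\<And>n N x. n \<le> N \<Longrightarrow> x ^ n = (\<Sum>k\<le>N. a n k * poly (He k) x)"
proof -
  have "\<forall>n. \<exists>a. monom 1 n = (\<Sum>k\<le>n. smult (a k) (He k))"
    by (intro allI He_span degree_monom_le)
  then obtain a0 where a0: "\<And>n. monom 1 n = (\<Sum>k\<le>n. smult (a0 n k) (He k))"
    by metis
  define a where "a n k = (if k \<le> n then a0 n k else 0)" for n k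
  have "x ^ n = (\<Sum>k\<le>N. a n k * poly (He k) x)" if "n \<le> N" for n N x
  proof -
    have "x ^ n = poly (monom 1 n) x" by (simp add: poly_monom)
    also have "\<dots> = (\<Sum>k\<le>n. a n k * poly (He k) x)"
      by (simp add: a0 poly_sum a_def)
    also have "\<dots> = (\<Sum>k\<le>N. a n k * poly (He k) x)"
      using that by (intro sum.mono_neutral_left) (auto simp: a_def)
    finally show ?thesis .
  qed
  moreover have "n < k \<Longrightarrow> a n k = 0" for n k by (simp add: a_def)
  ultimately show ?thesis by (rule that[rotated])
qed

section \<open>Gaussian integration by parts and shifted Hermite polynomials\<close>

lemma integrable_poly_std_normal: "integrable std_normal (\<lambda>z. poly p z)"
  using std_normal.all_moments_poly[OF all_moments_std_normal] by (rule all_moments_integrable)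

text \<open>Stein's identity on monomials, read off from the closed forms of the even and odd
  moments. For \<open>k = 0\<close> the exponent \<open>k - 1\<close> is truncated, but its factor
  \<open>real k\<close> vanishes.\<close>

lemma std_normal_moment_rec:
  "(\<integral>z. z ^ Suc k \<partial>std_normal) = real k * (\<integral>z. z ^ (k - 1) \<partial>std_normal)"
proof -
  define m where "m k = (\<integral>z. z ^ k \<partial>std_normal)" for k :: nat
  have m: "m k = (\<integral>z. std_normal_density z * z ^ k \<partial>lborel)" for k
    unfolding m_def by (subst integral_density) auto
  show ?thesis
  proof (cases "even k")
    case True
    then obtain j where j: "k = 2 * j" by (elim evenE)
    have "m (Suc k) = 0" using integral_std_normal_moment_odd[of j] by (simp add: m j)
    moreover have "real k * m (k - 1) = 0"
    proof (cases j)
      case (Suc i) then show ?thesis using integral_std_normal_moment_odd[of i] by (simp add: m j)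
    qed (simp add: j)
    ultimately show ?thesis by (simp add: m_def)
  next
    case False
    then obtain j where j: "k = 2 * j + 1" by (elim oddE)
    have "m (Suc k) = fact (2 * (j+1)) / (2^(j+1) * fact (j+1))"
      using integral_std_normal_moment_even[of "j+1"] by (simp add: m j)
    also have "\<dots> = real k * (fact (2 * j) / (2^j * fact j))"
    proof -
      have f1: "(fact (2 * (j+1)) :: real) = (2 * real (j+1)) * (real k * fact (2 * j))"
        by (simp add: j algebra_simps)
      have f2: "(fact (j+1) :: real) = real (j+1) * fact j" by simp
      have "real (j + 1) \<noteq> 0" by simp
      then show ?thesis unfolding f1 f2 by (simp add: field_simps del: of_nat_add of_nat_Suc)
    qed
    also have "fact (2 * j) / (2^j * fact j) = m (k - 1)"
      using integral_std_normal_moment_even[of j] by (simp add: m j)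
    finally show ?thesis by (simp add: m_def)
  qed
qed

lemma stein_poly: "(\<integral>z. z * poly p z \<partial>std_normal) = (\<integral>z. poly (pderiv p) z \<partial>std_normal)"
proof -
  define n c where "n = degree p" and "c = coeff p"
  have p: "p = (\<Sum>i\<le>n. monom (c i) i)"
    by (simp add: n_def c_def poly_as_sum_of_monoms)
  have int: "integrable std_normal (\<lambda>z. c * z ^ i)" for c i
    using integrable_poly_std_normal[of "monom c i"] by (simp add: poly_monom)
  have "(\<integral>z. z * poly p z \<partial>std_normal) = (\<integral>z. (\<Sum>i\<le>n. c i * z ^ Suc i) \<partial>std_normal)"
    by (subst p) (simp add: poly_sum poly_monom sum_distrib_left mult_ac)
  also have "\<dots> = (\<Sum>i\<le>n. c i * (\<integral>z. z ^ Suc i \<partial>std_normal))"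
    by (subst Bochner_Integration.integral_sum) (simp_all only: int integral_mult_right_zero)
  also have "\<dots> = (\<Sum>i\<le>n. c i * (real i * (\<integral>z. z ^ (i - 1) \<partial>std_normal)))"
    unfolding std_normal_moment_rec ..
  also have "\<dots> = (\<integral>z. (\<Sum>i\<le>n. c i * real i * z ^ (i - 1)) \<partial>std_normal)"
    using int[of "c _ * real _"]
    by (subst Bochner_Integration.integral_sum) (simp_all only: integral_mult_right_zero mult.assoc)
  also have "(\<lambda>z. \<Sum>i\<le>n. c i * real i * z ^ (i - 1)) = (\<lambda>z. poly (pderiv p) z)"
    by (subst p) (auto simp: higher_pderiv_sum[of 1, simplified] pderiv_monom poly_sum poly_monom
        mult_ac fun_eq_iff)
  finally show ?thesis .
qed

text \<open>The \<open>k\<close>-th derivative of \<open>x ^ m\<close>. Its vanishing for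
  \<open>k > m\<close> is the source of the triangular structure in several variables.\<close>

definition herm_coef :: "nat \<Rightarrow> nat \<Rightarrow> real \<Rightarrow> real" where
  "herm_coef m k x = (if k \<le> m then fact m / fact (m - k) * x ^ (m - k) else 0)"

text \<open>Raising \<open>k\<close> by one amounts, after integration by parts, to differentiating
  the shifted polynomial. So \<open>k\<close> steps produce \<open>m! / (m - k)!\<close> times the
  mean of \<open>He (m - k)\<close> at \<open>x + z\<close>, and that mean is
  \<open>x ^ (m - k)\<close>.\<close>

lemma integral_He_shift:
  "(\<integral>z. poly (He m) (x + z) * poly (He k) z \<partial>std_normal) = herm_coef m k x"
proof -
  define M where "M m k = (\<integral>z. poly (He m \<circ>\<^sub>p [:x, 1:] * He k) z \<partial>std_normal)" for m k
  define S where "S m = He m \<circ>\<^sub>p [:x, 1:]" for m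
  have pS: "pderiv (S m) = smult (real m) (S (m - 1))" for m
    by (simp add: S_def pderiv_pcompose pderiv_He pderiv_pCons pcompose_smult)
  have S_Suc: "S (Suc m) = [:x, 1:] * S m - pderiv (S m)" for m
    by (simp add: S_def pcompose_diff pcompose_mult pcompose_pCons pderiv_pcompose pderiv_pCons)
  \<comment> \<open>In the recursion for \<open>S\<close> the mean of \<open>z * S m\<close> cancels
    against that of \<open>pderiv (S m)\<close>, which leaves the factor \<open>x\<close>.\<close>
  have M0: "M m 0 = x ^ m" for m
  proof (induction m)
    case 0
    have "1 \<circ>\<^sub>p [:x, 1:] = (1 :: real poly)" by (simp add: one_pCons pcompose_pCons)
    then show ?case using std_normal.prob_space by (simp add: M_def)
  next
    case (Suc m)
    have "M (Suc m) 0 = (\<integral>z. x * poly (S m) z + z * poly (S m) z - poly (pderiv (S m)) z \<partial>std_normal)"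
      unfolding M_def S_def[symmetric] S_Suc
      by (intro Bochner_Integration.integral_cong refl) (simp add: algebra_simps)
    also have "\<dots> = x * M m 0"
      using integrable_poly_std_normal[of "[:0,1:] * S m"] integrable_poly_std_normal[of "S m"]
        integrable_poly_std_normal[of "pderiv (S m)"]
      by (simp add: stein_poly M_def S_def[symmetric])
    finally show ?case using Suc by simp
  qed
  have M_Suc: "M m (Suc k) = real m * M (m - 1) k" for m k
  proof -
    have "M m (Suc k) = (\<integral>z. z * poly (S m * He k) z - poly (S m * pderiv (He k)) z \<partial>std_normal)"
      unfolding M_def S_def[symmetric]
      by (intro Bochner_Integration.integral_cong refl) (simp add: algebra_simps)
    also have "\<dots> = (\<integral>z. poly (pderiv (S m * He k)) z \<partial>std_normal) - (\<integral>z. poly (S m * pderiv (He k)) z \<partial>std_normal)"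
      using integrable_poly_std_normal[of "[:0,1:] * (S m * He k)"]
        integrable_poly_std_normal[of "S m * pderiv (He k)"]
      by (simp add: stein_poly[symmetric])
    also have "\<dots> = (\<integral>z. poly (pderiv (S m * He k)) z - poly (S m * pderiv (He k)) z \<partial>std_normal)"
      by (rule Bochner_Integration.integral_diff[symmetric]) (intro integrable_poly_std_normal)+
    also have "\<dots> = (\<integral>z. real m * poly (S (m - 1) * He k) z \<partial>std_normal)"
      by (simp add: pderiv_mult pS algebra_simps)
    finally show ?thesis by (simp add: M_def S_def[symmetric])
  qed
  have "M m k = herm_coef m k x"
  proof (induction k arbitrary: m)
    case 0 then show ?case by (simp add: M0 herm_coef_def)
  next
    case (Suc k)
    show ?case
    proof (cases m)
      case (Suc m')
      then show ?thesis using Suc.IH[of m'] by (auto simp: M_Suc herm_coef_def)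
    qed (simp add: M_Suc herm_coef_def)
  qed
  then show ?thesis by (simp add: M_def poly_pcompose add.commute mult.commute)
qed

section \<open>Multi-indices and Hermite expansions\<close>

text \<open>The multinomial theorem divided by \<open>k!\<close>, proved by splitting off one
  exponent at a time and applying the binomial theorem. The hypothesis \<open>k \<le> D\<close>
  guarantees that the box \<open>{..D}\<close> cuts off no multi-index of total degree
  \<open>k\<close>.\<close>

lemma multinomial_power_fact:
  fixes y :: "'j \<Rightarrow> real"
  assumes "finite J" "k \<le> D"
  shows "(\<Sum>\<gamma>\<in>{\<gamma> \<in> J \<rightarrow>\<^sub>E {..D}. sum \<gamma> J = k}. \<Prod>j\<in>J. y j ^ \<gamma> j / fact (\<gamma> j))
         = (\<Sum>j\<in>J. y j) ^ k / fact k"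
  using assms
proof (induction J arbitrary: k rule: finite_induct)
  case empty
  then show ?case by (cases "k = 0") (auto simp: PiE_empty_domain Collect_conv_if)
next
  case (insert i J)
  let ?S = "\<lambda>k. {\<gamma> \<in> J \<rightarrow>\<^sub>E {..D}. sum \<gamma> J = k}"
  let ?S' = "{\<gamma> \<in> insert i J \<rightarrow>\<^sub>E {..D}. sum \<gamma> (insert i J) = k}"
  let ?p = "\<lambda>J \<gamma>. \<Prod>j\<in>J. y j ^ \<gamma> j / fact (\<gamma> j)"
  have fin: "finite (?S m)" for m
    using insert.hyps by (intro finite_subset[OF _ finite_PiE[of J "\<lambda>_. {..D}"]]) auto
  have sum_upd: "sum (g(i := a)) J = sum g J" "?p J (g(i := a)) = ?p J g" for g :: "'j \<Rightarrow> nat" and a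
    using insert.hyps by (auto intro!: sum.cong prod.cong)
  have "sum (?p (insert i J)) ?S' = (\<Sum>(a, g)\<in>Sigma {..k} (\<lambda>a. ?S (k - a)). y i ^ a / fact a * ?p J g)"
  \<comment> \<open>Multi-indices are extensional, so deleting the coordinate \<open>i\<close> means
    resetting its value to \<open>undefined\<close>.\<close>
  proof (rule sum.reindex_bij_witness[where i = "\<lambda>(a, g). g(i := a)" and j = "\<lambda>\<gamma>. (\<gamma> i, \<gamma>(i := undefined))"])
    fix \<gamma> assume g: "\<gamma> \<in> ?S'"
    show "(case (\<gamma> i, \<gamma>(i := undefined)) of (a, g) \<Rightarrow> g(i := a)) = \<gamma>" by simp
    have "\<gamma> i + sum \<gamma> J = k" using g insert.hyps by simp
    moreover have "\<gamma>(i := undefined) \<in> J \<rightarrow>\<^sub>E {..D}"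
      using g insert.hyps by (auto simp: PiE_iff extensional_def)
    ultimately show "(\<gamma> i, \<gamma>(i := undefined)) \<in> Sigma {..k} (\<lambda>a. ?S (k - a))"
      using sum_upd(1)[of \<gamma> undefined] by (auto simp del: fun_upd_apply)
    show "(case (\<gamma> i, \<gamma>(i := undefined)) of (a, g) \<Rightarrow> y i ^ a / fact a * ?p J g) = ?p (insert i J) \<gamma>"
      using insert.hyps sum_upd(2)[of \<gamma> undefined] by (simp del: fun_upd_apply)
  next
    fix b assume b: "b \<in> Sigma {..k} (\<lambda>a. ?S (k - a))"
    obtain a g where ag: "b = (a, g)" by (cases b)
    show "((case b of (a, g) \<Rightarrow> g(i := a)) i, (case b of (a, g) \<Rightarrow> g(i := a))(i := undefined)) = b"
      using b insert.hyps by (auto simp: ag PiE_iff extensional_def)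
    show "(case b of (a, g) \<Rightarrow> g(i := a)) \<in> ?S'"
    proof -
      have "sum (g(i := a)) J = k - a" using b sum_upd(1)[of g a] by (simp add: ag)
      then have "sum (g(i := a)) (insert i J) = k" using b insert.hyps by (simp add: ag del: fun_upd_apply) simp
      moreover have "g(i := a) \<in> insert i J \<rightarrow>\<^sub>E {..D}"
        using b insert.hyps insert.prems by (auto simp: ag PiE_iff extensional_def)
      ultimately show ?thesis by (simp add: ag)
    qed
  qed
  also have "\<dots> = (\<Sum>a\<le>k. y i ^ a / fact a * ((\<Sum>j\<in>J. y j) ^ (k - a) / fact (k - a)))"
  proof (subst sum.Sigma[symmetric])
    show "\<forall>a\<in>{..k}. finite (?S (k - a))" using fin by blast
    show "(\<Sum>a\<le>k. \<Sum>g\<in>?S (k - a). y i ^ a / fact a * ?p J g)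
      = (\<Sum>a\<le>k. y i ^ a / fact a * ((\<Sum>j\<in>J. y j) ^ (k - a) / fact (k - a)))"
    proof (intro sum.cong refl)
      fix a assume "a \<in> {..k}"
      have "(\<Sum>g\<in>?S (k - a). y i ^ a / fact a * ?p J g) = y i ^ a / fact a * sum (?p J) (?S (k - a))"
        by (rule sum_distrib_left[symmetric])
      also have "sum (?p J) (?S (k - a)) = (\<Sum>j\<in>J. y j) ^ (k - a) / fact (k - a)"
        using insert.prems by (intro insert.IH) simp
      finally show "(\<Sum>g\<in>?S (k - a). y i ^ a / fact a * ?p J g)
        = y i ^ a / fact a * ((\<Sum>j\<in>J. y j) ^ (k - a) / fact (k - a))" .
    qed
  qed simp
  also have "\<dots> = (\<Sum>a\<le>k. real (k choose a) * y i ^ a * (\<Sum>j\<in>J. y j) ^ (k - a)) / fact k"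
    unfolding sum_divide_distrib by (intro sum.cong) (auto simp: binomial_fact)
  also have "\<dots> = (y i + (\<Sum>j\<in>J. y j)) ^ k / fact k"
    by (simp add: binomial_ring)
  finally show ?case using insert.hyps by simp
qed

section \<open>Hermite expansion of polynomials of bounded total degree\<close>

definition midx :: "'j set \<Rightarrow> nat \<Rightarrow> ('j \<Rightarrow> nat) set" where
  "midx J D = {\<alpha> \<in> J \<rightarrow>\<^sub>E {..D}. (\<Sum>j\<in>J. \<alpha> j) \<le> D}"

lemma finite_midx: "finite J \<Longrightarrow> finite (midx J D)"
  unfolding midx_def by (intro finite_subset[OF _ finite_PiE[of J "\<lambda>_. {..D}"]]) auto

lemma sum_midx_power:
  fixes y :: "'j \<Rightarrow> real"
  assumes J: "finite J"
  shows "(\<Sum>\<gamma>\<in>midx J D. (\<Prod>j\<in>J. y j ^ \<gamma> j / fact (\<gamma> j))) = (\<Sum>k\<le>D. (\<Sum>j\<in>J. y j) ^ k / fact k)"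
proof -
  let ?f = "\<lambda>\<gamma>. \<Prod>j\<in>J. y j ^ \<gamma> j / fact (\<gamma> j)"
  have "sum ?f (midx J D) = (\<Sum>k\<le>D. sum ?f {\<gamma> \<in> midx J D. sum \<gamma> J = k})"
    using J by (intro sum.group[symmetric]) (auto simp: finite_midx, auto simp: midx_def)
  also have "\<dots> = (\<Sum>k\<le>D. (\<Sum>j\<in>J. y j) ^ k / fact k)"
  proof (intro sum.cong refl)
    fix k assume "k \<in> {..D}"
    moreover from this have "{\<gamma> \<in> midx J D. sum \<gamma> J = k} = {\<gamma> \<in> J \<rightarrow>\<^sub>E {..D}. sum \<gamma> J = k}"
      by (auto simp: midx_def)
    ultimately show "sum ?f {\<gamma> \<in> midx J D. sum \<gamma> J = k} = (\<Sum>j\<in>J. y j) ^ k / fact k"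
      using multinomial_power_fact[OF J, of k D y] by simp
  qed
  finally show ?thesis .
qed

definition hermite :: "'j set \<Rightarrow> ('j \<Rightarrow> nat) \<Rightarrow> ('j \<Rightarrow> real) \<Rightarrow> real" where
  "hermite J \<alpha> y = (\<Prod>j\<in>J. poly (He (\<alpha> j)) (y j))"

definition hermite_sum :: "'j set \<Rightarrow> nat \<Rightarrow> (('j \<Rightarrow> nat) \<Rightarrow> real) \<Rightarrow> ('j \<Rightarrow> real) \<Rightarrow> real" where
  "hermite_sum J D c y = (\<Sum>\<alpha>\<in>midx J D. c \<alpha> * hermite J \<alpha> y)"

text \<open>Monomials are converted one coordinate at a time. The conversion coefficient vanishes
  unless \<open>\<beta> j \<le> \<alpha> j\<close> for every \<open>j\<close>, so the total degree
  does not grow and the expansion stays inside \<open>midx J D\<close>.\<close>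

lemma polynomials_upto_hermite:
  assumes J: "finite J" and p: "p \<in> polynomials_upto J D"
  obtains c where "p = hermite_sum J D c"
proof -
  obtain a :: "nat \<Rightarrow> nat \<Rightarrow> real" where a0: "\<And>n k. n < k \<Longrightarrow> a n k = 0"
    and a: "\<And>n N x. n \<le> N \<Longrightarrow> x ^ n = (\<Sum>k\<le>N. a n k * poly (He k) x)"
    using monom_He_expansion by blast
  obtain c where p: "p = (\<lambda>y. \<Sum>\<alpha>\<in>midx J D. c \<alpha> * (\<Prod>j\<in>J. y j ^ \<alpha> j))"
    using p by (auto simp: polynomials_upto_def midx_def)
  have mon: "(\<Prod>j\<in>J. y j ^ \<alpha> j) = (\<Sum>\<beta>\<in>midx J D. (\<Prod>j\<in>J. a (\<alpha> j) (\<beta> j)) * hermite J \<beta> y)"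
    if al: "\<alpha> \<in> midx J D" for \<alpha> y
  proof -
    have "(\<Prod>j\<in>J. y j ^ \<alpha> j) = (\<Prod>j\<in>J. \<Sum>k\<le>D. a (\<alpha> j) k * poly (He k) (y j))"
      using al by (intro prod.cong a) (auto simp: midx_def)
    also have "\<dots> = (\<Sum>\<beta>\<in>J \<rightarrow>\<^sub>E {..D}. \<Prod>j\<in>J. a (\<alpha> j) (\<beta> j) * poly (He (\<beta> j)) (y j))"
      using J by (intro prod_sum_PiE) auto
    also have "\<dots> = (\<Sum>\<beta>\<in>midx J D. \<Prod>j\<in>J. a (\<alpha> j) (\<beta> j) * poly (He (\<beta> j)) (y j))"
    proof (rule sum.mono_neutral_right)
      show "\<forall>\<beta>\<in>(J \<rightarrow>\<^sub>E {..D}) - midx J D. (\<Prod>j\<in>J. a (\<alpha> j) (\<beta> j) * poly (He (\<beta> j)) (y j)) = 0"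
      proof
        fix \<beta> assume "\<beta> \<in> (J \<rightarrow>\<^sub>E {..D}) - midx J D"
        then have "sum \<alpha> J < sum \<beta> J" using al by (auto simp: midx_def)
        then obtain j where "j \<in> J" "\<alpha> j < \<beta> j" by (meson not_less sum_mono)
        then show "(\<Prod>j\<in>J. a (\<alpha> j) (\<beta> j) * poly (He (\<beta> j)) (y j)) = 0"
          using J by (intro prod_zero) (auto simp: a0 intro!: bexI[of _ j])
      qed
    qed (use J in \<open>auto simp: midx_def intro!: finite_PiE\<close>)
    finally show ?thesis by (simp add: hermite_def prod.distrib)
  qed
  have "p = hermite_sum J D (\<lambda>\<beta>. \<Sum>\<alpha>\<in>midx J D. c \<alpha> * (\<Prod>j\<in>J. a (\<alpha> j) (\<beta> j)))"
  proof
    fix y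
    have "p y = (\<Sum>\<alpha>\<in>midx J D. \<Sum>\<beta>\<in>midx J D. c \<alpha> * ((\<Prod>j\<in>J. a (\<alpha> j) (\<beta> j)) * hermite J \<beta> y))"
      by (simp add: p mon sum_distrib_left)
    also have "\<dots> = hermite_sum J D (\<lambda>\<beta>. \<Sum>\<alpha>\<in>midx J D. c \<alpha> * (\<Prod>j\<in>J. a (\<alpha> j) (\<beta> j))) y"
      by (subst sum.swap) (simp add: hermite_sum_def sum_distrib_right sum_distrib_left mult_ac)
    finally show "p y = hermite_sum J D (\<lambda>\<beta>. \<Sum>\<alpha>\<in>midx J D. c \<alpha> * (\<Prod>j\<in>J. a (\<alpha> j) (\<beta> j))) y" .
  qed
  then show ?thesis by (rule that)
qed

lemma integral_hermite_shift:
  assumes J: "finite J"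
  shows "(\<integral>z. (\<Prod>j\<in>J. poly (He (\<alpha> j)) (x j + z j)) * hermite J \<beta> z \<partial>gaussian_vector J)
    = (\<Prod>j\<in>J. herm_coef (\<alpha> j) (\<beta> j) (x j))"
proof -
  interpret GP: product_prob_space "\<lambda>_. std_normal" J by unfold_locales
  have int: "integrable std_normal (\<lambda>z. poly (He m) (a + z) * poly (He k) z)" for m k and a :: real
    using integrable_poly_std_normal[of "He m \<circ>\<^sub>p [:a, 1:] * He k"] by (simp add: poly_pcompose add.commute)
  have "(\<integral>z. (\<Prod>j\<in>J. poly (He (\<alpha> j)) (x j + z j)) * hermite J \<beta> z \<partial>gaussian_vector J)
      = (\<integral>z. (\<Prod>j\<in>J. poly (He (\<alpha> j)) (x j + z j) * poly (He (\<beta> j)) (z j)) \<partial>gaussian_vector J)"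
    by (simp add: hermite_def prod.distrib)
  also have "\<dots> = (\<Prod>j\<in>J. \<integral>z. poly (He (\<alpha> j)) (x j + z) * poly (He (\<beta> j)) z \<partial>std_normal)"
    unfolding gaussian_vector_eq using J int by (rule GP.product_integral_prod)
  finally show ?thesis by (simp add: integral_He_shift)
qed

section \<open>Low-degree estimation in the Gaussian additive model\<close>

lemma midx_fact_pos: "0 < (\<Prod>j\<in>J. fact (\<alpha> j) :: real)"
  by (intro prod_pos) auto

lemma integral_double_sum:
  fixes f :: "'a \<Rightarrow> 'b \<Rightarrow> 'c \<Rightarrow> real"
  assumes "\<And>a b. integrable M (f a b)"
  shows "(\<integral>w. (\<Sum>a\<in>A. \<Sum>b\<in>B. k a b * f a b w) \<partial>M) = (\<Sum>a\<in>A. \<Sum>b\<in>B. k a b * (\<integral>w. f a b w \<partial>M))"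
proof -
  have "(\<integral>w. (\<Sum>a\<in>A. \<Sum>b\<in>B. k a b * f a b w) \<partial>M) = (\<Sum>a\<in>A. \<integral>w. (\<Sum>b\<in>B. k a b * f a b w) \<partial>M)"
    by (intro Bochner_Integration.integral_sum Bochner_Integration.integrable_sum integrable_mult_right assms)
  also have "\<dots> = (\<Sum>a\<in>A. \<Sum>b\<in>B. \<integral>w. k a b * f a b w \<partial>M)"
    by (intro sum.cong refl Bochner_Integration.integral_sum integrable_mult_right assms)
  finally show ?thesis by simp
qed

locale additive_model =
  fixes J :: "'j set" and P :: "('j \<Rightarrow> real) measure" and lam :: real
  assumes finite_J: "finite J"
    and prob_space_P: "prob_space P"
    and sets_P: "sets P = sets (\<Pi>\<^sub>M j\<in>J. borel)"
    and moments_P: "\<And>j. j \<in> J \<Longrightarrow> all_moments P (\<lambda>x. x j)"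
    and lam_nonneg: "0 \<le> lam"
begin

abbreviation "G \<equiv> gaussian_vector J"
abbreviation "W \<equiv> P \<Otimes>\<^sub>M G"

sublocale P: prob_space P by (rule prob_space_P)
sublocale G: prob_space G by (rule prob_space_gaussian_vector)
sublocale W: pair_prob_space P G by unfold_locales
sublocale PP: pair_prob_space P P by unfold_locales

definition obs :: "('j \<Rightarrow> real) \<times> ('j \<Rightarrow> real) \<Rightarrow> 'j \<Rightarrow> real" where
  "obs w = observation J lam (fst w) (snd w)"

lemma obs_nth: "j \<in> J \<Longrightarrow> obs w j = sqrt lam * fst w j + snd w j"
  by (simp add: obs_def observation_def)

lemma am_signal: "j \<in> J \<Longrightarrow> all_moments W (\<lambda>w. fst w j)"
  by (rule all_moments_fst[OF prob_space_P G.prob_space_axioms moments_P])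

lemma am_noise: "j \<in> J \<Longrightarrow> all_moments W (\<lambda>w. snd w j)"
  by (rule all_moments_snd[OF prob_space_P G.prob_space_axioms all_moments_gaussian_vector])

lemma am_obs: "j \<in> J \<Longrightarrow> all_moments W (\<lambda>w. obs w j)"
  by (simp add: obs_nth) (intro all_moments_add W.P.all_moments_cmult am_signal am_noise)

lemma am_hermite_obs: "all_moments W (\<lambda>w. hermite J \<alpha> (obs w))"
  unfolding hermite_def by (intro W.P.all_moments_prod W.P.all_moments_poly am_obs)

lemma am_hermite_noise: "all_moments W (\<lambda>w. hermite J \<alpha> (snd w))"
  unfolding hermite_def by (intro W.P.all_moments_prod W.P.all_moments_poly am_noise)

lemma am_hermite_sum_obs: "all_moments W (\<lambda>w. hermite_sum J D c (obs w))"
  unfolding hermite_sum_def by (intro W.P.all_moments_sum W.P.all_moments_cmult am_hermite_obs)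

lemma am_hermite_sum_noise: "all_moments W (\<lambda>w. hermite_sum J D c (snd w))"
  unfolding hermite_sum_def by (intro W.P.all_moments_sum W.P.all_moments_cmult am_hermite_noise)

definition moment :: "('j \<Rightarrow> nat) \<Rightarrow> real" where
  "moment \<gamma> = (\<integral>x. (\<Prod>j\<in>J. x j ^ \<gamma> j) \<partial>P)"

definition overlap_moment :: "nat \<Rightarrow> real" where
  "overlap_moment k = (\<integral>w. overlap J w ^ k \<partial>(P \<Otimes>\<^sub>M P))"

lemma hermite_obs: "hermite J \<alpha> (obs w) = (\<Prod>j\<in>J. poly (He (\<alpha> j)) (sqrt lam * fst w j + snd w j))"
  unfolding hermite_def by (intro prod.cong) (auto simp: obs_nth)

text \<open>The noise is integrated out first, for a fixed signal. The test function
  \<open>h\<close> covers two uses: \<open>h = 1\<close> gives the cross moments of observation and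
  noise, and a coordinate of the signal gives its correlation with the estimator.\<close>

lemma integral_hermite_cross_fst:
  assumes h: "all_moments P h"
  shows "(\<integral>w. hermite J \<alpha> (obs w) * hermite J \<beta> (snd w) * h (fst w) \<partial>W)
    = (\<integral>x. (\<Prod>j\<in>J. herm_coef (\<alpha> j) (\<beta> j) (sqrt lam * x j)) * h x \<partial>P)"
proof -
  have am: "all_moments W (\<lambda>w. hermite J \<alpha> (obs w) * hermite J \<beta> (snd w) * h (fst w))"
    by (intro all_moments_mult am_hermite_obs am_hermite_noise
        all_moments_fst[OF prob_space_P G.prob_space_axioms h])
  have "(\<integral>w. hermite J \<alpha> (obs w) * hermite J \<beta> (snd w) * h (fst w) \<partial>W)
     = (\<integral>x. (\<integral>z. hermite J \<alpha> (obs (x, z)) * hermite J \<beta> z * h x \<partial>G) \<partial>P)"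
    using W.integral_fst'[OF all_moments_integrable[OF am]] by simp
  then show ?thesis
    using integral_hermite_shift[OF finite_J, of \<alpha> "\<lambda>j. sqrt lam * _ j" \<beta>]
    by (simp add: hermite_obs)
qed

text \<open>Orthogonality is the case of shift zero, where \<open>herm_coef m k 0\<close> is
  \<open>m!\<close> for \<open>k = m\<close> (by \<open>0 ^ 0 = 1\<close>) and zero otherwise.
  Membership in \<open>midx\<close> makes the indices extensional, so distinct ones differ at some
  coordinate in \<open>J\<close>.\<close>

lemma integral_hermite_noise:
  assumes "\<alpha> \<in> midx J D" "\<beta> \<in> midx J D"
  shows "(\<integral>w. hermite J \<alpha> (snd w) * hermite J \<beta> (snd w) \<partial>W)
    = (if \<alpha> = \<beta> then (\<Prod>j\<in>J. fact (\<alpha> j)) else 0)"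
proof -
  have am: "all_moments W (\<lambda>w. hermite J \<alpha> (snd w) * hermite J \<beta> (snd w))"
    by (intro all_moments_mult am_hermite_noise)
  have "(\<integral>w. hermite J \<alpha> (snd w) * hermite J \<beta> (snd w) \<partial>W)
     = (\<integral>x. (\<integral>z. hermite J \<alpha> z * hermite J \<beta> z \<partial>G) \<partial>P)"
    using W.integral_fst'[OF all_moments_integrable[OF am]] by simp
  also have "\<dots> = (\<integral>z. hermite J \<alpha> z * hermite J \<beta> z \<partial>G)"
    by (simp add: P.prob_space)
  also have "\<dots> = (\<Prod>j\<in>J. herm_coef (\<alpha> j) (\<beta> j) 0)"
    using integral_hermite_shift[OF finite_J, of \<alpha> "\<lambda>_. 0" \<beta>] by (simp add: hermite_def)
  also have "\<dots> = (if \<alpha> = \<beta> then (\<Prod>j\<in>J. fact (\<alpha> j)) else 0)"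
  proof (cases "\<alpha> = \<beta>")
    case False
    then obtain j where "j \<in> J" "\<alpha> j \<noteq> \<beta> j"
      using assms PiE_ext[of \<alpha> J "\<lambda>_. {..D}" \<beta>] unfolding midx_def by blast
    then have "herm_coef (\<alpha> j) (\<beta> j) 0 = 0" by (simp add: herm_coef_def)
    then have "(\<Prod>j\<in>J. herm_coef (\<alpha> j) (\<beta> j) 0) = 0"
      using \<open>j \<in> J\<close> finite_J by (intro prod_zero) auto
    then show ?thesis using False by simp
  qed (simp add: herm_coef_def)
  finally show ?thesis .
qed

lemma integral_hermite_sum_noise_sq:
  "(\<integral>w. (hermite_sum J D c (snd w))\<^sup>2 \<partial>W) = (\<Sum>\<alpha>\<in>midx J D. (c \<alpha>)\<^sup>2 * (\<Prod>j\<in>J. fact (\<alpha> j)))"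
proof -
  have fin: "finite (midx J D)" by (rule finite_midx[OF finite_J])
  have am: "integrable W (\<lambda>w. hermite J \<alpha> (snd w) * hermite J \<beta> (snd w))" for \<alpha> \<beta>
    by (rule all_moments_integrable[OF all_moments_mult[OF am_hermite_noise am_hermite_noise]])
  have "(\<integral>w. (hermite_sum J D c (snd w))\<^sup>2 \<partial>W)
    = (\<integral>w. (\<Sum>\<alpha>\<in>midx J D. \<Sum>\<beta>\<in>midx J D. (c \<alpha> * c \<beta>) * (hermite J \<alpha> (snd w) * hermite J \<beta> (snd w))) \<partial>W)"
    by (simp add: power2_eq_square hermite_sum_def sum_product mult_ac)
  also have "\<dots> = (\<Sum>\<alpha>\<in>midx J D. \<Sum>\<beta>\<in>midx J D. (c \<alpha> * c \<beta>) * (\<integral>w. hermite J \<alpha> (snd w) * hermite J \<beta> (snd w) \<partial>W))"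
    by (rule integral_double_sum[OF am])
  also have "\<dots> = (\<Sum>\<alpha>\<in>midx J D. \<Sum>\<beta>\<in>midx J D. if \<alpha> = \<beta> then (c \<alpha>)\<^sup>2 * (\<Prod>j\<in>J. fact (\<alpha> j)) else 0)"
    by (intro sum.cong refl) (simp add: integral_hermite_noise power2_eq_square)
  also have "\<dots> = (\<Sum>\<alpha>\<in>midx J D. (c \<alpha>)\<^sup>2 * (\<Prod>j\<in>J. fact (\<alpha> j)))"
    using fin by (simp add: sum.delta)
  finally show ?thesis .
qed

lemma am_overlap: "all_moments (P \<Otimes>\<^sub>M P) (overlap J)"
proof -
  have "overlap J = (\<lambda>w. \<Sum>j\<in>J. fst w j * snd w j)" by (auto simp: overlap_def)
  then show ?thesis
    by (simp, intro PP.P.all_moments_sum all_moments_mult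
        all_moments_fst[OF prob_space_P prob_space_P] all_moments_snd[OF prob_space_P prob_space_P] moments_P)
qed

lemma am_monomial: "all_moments P (\<lambda>x. (\<Prod>j\<in>J. x j ^ \<gamma> j))"
  by (intro P.all_moments_prod P.all_moments_power moments_P)

text \<open>A squared mean becomes a mean over two independent copies. This is where the pair
  \<open>X, X'\<close>, and with it the overlap, comes in.\<close>

lemma integral_square_pair:
  assumes "all_moments P h"
  shows "(\<integral>x. h x \<partial>P)\<^sup>2 = (\<integral>w. h (fst w) * h (snd w) \<partial>(P \<Otimes>\<^sub>M P))"
proof -
  have am: "all_moments (P \<Otimes>\<^sub>M P) (\<lambda>w. h (fst w) * h (snd w))"
    by (intro all_moments_mult all_moments_fst[OF prob_space_P prob_space_P] 
        all_moments_snd[OF prob_space_P prob_space_P] assms)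
  have "(\<integral>w. h (fst w) * h (snd w) \<partial>(P \<Otimes>\<^sub>M P)) = (\<integral>x. (\<integral>y. h x * h y \<partial>P) \<partial>P)"
    using PP.integral_fst'[OF all_moments_integrable[OF am]] by simp
  then show ?thesis by (simp add: power2_eq_square)
qed

text \<open>After passing to two copies, the sum over multi-indices is the truncated exponential
  series of \<open>u * overlap J w\<close>. It is applied with \<open>h = 1\<close> and
  \<open>u = lam * D\<close> for the perturbation, and with a coordinate \<open>h\<close> and
  \<open>u = lam\<close> for the correlations with the signal.\<close>

lemma sum_moments_square:
  assumes h: "all_moments P h"
  shows "(\<Sum>\<gamma>\<in>midx J D. u ^ (\<Sum>j\<in>J. \<gamma> j) * (\<integral>x. (\<Prod>j\<in>J. x j ^ \<gamma> j) * h x \<partial>P)\<^sup>2 / (\<Prod>j\<in>J. fact (\<gamma> j)))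
    = (\<Sum>k\<le>D. u ^ k / fact k * (\<integral>w. overlap J w ^ k * (h (fst w) * h (snd w)) \<partial>(P \<Otimes>\<^sub>M P)))"
proof -
  let ?m = "\<lambda>\<gamma> x. \<Prod>j\<in>J. x j ^ \<gamma> j"
  let ?H = "\<lambda>w. h (fst w) * h (snd w)"
  have am1: "all_moments P (\<lambda>x. ?m \<gamma> x * h x)" for \<gamma>
    by (intro all_moments_mult am_monomial h)
  have am2: "all_moments (P \<Otimes>\<^sub>M P) (\<lambda>w. f (fst w) * f (snd w))" if "all_moments P f" for f
    by (intro all_moments_mult all_moments_fst[OF prob_space_P prob_space_P] 
        all_moments_snd[OF prob_space_P prob_space_P] that)
  have "(\<Sum>\<gamma>\<in>midx J D. u ^ (\<Sum>j\<in>J. \<gamma> j) * (\<integral>x. ?m \<gamma> x * h x \<partial>P)\<^sup>2 / (\<Prod>j\<in>J. fact (\<gamma> j)))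
    = (\<Sum>\<gamma>\<in>midx J D. (\<integral>w. u ^ (\<Sum>j\<in>J. \<gamma> j) / (\<Prod>j\<in>J. fact (\<gamma> j)) * ((?m \<gamma> (fst w) * h (fst w)) * (?m \<gamma> (snd w) * h (snd w))) \<partial>(P \<Otimes>\<^sub>M P)))"
    by (simp add: integral_square_pair[OF am1])
  also have "\<dots> = (\<integral>w. (\<Sum>\<gamma>\<in>midx J D. u ^ (\<Sum>j\<in>J. \<gamma> j) / (\<Prod>j\<in>J. fact (\<gamma> j)) * ((?m \<gamma> (fst w) * h (fst w)) * (?m \<gamma> (snd w) * h (snd w)))) \<partial>(P \<Otimes>\<^sub>M P))"
    by (rule Bochner_Integration.integral_sum[symmetric])
       (intro all_moments_integrable PP.P.all_moments_cmult am2[OF am1])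
  also have "\<dots> = (\<integral>w. (\<Sum>k\<le>D. u ^ k / fact k * (overlap J w ^ k * ?H w)) \<partial>(P \<Otimes>\<^sub>M P))"
  proof (intro Bochner_Integration.integral_cong refl)
    fix w
    have "(\<Sum>\<gamma>\<in>midx J D. u ^ (\<Sum>j\<in>J. \<gamma> j) / (\<Prod>j\<in>J. fact (\<gamma> j)) * ((?m \<gamma> (fst w) * h (fst w)) * (?m \<gamma> (snd w) * h (snd w))))
      = (\<Sum>\<gamma>\<in>midx J D. (\<Prod>j\<in>J. (u * (fst w j * snd w j)) ^ \<gamma> j / fact (\<gamma> j))) * ?H w"
      unfolding sum_distrib_right
      by (intro sum.cong refl) (simp add: prod_dividef power_mult_distrib prod.distrib power_sum)
    also have "\<dots> = (\<Sum>k\<le>D. (\<Sum>j\<in>J. u * (fst w j * snd w j)) ^ k / fact k) * ?H w"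
      by (simp only: sum_midx_power[OF finite_J])
    also have "(\<Sum>j\<in>J. u * (fst w j * snd w j)) = u * overlap J w"
      by (simp add: overlap_def sum_distrib_left case_prod_beta)
    finally show "(\<Sum>\<gamma>\<in>midx J D. u ^ (\<Sum>j\<in>J. \<gamma> j) / (\<Prod>j\<in>J. fact (\<gamma> j)) * ((?m \<gamma> (fst w) * h (fst w)) * (?m \<gamma> (snd w) * h (snd w))))
      = (\<Sum>k\<le>D. u ^ k / fact k * (overlap J w ^ k * ?H w))"
      by (simp add: sum_distrib_right power_mult_distrib mult.assoc)
  qed
  also have "\<dots> = (\<Sum>k\<le>D. u ^ k / fact k * (\<integral>w. overlap J w ^ k * ?H w \<partial>(P \<Otimes>\<^sub>M P)))"
  proof -
    have "integrable (P \<Otimes>\<^sub>M P) (\<lambda>w. overlap J w ^ k * ?H w)" for k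
      by (rule all_moments_integrable[OF all_moments_mult[OF PP.P.all_moments_power[OF am_overlap] am2[OF h]]])
    then show ?thesis
      by (subst Bochner_Integration.integral_sum) (simp_all only: integrable_mult_right integral_mult_right_zero)
  qed
  finally show ?thesis .
qed

text \<open>Entry of the operator that sends \<open>f\<close> to the mean over the signal of
  \<open>f (sqrt lam * x + z)\<close>, in the Hermite basis without normalisation.\<close>

definition shift_coef :: "('j \<Rightarrow> nat) \<Rightarrow> ('j \<Rightarrow> nat) \<Rightarrow> real" where
  "shift_coef \<alpha> \<beta> = (\<integral>x. (\<Prod>j\<in>J. herm_coef (\<alpha> j) (\<beta> j) (sqrt lam * x j)) \<partial>P)"

lemma shift_coef_eq:
  "shift_coef \<alpha> \<beta> = (if \<forall>j\<in>J. \<beta> j \<le> \<alpha> j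
     then (\<Prod>j\<in>J. fact (\<alpha> j)) / (\<Prod>j\<in>J. fact (\<alpha> j - \<beta> j)) * sqrt lam ^ (\<Sum>j\<in>J. \<alpha> j - \<beta> j) * moment (\<lambda>j\<in>J. \<alpha> j - \<beta> j)
     else 0)"
proof (cases "\<forall>j\<in>J. \<beta> j \<le> \<alpha> j")
  case True
  have "(\<Prod>j\<in>J. herm_coef (\<alpha> j) (\<beta> j) (sqrt lam * x j))
    = (\<Prod>j\<in>J. fact (\<alpha> j)) / (\<Prod>j\<in>J. fact (\<alpha> j - \<beta> j)) * sqrt lam ^ (\<Sum>j\<in>J. \<alpha> j - \<beta> j)
      * (\<Prod>j\<in>J. x j ^ (\<lambda>j\<in>J. \<alpha> j - \<beta> j) j)" for x
    using True by (simp add: herm_coef_def prod.distrib prod_dividef power_mult_distrib power_sum)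
  then show ?thesis using True by (simp add: shift_coef_def moment_def)
next
  case False
  then obtain j where "j \<in> J" "\<alpha> j < \<beta> j" by (auto simp: not_le)
  then have "(\<Prod>j\<in>J. herm_coef (\<alpha> j) (\<beta> j) (sqrt lam * x j)) = 0" for x
    using finite_J by (intro prod_zero) (auto intro!: bexI[of _ j] simp: herm_coef_def)
  then show ?thesis using False by (auto simp: shift_coef_def)
qed

lemma shift_coef_self: "shift_coef \<alpha> \<alpha> = (\<Prod>j\<in>J. fact (\<alpha> j))"
  by (simp add: shift_coef_eq moment_def P.prob_space)

lemma integral_hermite_cross:
  "(\<integral>w. hermite J \<alpha> (obs w) * hermite J \<beta> (snd w) \<partial>W) = shift_coef \<alpha> \<beta>"
  using integral_hermite_cross_fst[of "\<lambda>_. 1" \<alpha> \<beta>] P.all_moments_const[of 1]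
  by (simp add: shift_coef_def)

lemma integral_hermite_sum_cross:
  "(\<integral>w. hermite_sum J D c (obs w) * hermite_sum J D c (snd w) \<partial>W)
    = (\<Sum>\<alpha>\<in>midx J D. \<Sum>\<beta>\<in>midx J D. c \<alpha> * c \<beta> * shift_coef \<alpha> \<beta>)"
proof -
  have am: "integrable W (\<lambda>w. hermite J \<alpha> (obs w) * hermite J \<beta> (snd w))" for \<alpha> \<beta>
    by (rule all_moments_integrable[OF all_moments_mult[OF am_hermite_obs am_hermite_noise]])
  have "(\<integral>w. hermite_sum J D c (obs w) * hermite_sum J D c (snd w) \<partial>W)
    = (\<integral>w. (\<Sum>\<alpha>\<in>midx J D. \<Sum>\<beta>\<in>midx J D. (c \<alpha> * c \<beta>) * (hermite J \<alpha> (obs w) * hermite J \<beta> (snd w))) \<partial>W)"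
    unfolding hermite_sum_def sum_product
    by (intro Bochner_Integration.integral_cong sum.cong refl) (simp only: mult_ac)
  also have "\<dots> = (\<Sum>\<alpha>\<in>midx J D. \<Sum>\<beta>\<in>midx J D. (c \<alpha> * c \<beta>) * (\<integral>w. hermite J \<alpha> (obs w) * hermite J \<beta> (snd w) \<partial>W))"
    by (rule integral_double_sum[OF am])
  finally show ?thesis by (simp add: integral_hermite_cross)
qed

text \<open>One of the two parts into which a matrix entry is split by the inequality of the
  arithmetic and geometric mean. The factor \<open>real D\<close> per derivative placed here is
  compensated by the powers of \<open>1 / real D\<close> in
  \<open>sum_binomial_pairs\<close>.\<close>

definition weight :: "nat \<Rightarrow> ('j \<Rightarrow> nat) \<Rightarrow> real" where
  "weight D \<gamma> = (lam * real D) ^ (\<Sum>j\<in>J. \<gamma> j) * (moment \<gamma>)\<^sup>2 / (\<Prod>j\<in>J. fact (\<gamma> j))"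

lemma weight_nonneg: "0 \<le> weight D \<gamma>"
  unfolding weight_def using lam_nonneg midx_fact_pos[of \<gamma> J]
  by (auto intro!: divide_nonneg_nonneg mult_nonneg_nonneg prod_nonneg)

lemma sum_weight:
  "(\<Sum>\<gamma>\<in>midx J D - {\<lambda>j\<in>J. 0}. weight D \<gamma>) = (\<Sum>k=1..D. (lam * real D) ^ k / fact k * overlap_moment k)"
proof -
  have 0: "(\<lambda>j\<in>J. 0) \<in> midx J D" by (auto simp: midx_def)
  have "(\<Sum>\<gamma>\<in>midx J D. weight D \<gamma>) = (\<Sum>k\<le>D. (lam * real D) ^ k / fact k * overlap_moment k)"
    using sum_moments_square[of "\<lambda>_. 1" "lam * real D" D] P.all_moments_const[of 1]
    by (simp add: weight_def moment_def overlap_moment_def)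
  also have "\<dots> = 1 + (\<Sum>k=1..D. (lam * real D) ^ k / fact k * overlap_moment k)"
  proof -
    have "{..D} = insert 0 {1..D}" by auto
    then show ?thesis by (simp add: overlap_moment_def PP.P.prob_space)
  qed
  finally have "(\<Sum>\<gamma>\<in>midx J D. weight D \<gamma>) = 1 + (\<Sum>k=1..D. (lam * real D) ^ k / fact k * overlap_moment k)" .
  moreover have "weight D (\<lambda>j\<in>J. 0) = 1"
    by (simp add: weight_def moment_def P.prob_space)
  ultimately show ?thesis
    using sum.remove[OF finite_midx[OF finite_J, of D] 0, of "weight D"] by simp
qed

text \<open>By the binomial theorem in each coordinate the sum over all \<open>\<beta>\<close> below
  \<open>\<alpha>\<close> is at most \<open>(1 + 1/D) ^ D\<close>, hence at most 3. The excluded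
  diagonal index contributes exactly 1, which leaves 2.\<close>

lemma sum_binomial_pairs:
  assumes D: "D > 0" and \<alpha>: "\<alpha> \<in> midx J D"
  shows "(\<Sum>\<beta>\<in>{\<beta> \<in> midx J D. (\<forall>j\<in>J. \<beta> j \<le> \<alpha> j) \<and> \<beta> \<noteq> \<alpha>}.
      (\<Prod>j\<in>J. real (\<alpha> j choose \<beta> j) * (1 / real D) ^ (\<alpha> j - \<beta> j))) \<le> 2"
proof -
  let ?f = "\<lambda>\<beta>. \<Prod>j\<in>J. real (\<alpha> j choose \<beta> j) * (1 / real D) ^ (\<alpha> j - \<beta> j)"
  let ?S = "\<Pi>\<^sub>E j\<in>J. {..\<alpha> j}"
  have S: "finite ?S" using finite_J by (intro finite_PiE) auto
  have a: "\<alpha> \<in> ?S" using \<alpha> by (auto simp: midx_def)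
  have "{\<beta> \<in> midx J D. (\<forall>j\<in>J. \<beta> j \<le> \<alpha> j) \<and> \<beta> \<noteq> \<alpha>} \<subseteq> ?S - {\<alpha>}"
    by (auto simp: midx_def PiE_iff extensional_def)
  then have "sum ?f {\<beta> \<in> midx J D. (\<forall>j\<in>J. \<beta> j \<le> \<alpha> j) \<and> \<beta> \<noteq> \<alpha>} \<le> sum ?f (?S - {\<alpha>})"
    using S by (intro sum_mono2) (auto intro!: prod_nonneg)
  also have "\<dots> = sum ?f ?S - 1"
    using sum.remove[OF S a, of ?f] by simp
  also have "sum ?f ?S = (\<Prod>j\<in>J. \<Sum>b\<le>\<alpha> j. real (\<alpha> j choose b) * (1 / real D) ^ (\<alpha> j - b))"
    using finite_J by (intro prod_sum_PiE[symmetric]) auto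
  also have "\<dots> = (\<Prod>j\<in>J. (1 + 1 / real D) ^ \<alpha> j)"
    using binomial_ring[of 1 "1 / real D"] by simp
  also have "\<dots> = (1 + 1 / real D) ^ (\<Sum>j\<in>J. \<alpha> j)" by (simp add: power_sum)
  also have "\<dots> \<le> (1 + 1 / real D) ^ D"
    using \<alpha> by (intro power_increasing) (auto simp: midx_def)
  also have "\<dots> \<le> exp (1 / real D) ^ D"
    by (intro power_mono) (auto simp: add_nonneg_nonneg)
  also have "\<dots> = exp 1" using D by (simp add: exp_of_nat_mult[symmetric])
  also have "\<dots> \<le> 3" by (rule exp_le)
  finally show ?thesis by simp
qed

text \<open>For fixed \<open>\<beta>\<close> the difference \<open>\<alpha> - \<beta>\<close>
  determines \<open>\<alpha>\<close> and is a nonzero multi-index of degree at most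
  \<open>D\<close>. Weights are nonnegative, so extending the sum to all such multi-indices can only
  enlarge it.\<close>

lemma sum_weight_pairs:
  assumes \<beta>: "\<beta> \<in> midx J D"
  shows "(\<Sum>\<alpha>\<in>{\<alpha> \<in> midx J D. (\<forall>j\<in>J. \<beta> j \<le> \<alpha> j) \<and> \<beta> \<noteq> \<alpha>}. weight D (\<lambda>j\<in>J. \<alpha> j - \<beta> j))
    \<le> (\<Sum>\<gamma>\<in>midx J D - {\<lambda>j\<in>J. 0}. weight D \<gamma>)"
proof -
  let ?A = "{\<alpha> \<in> midx J D. (\<forall>j\<in>J. \<beta> j \<le> \<alpha> j) \<and> \<beta> \<noteq> \<alpha>}"
  let ?d = "\<lambda>\<alpha>. \<lambda>j\<in>J. \<alpha> j - \<beta> j"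
  have ext: "\<alpha> = \<alpha>'" if "\<alpha> \<in> midx J D" "\<alpha>' \<in> midx J D" "\<And>j. j \<in> J \<Longrightarrow> \<alpha> j = \<alpha>' j" for \<alpha> \<alpha>'
    using that PiE_ext[of \<alpha> J "\<lambda>_. {..D}" \<alpha>'] unfolding midx_def by blast
  have inj: "inj_on ?d ?A"
  proof (rule inj_onI)
    fix \<alpha> \<alpha>' assume *: "\<alpha> \<in> ?A" "\<alpha>' \<in> ?A" "?d \<alpha> = ?d \<alpha>'"
    show "\<alpha> = \<alpha>'"
    proof (rule ext)
      fix j assume j: "j \<in> J"
      have "\<alpha> j - \<beta> j = \<alpha>' j - \<beta> j" using fun_cong[OF *(3), of j] j by simp
      moreover have "\<beta> j \<le> \<alpha> j" "\<beta> j \<le> \<alpha>' j" using * j by auto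
      ultimately show "\<alpha> j = \<alpha>' j" by linarith
    qed (use * in auto)
  qed
  have sub: "?d ` ?A \<subseteq> midx J D - {\<lambda>j\<in>J. 0}"
  proof
    fix \<gamma> assume "\<gamma> \<in> ?d ` ?A"
    then obtain \<alpha> where \<alpha>: "\<alpha> \<in> ?A" and \<gamma>: "\<gamma> = ?d \<alpha>" by blast
    have "(\<Sum>j\<in>J. \<gamma> j) \<le> (\<Sum>j\<in>J. \<alpha> j)" unfolding \<gamma> by (intro sum_mono) auto
    moreover have "\<gamma> j \<le> D" if "j \<in> J" for j
    proof -
      have "\<alpha> j \<le> D" using \<alpha> that by (auto simp: midx_def)
      then show ?thesis using that by (simp add: \<gamma>)
    qed
    ultimately have "\<gamma> \<in> midx J D" using \<alpha> by (auto simp: midx_def \<gamma>)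
    moreover have "\<gamma> \<noteq> (\<lambda>j\<in>J. 0)"
    proof
      assume "\<gamma> = (\<lambda>j\<in>J. 0)"
      then have "\<alpha> j - \<beta> j = 0" if "j \<in> J" for j
        using that \<gamma> by (metis (no_types, lifting) restrict_apply')
      moreover have "\<beta> j \<le> \<alpha> j" if "j \<in> J" for j using \<alpha> that by auto
      ultimately have "\<alpha> = \<beta>" using \<alpha> \<beta> by (intro ext) (auto intro: le_antisym)
      then show False using \<alpha> by auto
    qed
    ultimately show "\<gamma> \<in> midx J D - {\<lambda>j\<in>J. 0}" by simp
  qed
  have "(\<Sum>\<alpha>\<in>?A. weight D (?d \<alpha>)) = sum (weight D) (?d ` ?A)"
    using inj by (simp add: sum.reindex)
  also have "\<dots> \<le> sum (weight D) (midx J D - {\<lambda>j\<in>J. 0})"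
    using sub finite_midx[OF finite_J] by (intro sum_mono2) (auto simp: weight_nonneg)
  finally show ?thesis .
qed

text \<open>The square of the entry factors as \<open>X * Y\<close>, where \<open>X\<close> carries
  the coefficient at \<open>\<beta>\<close> and \<open>Y\<close> the one at \<open>\<alpha>\<close>;
  its root is at most \<open>(X + Y) / 2\<close>. The first part can be summed over
  \<open>\<alpha>\<close>, the second over \<open>\<beta>\<close>.\<close>

lemma abs_cross_term_le:
  assumes D: "D > 0" and le: "\<forall>j\<in>J. \<beta> j \<le> \<alpha> j"
  shows "\<bar>c \<alpha> * c \<beta> * shift_coef \<alpha> \<beta>\<bar> \<le>
    2 * ((c \<beta>)\<^sup>2 * (\<Prod>j\<in>J. fact (\<beta> j))) * weight D (\<lambda>j\<in>J. \<alpha> j - \<beta> j)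
    + ((c \<alpha>)\<^sup>2 * (\<Prod>j\<in>J. fact (\<alpha> j))) / 8 * (\<Prod>j\<in>J. real (\<alpha> j choose \<beta> j) * (1 / real D) ^ (\<alpha> j - \<beta> j))"
proof -
  let ?g = "\<lambda>j\<in>J. \<alpha> j - \<beta> j"
  let ?s = "\<Sum>j\<in>J. \<alpha> j - \<beta> j"
  define A B C m :: real where "A = (\<Prod>j\<in>J. fact (\<alpha> j))" and "B = (\<Prod>j\<in>J. fact (\<beta> j))"
    and "C = (\<Prod>j\<in>J. fact (\<alpha> j - \<beta> j))" and "m = moment ?g"
  \<comment> \<open>The constants 4 and 1/4 balance the two later sums: weights adding up to at most
    1/8 and binomial sums of at most 2 then cost a quarter of the diagonal each.\<close>
  define X Y where "X = 4 * ((c \<beta>)\<^sup>2 * B) * weight D ?g"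
    and "Y = ((c \<alpha>)\<^sup>2 * A) / 4 * (\<Prod>j\<in>J. real (\<alpha> j choose \<beta> j) * (1 / real D) ^ (\<alpha> j - \<beta> j))"
  have pos: "A > 0" "B > 0" "C > 0" unfolding A_def B_def C_def by (rule midx_fact_pos)+
  have w: "weight D ?g = (lam * real D) ^ ?s * m\<^sup>2 / C"
    by (simp add: weight_def m_def C_def)
  have ch: "(\<Prod>j\<in>J. real (\<alpha> j choose \<beta> j) * (1 / real D) ^ (\<alpha> j - \<beta> j)) = A / (B * C) * (1 / real D) ^ ?s"
  proof -
    have "(\<Prod>j\<in>J. real (\<alpha> j choose \<beta> j)) = (\<Prod>j\<in>J. fact (\<alpha> j) / (fact (\<beta> j) * fact (\<alpha> j - \<beta> j)))"
      using le by (intro prod.cong refl) (simp add: binomial_fact)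
    then show ?thesis by (simp add: prod.distrib prod_dividef A_def B_def C_def power_sum)
  qed
  have sc: "shift_coef \<alpha> \<beta> = A / C * sqrt lam ^ ?s * m"
    using le by (simp add: shift_coef_eq A_def C_def m_def)
  have X0: "0 \<le> X" unfolding X_def using weight_nonneg pos by (intro mult_nonneg_nonneg) auto
  have Y0: "0 \<le> Y" unfolding Y_def ch using pos by (intro mult_nonneg_nonneg divide_nonneg_nonneg) auto
  have "(c \<alpha> * c \<beta> * shift_coef \<alpha> \<beta>)\<^sup>2 = (c \<alpha>)\<^sup>2 * (c \<beta>)\<^sup>2 * (A\<^sup>2 / C\<^sup>2) * lam ^ ?s * m\<^sup>2"
  proof -
    have "(sqrt lam ^ ?s)\<^sup>2 = lam ^ ?s"
      using lam_nonneg by (simp add: power_mult[symmetric] mult.commute[of _ 2]) (simp add: power_mult)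
    then show ?thesis by (simp add: sc power_mult_distrib power_divide)
  qed
  also have "\<dots> = X * Y"
  proof -
    have "(lam * real D) ^ ?s * (1 / real D) ^ ?s = lam ^ ?s"
      using D by (simp add: power_mult_distrib power_one_over)
    moreover have "X * Y = (c \<alpha>)\<^sup>2 * (c \<beta>)\<^sup>2 * (A\<^sup>2 / C\<^sup>2) * ((lam * real D) ^ ?s * (1 / real D) ^ ?s) * m\<^sup>2"
      unfolding X_def Y_def w ch using pos by (simp add: field_simps power2_eq_square)
    ultimately show ?thesis by simp
  qed
  finally have sq: "(c \<alpha> * c \<beta> * shift_coef \<alpha> \<beta>)\<^sup>2 = X * Y" .
  have "X * Y \<le> ((X + Y) / 2)\<^sup>2"
    using sum_squares_bound[of X Y] by (simp add: power2_eq_square field_simps)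
  then have "\<bar>c \<alpha> * c \<beta> * shift_coef \<alpha> \<beta>\<bar>\<^sup>2 \<le> ((X + Y) / 2)\<^sup>2"
    by (simp only: power2_abs sq)
  then have "\<bar>c \<alpha> * c \<beta> * shift_coef \<alpha> \<beta>\<bar> \<le> (X + Y) / 2"
    by (rule power2_le_imp_le) (use X0 Y0 in simp)
  moreover have "(4 * u * v + t / 4 * s) / 2 = 2 * u * v + t / 8 * s" for u v t s :: real
    by simp
  ultimately show ?thesis unfolding X_def Y_def A_def B_def by simp
qed

text \<open>In the Hermite basis the cross moment \<open>E[f(Y) f(Z)]\<close> is triangular, with diagonal \<open>E[f(Z)\<^sup>2]\<close>.
  When the off-diagonal part is at most half of the diagonal, \<open>0 \<le> E[(f(Y) - f(Z) / 2)\<^sup>2]\<close> gives the bound.\<close>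

lemma hermite_sum_obs_sq_ge:
  assumes D: "D > 0"
    and small: "(\<Sum>k=1..D. (lam * real D) ^ k / fact k * overlap_moment k) \<le> 1/8"
  shows "(\<Sum>\<alpha>\<in>midx J D. (c \<alpha>)\<^sup>2 * (\<Prod>j\<in>J. fact (\<alpha> j))) / 4 \<le> (\<integral>w. (hermite_sum J D c (obs w))\<^sup>2 \<partial>W)"
proof -
  let ?A = "midx J D"
  let ?v = "\<lambda>\<alpha>. (c \<alpha>)\<^sup>2 * (\<Prod>j\<in>J. fact (\<alpha> j) :: real)"
  let ?d = "\<lambda>\<alpha> \<beta>. \<lambda>j\<in>J. \<alpha> j - \<beta> j"
  let ?b = "\<lambda>\<alpha> \<beta>. (\<Prod>j\<in>J. real (\<alpha> j choose \<beta> j) * (1 / real D) ^ (\<alpha> j - \<beta> j))"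
  let ?R = "\<lambda>\<alpha> \<beta>. (\<forall>j\<in>J. \<beta> j \<le> \<alpha> j) \<and> \<beta> \<noteq> \<alpha>"
  define V where "V = sum ?v ?A"
  define B where "B = (\<Sum>\<alpha>\<in>?A. \<Sum>\<beta>\<in>?A. c \<alpha> * c \<beta> * shift_coef \<alpha> \<beta>)"
  have fin: "finite ?A" by (rule finite_midx[OF finite_J])
  have v0: "0 \<le> ?v \<alpha>" for \<alpha> using midx_fact_pos[of \<alpha> J] by (intro mult_nonneg_nonneg) auto
  \<comment> \<open>Conditionals make this one bound cover diagonal, comparable and incomparable
    pairs (whose entry is zero), so that the double sum splits into three sums over the full
    square.\<close>
  have entry: "c \<alpha> * c \<beta> * shift_coef \<alpha> \<beta> \<ge> (if \<alpha> = \<beta> then ?v \<alpha> else 0)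
      - (if ?R \<alpha> \<beta> then 2 * ?v \<beta> * weight D (?d \<alpha> \<beta>) else 0)
      - (if ?R \<alpha> \<beta> then ?v \<alpha> / 8 * ?b \<alpha> \<beta> else 0)" for \<alpha> \<beta>
  proof -
    consider "\<alpha> = \<beta>" | "\<alpha> \<noteq> \<beta>" "\<forall>j\<in>J. \<beta> j \<le> \<alpha> j" | "\<alpha> \<noteq> \<beta>" "\<not> (\<forall>j\<in>J. \<beta> j \<le> \<alpha> j)" by blast
    then show ?thesis
    proof cases
      case 1 then show ?thesis by (simp add: shift_coef_self power2_eq_square)
    next
      case 2
      have "\<bar>c \<alpha> * c \<beta> * shift_coef \<alpha> \<beta>\<bar> \<le> 2 * ?v \<beta> * weight D (?d \<alpha> \<beta>) + ?v \<alpha> / 8 * ?b \<alpha> \<beta>"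
        by (rule abs_cross_term_le[OF D 2(2)])
      moreover have e0: "(if \<alpha> = \<beta> then ?v \<alpha> else 0) = 0" using 2 by simp
      moreover have e: "(if ?R \<alpha> \<beta> then u else 0) = u" for u :: real using 2 by auto
      ultimately show ?thesis unfolding e e0 by linarith
    next
      case 3
      have e0: "(if \<alpha> = \<beta> then ?v \<alpha> else 0) = 0" "shift_coef \<alpha> \<beta> = 0" using 3 by (auto simp: shift_coef_eq)
      have e: "(if ?R \<alpha> \<beta> then u else 0) = 0" for u :: real using 3(2) by (intro if_not_P) blast
      show ?thesis unfolding e e0 by simp
    qed
  qed
  have "(\<Sum>\<alpha>\<in>?A. \<Sum>\<beta>\<in>?A. if \<alpha> = \<beta> then ?v \<alpha> else 0) = V"
    using fin by (simp add: V_def sum.delta)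
  moreover have "(\<Sum>\<alpha>\<in>?A. \<Sum>\<beta>\<in>?A. if ?R \<alpha> \<beta> then 2 * ?v \<beta> * weight D (?d \<alpha> \<beta>) else 0) \<le> V / 4"
  proof -
    \<comment> \<open>Here \<open>\<beta>\<close> is held fixed while the weights are summed over
      \<open>\<alpha>\<close>. The binomial part below is summed over \<open>\<beta>\<close> for
      fixed \<open>\<alpha>\<close>, so only this sum is exchanged.\<close>
    have "(\<Sum>\<alpha>\<in>?A. \<Sum>\<beta>\<in>?A. if ?R \<alpha> \<beta> then 2 * ?v \<beta> * weight D (?d \<alpha> \<beta>) else 0)
      = (\<Sum>\<beta>\<in>?A. \<Sum>\<alpha>\<in>?A. if ?R \<alpha> \<beta> then 2 * ?v \<beta> * weight D (?d \<alpha> \<beta>) else 0)"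
      by (rule sum.swap)
    also have "\<dots> = (\<Sum>\<beta>\<in>?A. 2 * ?v \<beta> * (\<Sum>\<alpha>\<in>{\<alpha> \<in> ?A. ?R \<alpha> \<beta>}. weight D (?d \<alpha> \<beta>)))"
      using fin by (simp add: sum.inter_filter[symmetric] sum_distrib_left)
    also have "\<dots> \<le> (\<Sum>\<beta>\<in>?A. 2 * ?v \<beta> * (1/8))"
    proof (intro sum_mono mult_left_mono)
      fix \<beta> assume "\<beta> \<in> ?A"
      from sum_weight_pairs[OF this] show "(\<Sum>\<alpha>\<in>{\<alpha> \<in> ?A. ?R \<alpha> \<beta>}. weight D (?d \<alpha> \<beta>)) \<le> 1/8"
        using small by (simp add: sum_weight)
    qed (use v0 in simp)
    also have "\<dots> = V / 4" by (simp add: V_def sum_divide_distrib[symmetric] mult.commute)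
    finally show ?thesis .
  qed
  moreover have "(\<Sum>\<alpha>\<in>?A. \<Sum>\<beta>\<in>?A. if ?R \<alpha> \<beta> then ?v \<alpha> / 8 * ?b \<alpha> \<beta> else 0) \<le> V / 4"
  proof -
    have "(\<Sum>\<alpha>\<in>?A. \<Sum>\<beta>\<in>?A. if ?R \<alpha> \<beta> then ?v \<alpha> / 8 * ?b \<alpha> \<beta> else 0)
      = (\<Sum>\<alpha>\<in>?A. ?v \<alpha> / 8 * (\<Sum>\<beta>\<in>{\<beta> \<in> ?A. ?R \<alpha> \<beta>}. ?b \<alpha> \<beta>))"
      by (simp only: sum.inter_filter[OF fin, symmetric] sum_distrib_left)
    also have "\<dots> \<le> (\<Sum>\<alpha>\<in>?A. ?v \<alpha> / 8 * 2)"
      using v0 by (intro sum_mono mult_left_mono sum_binomial_pairs D) auto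
    also have "\<dots> = V / 4" by (simp add: V_def sum_divide_distrib[symmetric] mult.commute)
    finally show ?thesis .
  qed
  moreover have "B \<ge> (\<Sum>\<alpha>\<in>?A. \<Sum>\<beta>\<in>?A. (if \<alpha> = \<beta> then ?v \<alpha> else 0)
      - (if ?R \<alpha> \<beta> then 2 * ?v \<beta> * weight D (?d \<alpha> \<beta>) else 0)
      - (if ?R \<alpha> \<beta> then ?v \<alpha> / 8 * ?b \<alpha> \<beta> else 0))"
    unfolding B_def by (intro sum_mono entry)
  ultimately have B: "V / 2 \<le> B" by (simp only: sum_subtractf)
  let ?Y = "\<lambda>w. hermite_sum J D c (obs w)" and ?Z = "\<lambda>w. hermite_sum J D c (snd w)"
  have int: "integrable W (\<lambda>w. (?Y w)\<^sup>2)" "integrable W (\<lambda>w. ?Y w * ?Z w)" "integrable W (\<lambda>w. (?Z w)\<^sup>2)"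
    by (intro all_moments_integrable W.P.all_moments_power all_moments_mult am_hermite_sum_obs am_hermite_sum_noise)+
  have "0 \<le> (\<integral>w. (?Y w - ?Z w / 2)\<^sup>2 \<partial>W)" by simp
  also have "\<dots> = (\<integral>w. (?Y w)\<^sup>2 - ?Y w * ?Z w + (?Z w)\<^sup>2 / 4 \<partial>W)"
    by (intro Bochner_Integration.integral_cong refl) (simp add: power2_eq_square algebra_simps)
  also have "\<dots> = (\<integral>w. (?Y w)\<^sup>2 \<partial>W) - B + V / 4"
    using int integral_hermite_sum_cross[of D c] integral_hermite_sum_noise_sq[of D c]
    by (simp add: B_def V_def)
  finally show ?thesis using B by (simp add: V_def)
qed

text \<open>The constant 1 is the Hermite polynomial of index zero, and
  \<open>herm_coef m 0 x = x ^ m\<close>, so only plain moments of the signal remain.\<close>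

lemma integral_hermite_sum_signal:
  assumes h: "all_moments P h"
  shows "(\<integral>w. hermite_sum J D c (obs w) * h (fst w) \<partial>W)
    = (\<Sum>\<alpha>\<in>midx J D. c \<alpha> * (sqrt lam ^ (\<Sum>j\<in>J. \<alpha> j) * (\<integral>x. (\<Prod>j\<in>J. x j ^ \<alpha> j) * h x \<partial>P)))"
proof -
  have am: "all_moments W (\<lambda>w. hermite J \<alpha> (obs w) * h (fst w))" for \<alpha>
    by (intro all_moments_mult am_hermite_obs all_moments_fst[OF prob_space_P G.prob_space_axioms h])
  have one: "hermite J (\<lambda>_. 0) z = 1" for z by (simp add: hermite_def)
  have "(\<integral>w. hermite_sum J D c (obs w) * h (fst w) \<partial>W)
    = (\<integral>w. (\<Sum>\<alpha>\<in>midx J D. c \<alpha> * (hermite J \<alpha> (obs w) * h (fst w))) \<partial>W)"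
    by (simp add: hermite_sum_def sum_distrib_right mult.assoc)
  also have "\<dots> = (\<Sum>\<alpha>\<in>midx J D. \<integral>w. c \<alpha> * (hermite J \<alpha> (obs w) * h (fst w)) \<partial>W)"
    by (rule Bochner_Integration.integral_sum) (rule integrable_mult_right[OF all_moments_integrable[OF am]])
  also have "\<dots> = (\<Sum>\<alpha>\<in>midx J D. c \<alpha> * (\<integral>x. (\<Prod>j\<in>J. herm_coef (\<alpha> j) 0 (sqrt lam * x j)) * h x \<partial>P))"
    using integral_hermite_cross_fst[OF h, of _ "\<lambda>_. 0"] by (simp add: one)
  also have "\<dots> = (\<Sum>\<alpha>\<in>midx J D. c \<alpha> * (\<integral>x. sqrt lam ^ (\<Sum>j\<in>J. \<alpha> j) * ((\<Prod>j\<in>J. x j ^ \<alpha> j) * h x) \<partial>P))"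
    by (simp add: herm_coef_def power_mult_distrib prod.distrib power_sum mult_ac)
  finally show ?thesis by simp
qed

text \<open>Once the second moment of the estimator is replaced by a diagonal quadratic form in its
  coefficients, the minimisation decouples: each coefficient contributes at least the minimum of a
  parabola, and the resulting bound is the same for all \<open>p\<close>.\<close>

lemma coordinate_error_ge:
  assumes D: "D > 0" and j: "j \<in> J" and p: "p \<in> polynomials_upto J D"
    and small: "(\<Sum>k=1..D. (lam * real D) ^ k / fact k * overlap_moment k) \<le> 1/8"
  shows "(\<integral>w. (p (obs w) - fst w j)\<^sup>2 \<partial>W)
    \<ge> (\<integral>x. (x j)\<^sup>2 \<partial>P) - 4 * (\<Sum>k\<le>D. lam ^ k / fact k * (\<integral>w. overlap J w ^ k * (fst w j * snd w j) \<partial>(P \<Otimes>\<^sub>M P)))"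
proof -
  obtain c where p: "p = hermite_sum J D c" by (rule polynomials_upto_hermite[OF finite_J p])
  let ?A = "midx J D"
  let ?F = "\<lambda>\<alpha>. (\<Prod>j\<in>J. fact (\<alpha> j) :: real)"
  define m where "m \<alpha> = sqrt lam ^ (\<Sum>j\<in>J. \<alpha> j) * (\<integral>x. (\<Prod>j\<in>J. x j ^ \<alpha> j) * x j \<partial>P)" for \<alpha>
  let ?Y = "\<lambda>w. p (obs w)"
  have am: "all_moments W ?Y" "all_moments W (\<lambda>w. fst w j)"
    unfolding p by (intro am_hermite_sum_obs am_signal j)+
  have int: "integrable W (\<lambda>w. (?Y w)\<^sup>2)" "integrable W (\<lambda>w. ?Y w * fst w j)" "integrable W (\<lambda>w. (fst w j)\<^sup>2)"
    by (intro all_moments_integrable W.P.all_moments_power all_moments_mult am)+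
  have x2: "(\<integral>w. (fst w j)\<^sup>2 \<partial>W) = (\<integral>x. (x j)\<^sup>2 \<partial>P)"
    using W.integral_fst'[OF int(3)] by (simp add: G.prob_space)
  have "(\<integral>w. (?Y w - fst w j)\<^sup>2 \<partial>W) = (\<integral>w. (?Y w)\<^sup>2 - 2 * (?Y w * fst w j) + (fst w j)\<^sup>2 \<partial>W)"
    by (intro Bochner_Integration.integral_cong refl) (simp add: power2_eq_square algebra_simps)
  also have "\<dots> = (\<integral>w. (?Y w)\<^sup>2 \<partial>W) - 2 * (\<Sum>\<alpha>\<in>?A. c \<alpha> * m \<alpha>) + (\<integral>x. (x j)\<^sup>2 \<partial>P)"
    using int integral_hermite_sum_signal[OF moments_P[OF j], of D c]
    by (simp add: x2 p m_def)
  also have "\<dots> \<ge> (\<Sum>\<alpha>\<in>?A. (c \<alpha>)\<^sup>2 * ?F \<alpha>) / 4 - 2 * (\<Sum>\<alpha>\<in>?A. c \<alpha> * m \<alpha>) + (\<integral>x. (x j)\<^sup>2 \<partial>P)"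
    using hermite_sum_obs_sq_ge[OF D small, of c] by (simp add: p)
  also have "(\<Sum>\<alpha>\<in>?A. (c \<alpha>)\<^sup>2 * ?F \<alpha>) / 4 - 2 * (\<Sum>\<alpha>\<in>?A. c \<alpha> * m \<alpha>) + (\<integral>x. (x j)\<^sup>2 \<partial>P)
     = (\<Sum>\<alpha>\<in>?A. (c \<alpha>)\<^sup>2 * ?F \<alpha> / 4 - 2 * (c \<alpha> * m \<alpha>)) + (\<integral>x. (x j)\<^sup>2 \<partial>P)"
    by (simp add: sum_subtractf sum_divide_distrib sum_distrib_left)
  finally have 1: "(\<Sum>\<alpha>\<in>?A. (c \<alpha>)\<^sup>2 * ?F \<alpha> / 4 - 2 * (c \<alpha> * m \<alpha>)) + (\<integral>x. (x j)\<^sup>2 \<partial>P)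
    \<le> (\<integral>w. (?Y w - fst w j)\<^sup>2 \<partial>W)" .
  \<comment> \<open>The parabola \<open>F * c^2 / 4 - 2 * c * m\<close> has its minimum at
    \<open>c = 4 * m / F\<close>; the square below is completed around that point.\<close>
  have "- 4 * ((m \<alpha>)\<^sup>2 / ?F \<alpha>) \<le> (c \<alpha>)\<^sup>2 * ?F \<alpha> / 4 - 2 * (c \<alpha> * m \<alpha>)" for \<alpha>
  proof -
    have F: "?F \<alpha> > 0" by (rule midx_fact_pos)
    have "0 \<le> (c \<alpha> * ?F \<alpha> / 2 - 2 * m \<alpha>)\<^sup>2 / ?F \<alpha>" using F by (intro divide_nonneg_pos) auto
    also have "\<dots> = (c \<alpha>)\<^sup>2 * ?F \<alpha> / 4 - 2 * (c \<alpha> * m \<alpha>) + 4 * ((m \<alpha>)\<^sup>2 / ?F \<alpha>)"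
      using F by (simp add: power2_eq_square field_simps)
    finally show ?thesis by linarith
  qed
  then have "(\<Sum>\<alpha>\<in>?A. - 4 * ((m \<alpha>)\<^sup>2 / ?F \<alpha>)) \<le> (\<Sum>\<alpha>\<in>?A. (c \<alpha>)\<^sup>2 * ?F \<alpha> / 4 - 2 * (c \<alpha> * m \<alpha>))"
    by (intro sum_mono)
  moreover have "(\<Sum>\<alpha>\<in>?A. - 4 * ((m \<alpha>)\<^sup>2 / ?F \<alpha>)) = - 4 * (\<Sum>\<alpha>\<in>?A. (m \<alpha>)\<^sup>2 / ?F \<alpha>)"
    by (rule sum_distrib_left[symmetric])
  moreover have "(\<Sum>\<alpha>\<in>?A. (m \<alpha>)\<^sup>2 / ?F \<alpha>)
    = (\<Sum>k\<le>D. lam ^ k / fact k * (\<integral>w. overlap J w ^ k * (fst w j * snd w j) \<partial>(P \<Otimes>\<^sub>M P)))"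
  proof -
    have "(sqrt lam ^ k)\<^sup>2 = lam ^ k" for k
      using lam_nonneg by (simp add: power_mult[symmetric] mult.commute[of _ 2]) (simp add: power_mult)
    then show ?thesis
      using sum_moments_square[OF moments_P[OF j], of lam D] by (simp add: m_def power_mult_distrib)
  qed
  ultimately show ?thesis using 1 by simp
qed

section \<open>Bounds for the low-degree MMSE\<close>

lemma MMSE_nonempty: "J \<rightarrow>\<^sub>E polynomials_upto J D \<noteq> {}"
  unfolding polynomials_upto_def by (auto simp: PiE_eq_empty_iff)

lemma integral_error_sum:
  assumes f: "f \<in> J \<rightarrow>\<^sub>E polynomials_upto J D"
  shows "(\<integral>(x, z). (\<Sum>j\<in>J. (f j (observation J lam x z) - x j)\<^sup>2) \<partial>W)
    = (\<Sum>j\<in>J. \<integral>w. (f j (obs w) - fst w j)\<^sup>2 \<partial>W)"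
proof -
  have "integrable W (\<lambda>w. (f j (obs w) - fst w j)\<^sup>2)" if j: "j \<in> J" for j
  proof -
    obtain c where "f j = hermite_sum J D c"
      using polynomials_upto_hermite[OF finite_J, of "f j" D] f j by (auto simp: PiE_iff)
    then show ?thesis
      by (simp, intro all_moments_integrable W.P.all_moments_power W.P.all_moments_diff am_hermite_sum_obs am_signal j)
  qed
  then have "(\<integral>w. (\<Sum>j\<in>J. (f j (obs w) - fst w j)\<^sup>2) \<partial>W) = (\<Sum>j\<in>J. \<integral>w. (f j (obs w) - fst w j)\<^sup>2 \<partial>W)"
    by (rule Bochner_Integration.integral_sum)
  then show ?thesis by (simp only: obs_def case_prod_beta')
qed

lemma second_moment_eq: "second_moment J P = (\<Sum>j\<in>J. \<integral>x. (x j)\<^sup>2 \<partial>P)"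
  unfolding second_moment_def
  by (intro Bochner_Integration.integral_sum all_moments_integrable P.all_moments_power moments_P)

text \<open>Summing the coordinate bounds over \<open>j\<close> multiplies
  \<open>overlap ^ k\<close> by the sum of the \<open>x j * x' j\<close>, that is, by one more
  overlap; hence the moment of order \<open>Suc k\<close>. The coordinate bounds do not depend on
  the estimator, so they pass to the infimum.\<close>

theorem MMSE_ge:
  assumes D: "D > 0"
    and small: "(\<Sum>k=1..D. (lam * real D) ^ k / fact k * overlap_moment k) \<le> 1/8"
  shows "MMSE J P D lam \<ge> second_moment J P - 4 * (\<Sum>k\<le>D. lam ^ k / fact k * overlap_moment (Suc k))"
  unfolding MMSE_def
proof (rule cINF_greatest[OF MMSE_nonempty])
  fix f assume f: "f \<in> J \<rightarrow>\<^sub>E polynomials_upto J D"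
  have am: "all_moments (P \<Otimes>\<^sub>M P) (\<lambda>w. overlap J w ^ k * (fst w j * snd w j))" if "j \<in> J" for j k
    by (intro all_moments_mult PP.P.all_moments_power am_overlap
        all_moments_fst[OF prob_space_P prob_space_P] all_moments_snd[OF prob_space_P prob_space_P] moments_P that)
  have ov: "(\<Sum>j\<in>J. \<integral>w. overlap J w ^ k * (fst w j * snd w j) \<partial>(P \<Otimes>\<^sub>M P)) = overlap_moment (Suc k)" for k
    unfolding overlap_moment_def
  proof (subst Bochner_Integration.integral_sum[symmetric])
    show "(\<integral>w. (\<Sum>j\<in>J. overlap J w ^ k * (fst w j * snd w j)) \<partial>(P \<Otimes>\<^sub>M P)) = (\<integral>w. overlap J w ^ Suc k \<partial>(P \<Otimes>\<^sub>M P))"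
      by (simp only: sum_distrib_left[symmetric] overlap_def case_prod_beta power_Suc2)
  qed (intro all_moments_integrable am)
  have "second_moment J P - 4 * (\<Sum>k\<le>D. lam ^ k / fact k * overlap_moment (Suc k))
    = (\<Sum>j\<in>J. (\<integral>x. (x j)\<^sup>2 \<partial>P) - 4 * (\<Sum>k\<le>D. lam ^ k / fact k * (\<integral>w. overlap J w ^ k * (fst w j * snd w j) \<partial>(P \<Otimes>\<^sub>M P))))"
  proof -
    have "(\<Sum>k\<le>D. lam ^ k / fact k * overlap_moment (Suc k))
      = (\<Sum>k\<le>D. \<Sum>j\<in>J. lam ^ k / fact k * (\<integral>w. overlap J w ^ k * (fst w j * snd w j) \<partial>(P \<Otimes>\<^sub>M P)))"
      by (simp only: ov[symmetric] sum_distrib_left)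
    also have "\<dots> = (\<Sum>j\<in>J. \<Sum>k\<le>D. lam ^ k / fact k * (\<integral>w. overlap J w ^ k * (fst w j * snd w j) \<partial>(P \<Otimes>\<^sub>M P)))"
      by (rule sum.swap)
    finally show ?thesis
      by (simp only: sum_subtractf second_moment_eq sum_distrib_left[symmetric])
  qed
  also have "\<dots> \<le> (\<Sum>j\<in>J. \<integral>w. (f j (obs w) - fst w j)\<^sup>2 \<partial>W)"
    using f by (intro sum_mono coordinate_error_ge[OF D _ _ small]) (auto simp: PiE_iff)
  finally show "second_moment J P - 4 * (\<Sum>k\<le>D. lam ^ k / fact k * overlap_moment (Suc k))
    \<le> (\<integral>(x, z). (\<Sum>j\<in>J. (f j (observation J lam x z) - x j)\<^sup>2) \<partial>W)"
    by (simp only: integral_error_sum[OF f])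
qed

text \<open>The competitor is the constant estimator given by the mean of each coordinate.\<close>

lemma MMSE_le_trivial: "MMSE J P D lam \<le> MMSE_trivial J P"
proof -
  define f where "f = (\<lambda>j\<in>J. \<lambda>y :: 'j \<Rightarrow> real. \<integral>x. x j \<partial>P)"
  have const: "(\<lambda>y. a) \<in> polynomials_upto J D" for a
  proof -
    \<comment> \<open>A constant is a polynomial whose only coefficient sits at the zero
      multi-index, written as an extensional function.\<close>
    let ?c = "\<lambda>\<alpha>. if \<alpha> = (\<lambda>j\<in>J. 0) then a else 0"
    have 0: "(\<lambda>j\<in>J. 0) \<in> midx J D" by (auto simp: midx_def)
    have "(\<Sum>\<alpha>\<in>midx J D. ?c \<alpha> * (\<Prod>j\<in>J. y j ^ \<alpha> j)) = a" for y :: "'j \<Rightarrow> real"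
    proof -
      have "(\<Sum>\<alpha>\<in>midx J D. ?c \<alpha> * (\<Prod>j\<in>J. y j ^ \<alpha> j)) = (\<Sum>\<alpha>\<in>midx J D. if \<alpha> = (\<lambda>j\<in>J. 0) then a else 0)"
        by (intro sum.cong refl) auto
      then show ?thesis using 0 finite_midx[OF finite_J, of D] by simp
    qed
    then show ?thesis unfolding polynomials_upto_def midx_def by (auto intro!: exI[of _ ?c])
  qed
  have f: "f \<in> J \<rightarrow>\<^sub>E polynomials_upto J D" unfolding f_def using const by auto
  have "MMSE J P D lam \<le> (\<integral>(x, z). (\<Sum>j\<in>J. (f j (observation J lam x z) - x j)\<^sup>2) \<partial>W)"
    unfolding MMSE_def
    by (rule cINF_lower[OF bdd_belowI2[of _ 0] f])
       (auto intro!: Bochner_Integration.integral_nonneg sum_nonneg)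
  also have "\<dots> = (\<Sum>j\<in>J. (\<integral>x. (x j)\<^sup>2 \<partial>P) - (\<integral>x. x j \<partial>P)\<^sup>2)"
    unfolding integral_error_sum[OF f]
  proof (intro sum.cong refl)
    fix j assume j: "j \<in> J"
    define a where "a = (\<integral>x. x j \<partial>P)"
    have int: "integrable P (\<lambda>x. x j)" "integrable P (\<lambda>x. (x j)\<^sup>2)"
      by (intro all_moments_integrable P.all_moments_power moments_P j)+
    have "integrable W (\<lambda>w. (a - fst w j)\<^sup>2)"
      by (intro all_moments_integrable W.P.all_moments_power W.P.all_moments_diff W.P.all_moments_const am_signal j)
    from W.integral_fst'[OF this]
    have "(\<integral>w. (a - fst w j)\<^sup>2 \<partial>W) = (\<integral>x. (a - x j)\<^sup>2 \<partial>P)" by (simp add: G.prob_space)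
    also have "\<dots> = (\<integral>x. a\<^sup>2 - 2 * a * x j + (x j)\<^sup>2 \<partial>P)"
      by (intro Bochner_Integration.integral_cong refl) (simp add: power2_eq_square algebra_simps)
    also have "\<dots> = (\<integral>x. (x j)\<^sup>2 \<partial>P) - a\<^sup>2"
      using int by (simp add: a_def[symmetric] P.prob_space power2_eq_square)
    finally show "(\<integral>w. (f j (obs w) - fst w j)\<^sup>2 \<partial>W) = (\<integral>x. (x j)\<^sup>2 \<partial>P) - (\<integral>x. x j \<partial>P)\<^sup>2"
      using j by (simp add: f_def a_def)
  qed
  also have "\<dots> = MMSE_trivial J P"
    by (simp add: MMSE_trivial_def second_moment_eq sum_subtractf)
  finally show ?thesis .
qed

end

section \<open>Gamma and Gaussian laws\<close>

text \<open>Monotone convergence along compact intervals; it carries the substitution rule on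
  \<open>{a..b}\<close> over to the half-line.\<close>

lemma nn_integral_atLeast_SUP:
  fixes F :: "real \<Rightarrow> ennreal" and b :: "nat \<Rightarrow> real"
  assumes [measurable]: "F \<in> borel_measurable borel" and b: "incseq b" "filterlim b at_top sequentially"
  shows "(\<integral>\<^sup>+x. F x * indicator {0..} x \<partial>lborel) = (SUP k. \<integral>\<^sup>+x. F x * indicator {0..b k} x \<partial>lborel)"
proof -
  have "(SUP k. F x * indicator {0..b k} x) = F x * indicator {0..} x" for x
  proof (rule antisym)
    show "(SUP k. F x * indicator {0..b k} x) \<le> F x * indicator {0..} x"
      by (intro SUP_least mult_left_mono) (auto simp: indicator_def)
    have "eventually (\<lambda>k. b k \<ge> x) sequentially" using b(2) by (simp add: filterlim_at_top)
    then obtain k where "x \<le> b k" by (auto simp: eventually_sequentially)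
    then have "F x * indicator {0..} x \<le> F x * indicator {0..b k} x"
      by (auto simp: indicator_def)
    then show "F x * indicator {0..} x \<le> (SUP k. F x * indicator {0..b k} x)"
      by (intro SUP_upper2[of k]) auto
  qed
  moreover have "incseq (\<lambda>k x. F x * indicator {0..b k} x)"
  proof (intro incseq_SucI le_funI mult_left_mono)
    fix k x show "indicator {0..b k} x \<le> (indicator {0..b (Suc k)} x :: ennreal)"
      using incseq_SucD[OF b(1), of k] by (auto simp: indicator_def)
  qed simp
  ultimately show ?thesis
    by (subst nn_integral_monotone_convergence_SUP[symmetric]) auto
qed

text \<open>Used twice: with \<open>c = 1/2\<close> and \<open>r = 2\<close> for half the square of
  a Gaussian variable, and with \<open>c = 1\<close> for the \<open>r\<close>-th power of the inner
  product.\<close>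

lemma nn_integral_power_substitution:
  fixes h :: "real \<Rightarrow> real"
  assumes [measurable]: "h \<in> borel_measurable borel" and c: "c > 0" and r: "r > 0"
  shows "(\<integral>\<^sup>+q. ennreal (h q) * indicator {0..} q \<partial>lborel)
    = (\<integral>\<^sup>+s. ennreal (h (c * s ^ r) * (c * real r * s ^ (r - 1))) * indicator {0..} s \<partial>lborel)"
proof -
  let ?g = "\<lambda>s. c * s ^ r" and ?g' = "\<lambda>s. c * real r * s ^ (r - 1)"
  have inc: "incseq (\<lambda>k. ?g (real k))"
    using c by (intro incseq_SucI mult_left_mono power_mono) auto
  have "filterlim (\<lambda>k. real k ^ r * c) at_top sequentially"
    using c r by (intro filterlim_at_top_mult_tendsto_pos[OF tendsto_const] filterlim_pow_at_top filterlim_real_sequentially) auto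
  then have lim: "filterlim (\<lambda>k. ?g (real k)) at_top sequentially" by (simp add: mult.commute)
  have "(\<integral>\<^sup>+q. ennreal (h q) * indicator {0..} q \<partial>lborel)
      = (SUP k. \<integral>\<^sup>+q. ennreal (h q) * indicator {0..?g (real k)} q \<partial>lborel)"
    by (rule nn_integral_atLeast_SUP[OF _ inc lim]) measurable
  also have "\<dots> = (SUP k. \<integral>\<^sup>+s. ennreal (h (?g s) * ?g' s) * indicator {0..real k} s \<partial>lborel)"
  proof (intro SUP_cong refl)
    fix k :: nat
    have "(\<integral>\<^sup>+q. ennreal (h q * indicator {?g 0..?g (real k)} q) \<partial>lborel)
      = (\<integral>\<^sup>+s. ennreal (h (?g s) * ?g' s * indicator {0..real k} s) \<partial>lborel)"
    proof (rule nn_integral_substitution)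
      show "set_borel_measurable borel {?g 0..?g (real k)} h" by (simp add: set_borel_measurable_def)
      show "(?g has_real_derivative ?g' x) (at x)" for x
        by (auto intro!: derivative_eq_intros)
      show "continuous_on {0..real k} ?g'" by (intro continuous_intros)
    qed (use c in auto)
    then show "(\<integral>\<^sup>+q. ennreal (h q) * indicator {0..?g (real k)} q \<partial>lborel)
      = (\<integral>\<^sup>+s. ennreal (h (?g s) * ?g' s) * indicator {0..real k} s \<partial>lborel)"
      using r by (simp add: ennreal_indicator ennreal_mult'' zero_power)
  qed
  also have "\<dots> = (\<integral>\<^sup>+s. ennreal (h (?g s) * ?g' s) * indicator {0..} s \<partial>lborel)"
    by (rule nn_integral_atLeast_SUP[symmetric]) (auto simp: incseq_def filterlim_real_sequentially)
  finally show ?thesis .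
qed

lemma nn_integral_split_sign:
  fixes F :: "real \<Rightarrow> ennreal"
  assumes [measurable]: "F \<in> borel_measurable borel"
  shows "(\<integral>\<^sup>+x. F x \<partial>lborel) = (\<integral>\<^sup>+x. F x * indicator {0..} x \<partial>lborel) + (\<integral>\<^sup>+x. F (- x) * indicator {0..} x \<partial>lborel)"
proof -
  have "(\<integral>\<^sup>+x. F x \<partial>lborel) = (\<integral>\<^sup>+x. F x * indicator {0..} x + F x * indicator {..<0} x \<partial>lborel)"
    by (intro nn_integral_cong) (auto simp: indicator_def)
  also have "\<dots> = (\<integral>\<^sup>+x. F x * indicator {0..} x \<partial>lborel) + (\<integral>\<^sup>+x. F x * indicator {..<0} x \<partial>lborel)"
    by (rule nn_integral_add) auto
  also have "(\<integral>\<^sup>+x. F x * indicator {..<0} x \<partial>lborel) = (\<integral>\<^sup>+x. F (- x) * indicator {..<0} (- x) \<partial>lborel)"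
    by (subst nn_integral_real_affine[of _ "-1" 0]) auto
  also have "\<dots> = (\<integral>\<^sup>+x. F (- x) * indicator {0..} x \<partial>lborel)"
    by (intro nn_integral_cong_AE, use AE_lborel_singleton[of "0::real"] in eventually_elim) (auto simp: indicator_def)
  finally show ?thesis .
qed

text \<open>Density of the Gamma law with shape \<open>a\<close> and rate 1. Working with half
  squares instead of squares of Gaussian variables is what makes the rate 1.\<close>

definition gam_density :: "real \<Rightarrow> real \<Rightarrow> real" where
  "gam_density a t = (if 0 < t then t powr (a - 1) * exp (- t) / Gamma a else 0)"

lemma gam_density_nonneg: "a > 0 \<Longrightarrow> 0 \<le> gam_density a t"
  by (simp add: gam_density_def Gamma_real_pos less_imp_le)

lemma measurable_gam_density[measurable]: "gam_density a \<in> borel_measurable borel"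
  unfolding gam_density_def[abs_def] by measurable

lemma distr_half_square:
  "distr std_normal borel (\<lambda>x. x\<^sup>2 / 2) = density lborel (\<lambda>t. ennreal (gam_density (1/2) t))"
proof (rule measure_eqI)
  fix B :: "real set" assume "B \<in> sets (distr std_normal borel (\<lambda>x. x\<^sup>2 / 2))"
  then have [measurable]: "B \<in> sets borel" by simp
  let ?F = "\<lambda>x. ennreal (std_normal_density x) * indicator B (x\<^sup>2 / 2)"
  have "emeasure (distr std_normal borel (\<lambda>x. x\<^sup>2 / 2)) B = (\<integral>\<^sup>+x. ?F x \<partial>lborel)"
  proof -
    have "emeasure (distr std_normal borel (\<lambda>x. x\<^sup>2 / 2)) B = (\<integral>\<^sup>+x. indicator B x \<partial>distr std_normal borel (\<lambda>x. x\<^sup>2 / 2))"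
      by simp
    also have "\<dots> = (\<integral>\<^sup>+x. indicator B (x\<^sup>2 / 2) \<partial>std_normal)" by (rule nn_integral_distr) auto
    also have "\<dots> = (\<integral>\<^sup>+x. ?F x \<partial>lborel)" by (rule nn_integral_density) auto
    finally show ?thesis .
  qed
  also have "\<dots> = (\<integral>\<^sup>+x. ?F x * indicator {0..} x \<partial>lborel) + (\<integral>\<^sup>+x. ?F (- x) * indicator {0..} x \<partial>lborel)"
    by (rule nn_integral_split_sign) measurable
  also have "\<dots> = (\<integral>\<^sup>+x. ?F x * indicator {0..} x + ?F x * indicator {0..} x \<partial>lborel)"
    by (subst nn_integral_add) (auto simp: normal_density_def)
  also have "\<dots> = (\<integral>\<^sup>+x. ennreal ((gam_density (1/2) (1/2 * x ^ 2) * indicator B (1/2 * x ^ 2)) * (1/2 * real 2 * x ^ (2 - 1))) * indicator {0..} x \<partial>lborel)"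
  proof (intro nn_integral_cong_AE, use AE_lborel_singleton[of "0::real"] in eventually_elim)
    fix x :: real assume x: "x \<noteq> 0"
    show "?F x * indicator {0..} x + ?F x * indicator {0..} x
      = ennreal ((gam_density (1/2) (1/2 * x ^ 2) * indicator B (1/2 * x ^ 2)) * (1/2 * real 2 * x ^ (2 - 1))) * indicator {0..} x"
    proof (cases "x \<ge> 0")
      case True
      then have x0: "x > 0" using x by simp
      \<comment> \<open>The map \<open>x^2 / 2\<close> has derivative \<open>x\<close>, and the two
        signs of \<open>x\<close> account for the factor 2.\<close>
      have "gam_density (1/2) (1/2 * x ^ 2) * x = 2 * std_normal_density x"
      proof -
        have "(x\<^sup>2 / 2) powr (1/2 - 1) = inverse (sqrt (x\<^sup>2 / 2))"
          using x0 by (simp add: powr_minus powr_half_sqrt)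
        also have "\<dots> = sqrt 2 / x" using x0 by (simp add: real_sqrt_divide)
        finally have 1: "(x\<^sup>2 / 2) powr (1/2 - 1) = sqrt 2 / x" .
        have "sqrt 2 / sqrt pi = 2 / sqrt (2 * pi)"
          by (simp add: real_sqrt_mult field_simps)
        then have 2: "sqrt 2 / sqrt pi * y = 2 * (1 / sqrt (2 * pi) * y)" for y by simp
        have "gam_density (1/2) (1/2 * x ^ 2) = (x\<^sup>2 / 2) powr (1/2 - 1) * exp (- (x\<^sup>2 / 2)) / sqrt pi"
          using x0 by (simp add: gam_density_def Gamma_one_half_real)
        then have "gam_density (1/2) (1/2 * x ^ 2) * x = sqrt 2 / sqrt pi * exp (- (x\<^sup>2 / 2))"
          unfolding 1 using x0 by simp
        then show ?thesis unfolding 2 by (simp add: std_normal_density_def)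
      qed
      then have 2: "gam_density (1/2) (1/2 * x ^ 2) * indicator B (1/2 * x ^ 2) * (1/2 * real 2 * x ^ (2 - 1))
        = 2 * std_normal_density x * indicator B (x\<^sup>2 / 2)"
        by simp
      show ?thesis unfolding 2 using True
        by (auto simp: indicator_def ennreal_plus[symmetric] normal_density_nonneg simp del: ennreal_plus)
    qed simp
  qed
  also have "\<dots> = (\<integral>\<^sup>+t. ennreal (gam_density (1/2) t * indicator B t) * indicator {0..} t \<partial>lborel)"
    by (rule nn_integral_power_substitution[symmetric, where h = "\<lambda>t. gam_density (1/2) t * indicator B t" and c = "1/2" and r = 2])
      auto
  also have "\<dots> = (\<integral>\<^sup>+t. ennreal (gam_density (1/2) t) * indicator B t \<partial>lborel)"
    by (intro nn_integral_cong) (auto simp: indicator_def gam_density_def)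
  also have "\<dots> = emeasure (density lborel (\<lambda>t. ennreal (gam_density (1/2) t))) B"
    by (rule emeasure_density[symmetric]) auto
  finally show "emeasure (distr std_normal borel (\<lambda>x. x\<^sup>2 / 2)) B = emeasure (density lborel (\<lambda>t. ennreal (gam_density (1/2) t))) B" .
qed simp

text \<open>Scaling by \<open>z\<close> turns the convolution into a Beta integral: the exponentials
  combine to \<open>exp (- z)\<close>, and the powers of \<open>z\<close> to the one of shape
  \<open>a + b\<close>.\<close>

lemma nn_integral_gam_density_conv:
  assumes a: "a > 0" and b: "b > 0"
  shows "(\<integral>\<^sup>+x. ennreal (gam_density a x * gam_density b (z - x)) \<partial>lborel) = ennreal (gam_density (a + b) z)"
proof (cases "z > 0")
  case False
  then have zero: "gam_density a x * gam_density b (z - x) = 0" for x by (simp add: gam_density_def)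
  show ?thesis unfolding zero using False by (simp add: gam_density_def)
next
  case z: True
  let ?B = "\<lambda>t. t powr (a - 1) * (1 - t) powr (b - 1)"
  define C where "C = z powr (a + b - 2) * exp (- z) / (Gamma a * Gamma b)"
  have C: "C \<ge> 0" using a b by (simp add: C_def Gamma_real_pos less_imp_le)
  have "(\<integral>\<^sup>+x. ennreal (gam_density a x * gam_density b (z - x)) \<partial>lborel)
    = ennreal z * (\<integral>\<^sup>+t. ennreal (gam_density a (z * t) * gam_density b (z - z * t)) \<partial>lborel)"
    using z by (subst nn_integral_real_affine[of _ z 0]) auto
  also have "\<dots> = ennreal z * (\<integral>\<^sup>+t. ennreal C * (ennreal (?B t) * indicator {0..1} t) \<partial>lborel)"
  proof (intro arg_cong2[where f = times] refl nn_integral_cong_AE,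
      use AE_lborel_singleton[of "0::real"] AE_lborel_singleton[of "1::real"] in eventually_elim)
    fix t :: real assume t: "t \<noteq> 0" "t \<noteq> 1"
    show "ennreal (gam_density a (z * t) * gam_density b (z - z * t)) = ennreal C * (ennreal (?B t) * indicator {0..1} t)"
    proof (cases "0 < t \<and> t < 1")
      case True
      have zt: "z - z * t = z * (1 - t)" by (simp add: algebra_simps)
      have ee: "exp (- (z * t)) * exp (- (z * (1 - t))) = exp (- z)"
        by (simp add: exp_add[symmetric] algebra_simps)
      have zz: "z powr (a - 1) * z powr (b - 1) = z powr (a + b - 2)"
        by (simp add: powr_add[symmetric] algebra_simps)
      have "0 < z * t" "0 < z * (1 - t)" using z True by auto
      then have "gam_density a (z * t) * gam_density b (z - z * t)
        = (z powr (a - 1) * t powr (a - 1) * exp (- (z * t)) / Gamma a)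
          * (z powr (b - 1) * (1 - t) powr (b - 1) * exp (- (z * (1 - t))) / Gamma b)"
        using True z by (simp only: zt gam_density_def powr_mult if_True)
      also have "\<dots> = (z powr (a - 1) * z powr (b - 1)) * (exp (- (z * t)) * exp (- (z * (1 - t)))) / (Gamma a * Gamma b) * ?B t"
        by simp
      finally have "gam_density a (z * t) * gam_density b (z - z * t) = C * ?B t"
        unfolding ee zz C_def .
      then show ?thesis using True C by (simp add: ennreal_mult')
    next
      case False
      then have "t < 0 \<or> t > 1" using t by auto
      then show ?thesis using z by (auto simp: gam_density_def mult_less_0_iff zero_less_mult_iff)
    qed
  qed
  also have "\<dots> = ennreal z * (ennreal C * ennreal (Beta a b))"
    using nn_integral_has_integral_lebesgue'[OF _ has_integral_Beta_real[OF a b]]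
    by (subst nn_integral_cmult) auto
  also have "\<dots> = ennreal (z * C * Beta a b)"
    using z C a b by (simp add: ennreal_mult'[symmetric] mult.assoc)
  also have "z * C * Beta a b = gam_density (a + b) z"
  proof -
    have "z * z powr (a + b - 2) = z powr (a + b - 1)"
      using z powr_add[of z 1 "a + b - 2"] by simp
    moreover have "Gamma a > 0" "Gamma b > 0" "Gamma (a + b) > 0" using a b by (auto intro: Gamma_real_pos)
    ultimately show ?thesis using z by (simp add: C_def gam_density_def Beta_def field_simps)
  qed
  finally show ?thesis .
qed

lemma nn_integral_gam_density_sum:
  fixes F :: "real \<Rightarrow> ennreal"
  assumes a: "a > 0" and b: "b > 0" and [measurable]: "F \<in> borel_measurable borel"
  shows "(\<integral>\<^sup>+x. ennreal (gam_density a x) * (\<integral>\<^sup>+y. ennreal (gam_density b y) * F (x + y) \<partial>lborel) \<partial>lborel)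
    = (\<integral>\<^sup>+z. ennreal (gam_density (a + b) z) * F z \<partial>lborel)"
proof -
  have "(\<integral>\<^sup>+x. ennreal (gam_density a x) * (\<integral>\<^sup>+y. ennreal (gam_density b y) * F (x + y) \<partial>lborel) \<partial>lborel)
    = (\<integral>\<^sup>+x. (\<integral>\<^sup>+z. ennreal (gam_density a x * gam_density b (z - x)) * F z \<partial>lborel) \<partial>lborel)"
  proof (intro nn_integral_cong)
    fix x :: real
    have "(\<integral>\<^sup>+y. ennreal (gam_density b y) * F (x + y) \<partial>lborel)
      = (\<integral>\<^sup>+z. ennreal (gam_density b (z - x)) * F z \<partial>lborel)"
      by (subst nn_integral_real_affine[of _ 1 "- x"]) auto
    then show "ennreal (gam_density a x) * (\<integral>\<^sup>+y. ennreal (gam_density b y) * F (x + y) \<partial>lborel)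
      = (\<integral>\<^sup>+z. ennreal (gam_density a x * gam_density b (z - x)) * F z \<partial>lborel)"
      using a b by (simp add: nn_integral_cmult[symmetric] ennreal_mult gam_density_nonneg mult.assoc)
  qed
  also have "\<dots> = (\<integral>\<^sup>+z. (\<integral>\<^sup>+x. ennreal (gam_density a x * gam_density b (z - x)) * F z \<partial>lborel) \<partial>lborel)"
    by (rule lborel_pair.Fubini') measurable
  also have "\<dots> = (\<integral>\<^sup>+z. ennreal (gam_density (a + b) z) * F z \<partial>lborel)"
    using a b by (simp add: nn_integral_multc nn_integral_gam_density_conv)
  finally show ?thesis .
qed

text \<open>Each coordinate adds an independent Gamma variable of shape 1/2, and shapes add under
  convolution. The induction starts from one coordinate because shape 0 has no density.\<close>

lemma nn_integral_half_norm_sq: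
  fixes F :: "real \<Rightarrow> ennreal"
  assumes "finite I" "I \<noteq> {}" and "F \<in> borel_measurable borel"
  shows "(\<integral>\<^sup>+v. F (\<Sum>i\<in>I. (v i)\<^sup>2 / 2) \<partial>gaussian_vector I)
    = (\<integral>\<^sup>+t. ennreal (gam_density (real (card I) / 2) t) * F t \<partial>lborel)"
  using assms
proof (induction I arbitrary: F rule: finite_ne_induct)
  case (singleton i)
  note [measurable] = singleton
  interpret GP: product_prob_space "\<lambda>_. std_normal" "{i}" by unfold_locales
  have "(\<integral>\<^sup>+v. F (\<Sum>i\<in>{i}. (v i)\<^sup>2 / 2) \<partial>gaussian_vector {i}) = (\<integral>\<^sup>+x. F (x\<^sup>2 / 2) \<partial>std_normal)"
    unfolding gaussian_vector_eq using GP.product_nn_integral_singleton[of "\<lambda>x. F (x\<^sup>2 / 2)" i] by simp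
  also have "\<dots> = (\<integral>\<^sup>+t. F t \<partial>distr std_normal borel (\<lambda>x. x\<^sup>2 / 2))"
    by (rule nn_integral_distr[symmetric]) auto
  also have "\<dots> = (\<integral>\<^sup>+t. ennreal (gam_density (1/2) t) * F t \<partial>lborel)"
    unfolding distr_half_square by (rule nn_integral_density) auto
  finally show ?case by simp
next
  case (insert i I)
  note [measurable] = insert.prems
  interpret GP: product_prob_space "\<lambda>_. std_normal" "insert i I" by unfold_locales
  have [simp]: "(\<Sum>j\<in>I. ((v(i := x)) j)\<^sup>2 / 2) = (\<Sum>j\<in>I. (v j)\<^sup>2 / 2)" for v :: "'a \<Rightarrow> real" and x
    using insert.hyps by (intro sum.cong) auto
  have "(\<integral>\<^sup>+v. F (\<Sum>i\<in>insert i I. (v i)\<^sup>2 / 2) \<partial>gaussian_vector (insert i I))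
    = (\<integral>\<^sup>+x. (\<integral>\<^sup>+v. F (\<Sum>j\<in>insert i I. ((v(i := x)) j)\<^sup>2 / 2) \<partial>gaussian_vector I) \<partial>std_normal)"
    unfolding gaussian_vector_eq using insert.hyps
    by (intro GP.product_nn_integral_insert_rev) auto
  also have "\<dots> = (\<integral>\<^sup>+x. (\<integral>\<^sup>+v. F (x\<^sup>2 / 2 + (\<Sum>j\<in>I. (v j)\<^sup>2 / 2)) \<partial>gaussian_vector I) \<partial>std_normal)"
    using insert.hyps by (simp del: fun_upd_apply) (simp add: fun_upd_same)
  also have "\<dots> = (\<integral>\<^sup>+x. (\<integral>\<^sup>+t. ennreal (gam_density (real (card I) / 2) t) * F (x\<^sup>2 / 2 + t) \<partial>lborel) \<partial>std_normal)"
    by (subst insert.IH) auto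
  also have "\<dots> = (\<integral>\<^sup>+s. (\<integral>\<^sup>+t. ennreal (gam_density (real (card I) / 2) t) * F (s + t) \<partial>lborel) \<partial>distr std_normal borel (\<lambda>x. x\<^sup>2 / 2))"
    by (rule nn_integral_distr[symmetric]) auto
  also have "\<dots> = (\<integral>\<^sup>+s. ennreal (gam_density (1/2) s) * (\<integral>\<^sup>+t. ennreal (gam_density (real (card I) / 2) t) * F (s + t) \<partial>lborel) \<partial>lborel)"
    unfolding distr_half_square by (rule nn_integral_density) auto
  also have "\<dots> = (\<integral>\<^sup>+z. ennreal (gam_density (1/2 + real (card I) / 2) z) * F z \<partial>lborel)"
    using insert.hyps by (intro nn_integral_gam_density_sum) (auto simp: card_gt_0_iff)
  also have "1/2 + real (card I) / 2 = real (card (insert i I)) / 2"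
    using insert.hyps by (simp add: field_simps)
  finally show ?case .
qed

text \<open>The coefficients are nonzero so that every summand has a genuine normal density. When
  the coefficients are themselves a Gaussian vector, this excludes only a null set.\<close>

lemma nn_integral_linear_form:
  fixes F :: "real \<Rightarrow> ennreal" and a :: "'i \<Rightarrow> real"
  assumes I: "finite I" "I \<noteq> {}" and a: "\<And>i. i \<in> I \<Longrightarrow> a i \<noteq> 0" and [measurable]: "F \<in> borel_measurable borel"
  shows "(\<integral>\<^sup>+v. F (\<Sum>i\<in>I. a i * v i) \<partial>gaussian_vector I)
    = (\<integral>\<^sup>+x. F (sqrt (\<Sum>i\<in>I. (a i)\<^sup>2) * x) \<partial>std_normal)"
proof -
  interpret G: prob_space "gaussian_vector I" by (rule prob_space_gaussian_vector)
  have comp [measurable]: "(\<lambda>v. v i) \<in> borel_measurable (gaussian_vector I)" if "i \<in> I" for i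
    using all_moments_measurable[OF all_moments_gaussian_vector[OF that]] .
  have distr_comp: "distr (gaussian_vector I) borel (\<lambda>v. v i) = std_normal" if "i \<in> I" for i
  proof -
    have "distr (gaussian_vector I) std_normal (\<lambda>v. v i) = std_normal"
      unfolding gaussian_vector_eq by (rule GP.PiM_component[OF that])
    then show ?thesis by (simp cong: distr_cong)
  qed
  have ind: "G.indep_vars (\<lambda>i. borel) (\<lambda>i v. v i) I"
  proof (subst G.indep_vars_iff_distr_eq_PiM'[OF I(2) comp])
    have "distr (gaussian_vector I) (\<Pi>\<^sub>M i\<in>I. borel) (\<lambda>v. \<lambda>i\<in>I. v i) = distr (gaussian_vector I) (gaussian_vector I) (\<lambda>v. v)"
      by (intro distr_cong) (auto simp: sets_gaussian_vector space_gaussian_vector PiE_restrict)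
    also have "\<dots> = (\<Pi>\<^sub>M i\<in>I. std_normal)" by (simp add: gaussian_vector_eq)
    also have "\<dots> = (\<Pi>\<^sub>M i\<in>I. distr (gaussian_vector I) borel (\<lambda>v. v i))"
      by (intro PiM_cong refl) (simp add: distr_comp)
    finally show "distr (gaussian_vector I) (\<Pi>\<^sub>M i\<in>I. borel) (\<lambda>v. \<lambda>i\<in>I. v i) = (\<Pi>\<^sub>M i\<in>I. distr (gaussian_vector I) borel (\<lambda>v. v i))" .
  qed auto
  have ind': "G.indep_vars (\<lambda>i. borel) (\<lambda>i v. a i * v i) I"
    by (rule G.indep_vars_compose2[OF ind]) auto
  have nrm: "distributed (gaussian_vector I) lborel (\<lambda>v. a i * v i) (normal_density 0 \<bar>a i\<bar>)" if i: "i \<in> I" for i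
  proof -
    have "distributed (gaussian_vector I) lborel (\<lambda>v. v i) (normal_density 0 1)"
      using i distr_comp[OF i] by (auto simp: distributed_def cong: distr_cong)
    from G.normal_density_affine[OF this, of "a i" 0] a[OF i] show ?thesis by simp
  qed
  define \<sigma> where "\<sigma> = sqrt (\<Sum>i\<in>I. (a i)\<^sup>2)"
  have \<sigma>: "\<sigma> > 0" unfolding \<sigma>_def using I a by (intro real_sqrt_gt_zero sum_pos) auto
  have "distributed (gaussian_vector I) lborel (\<lambda>v. \<Sum>i\<in>I. a i * v i) (normal_density 0 \<sigma>)"
    using G.sum_indep_normal[OF I ind', of "\<lambda>i. \<bar>a i\<bar>" "\<lambda>_. 0"] nrm a by (simp add: \<sigma>_def)
  from distributed_nn_integral[OF this, of F]
  have "(\<integral>\<^sup>+v. F (\<Sum>i\<in>I. a i * v i) \<partial>gaussian_vector I) = (\<integral>\<^sup>+x. ennreal (normal_density 0 \<sigma> x) * F x \<partial>lborel)"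
    by simp
  also have "\<dots> = ennreal \<sigma> * (\<integral>\<^sup>+x. ennreal (normal_density 0 \<sigma> (\<sigma> * x)) * F (\<sigma> * x) \<partial>lborel)"
    using \<sigma> by (subst nn_integral_real_affine[of _ \<sigma> 0]) auto
  also have "\<dots> = (\<integral>\<^sup>+x. ennreal (std_normal_density x) * F (\<sigma> * x) \<partial>lborel)"
  proof -
    have "\<sigma> * normal_density 0 \<sigma> (\<sigma> * x) = std_normal_density x" for x
      using \<sigma> by (simp add: normal_density_def real_sqrt_mult power_mult_distrib field_simps)
    then show ?thesis using \<sigma>
      by (simp add: nn_integral_cmult[symmetric] mult.assoc[symmetric] ennreal_mult'[symmetric])
  qed
  also have "\<dots> = (\<integral>\<^sup>+x. F (\<sigma> * x) \<partial>std_normal)" by (rule nn_integral_density[symmetric]) auto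
  finally show ?thesis by (simp add: \<sigma>_def)
qed

section \<open>The inner product of two independent Gaussian vectors\<close>

abbreviation gauss_pair :: "nat \<Rightarrow> ((nat \<Rightarrow> real) \<times> (nat \<Rightarrow> real)) measure" where
  "gauss_pair n \<equiv> gaussian_vector {..<n} \<Otimes>\<^sub>M gaussian_vector {..<n}"

definition inner_pair :: "nat \<Rightarrow> (nat \<Rightarrow> real) \<times> (nat \<Rightarrow> real) \<Rightarrow> real" where
  "inner_pair n w = (\<Sum>i<n. fst w i * snd w i)"

lemma prob_space_gauss_pair: "prob_space (gauss_pair n)"
  by (intro prob_space_pair prob_space_gaussian_vector)

lemma measurable_gaussian_vector_component:
  "i \<in> I \<Longrightarrow> (\<lambda>v. v i) \<in> borel_measurable (gaussian_vector I)"
  using all_moments_measurable[OF all_moments_gaussian_vector] .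

lemma all_moments_inner_pair: "all_moments (gauss_pair n) (inner_pair n)"
proof -
  interpret prob_space "gauss_pair n" by (rule prob_space_gauss_pair)
  note * = prob_space_gaussian_vector[of "{..<n}"]
  show ?thesis unfolding inner_pair_def[abs_def]
    by (intro all_moments_sum all_moments_mult all_moments_fst[OF * *] all_moments_snd[OF * *]
        all_moments_gaussian_vector)
qed

lemma measurable_inner_pair[measurable]: "inner_pair n \<in> borel_measurable (gauss_pair n)"
  by (rule all_moments_measurable[OF all_moments_inner_pair])

lemma AE_gaussian_vector_nonzero:
  assumes "finite I"
  shows "AE v in gaussian_vector I. \<forall>i\<in>I. v i \<noteq> 0"
proof (rule AE_finite_allI[OF assms])
  fix i assume i: "i \<in> I"
  have d: "distr (gaussian_vector I) std_normal (\<lambda>v. v i) = std_normal"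
    unfolding gaussian_vector_eq by (rule GP.PiM_component[OF i])
  have z: "AE x in std_normal. x \<noteq> 0"
    using AE_lborel_singleton[of "0::real"] by (subst AE_density) auto
  have "AE x in distr (gaussian_vector I) std_normal (\<lambda>v. v i). x \<noteq> 0" unfolding d by (rule z)
  then show "AE v in gaussian_vector I. v i \<noteq> 0"
    using i by (subst (asm) AE_distr_iff) (auto intro!: measurable_gaussian_vector_component)
qed

lemma nn_integral_inner_pair:
  fixes F :: "real \<Rightarrow> ennreal"
  assumes n: "n > 0" and [measurable]: "F \<in> borel_measurable borel"
  shows "(\<integral>\<^sup>+w. F (inner_pair n w) \<partial>gauss_pair n)
    = (\<integral>\<^sup>+t. ennreal (gam_density (real n / 2) t) * (\<integral>\<^sup>+x. F (sqrt (2 * t) * x) \<partial>std_normal) \<partial>lborel)"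
proof -
  let ?G = "gaussian_vector {..<n}"
  interpret G: prob_space ?G by (rule prob_space_gaussian_vector)
  have "(\<integral>\<^sup>+w. F (inner_pair n w) \<partial>gauss_pair n) = (\<integral>\<^sup>+v. (\<integral>\<^sup>+v'. F (inner_pair n (v, v')) \<partial>?G) \<partial>?G)"
    by (rule G.nn_integral_fst[symmetric]) (rule measurable_compose[OF measurable_inner_pair assms(2)])
  also have "\<dots> = (\<integral>\<^sup>+v. (\<integral>\<^sup>+x. F (sqrt (2 * (\<Sum>i<n. (v i)\<^sup>2 / 2)) * x) \<partial>std_normal) \<partial>?G)"
  proof (intro nn_integral_cong_AE, use AE_gaussian_vector_nonzero[OF finite_lessThan[of n]] in eventually_elim)
    fix v :: "nat \<Rightarrow> real" assume v: "\<forall>i\<in>{..<n}. v i \<noteq> 0"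
    have "(\<integral>\<^sup>+v'. F (inner_pair n (v, v')) \<partial>?G) = (\<integral>\<^sup>+x. F (sqrt (\<Sum>i<n. (v i)\<^sup>2) * x) \<partial>std_normal)"
      using nn_integral_linear_form[of "{..<n}" v F] n v unfolding inner_pair_def
      by (auto simp: lessThan_empty_iff)
    then show "(\<integral>\<^sup>+v'. F (inner_pair n (v, v')) \<partial>?G)
      = (\<integral>\<^sup>+x. F (sqrt (2 * (\<Sum>i<n. (v i)\<^sup>2 / 2)) * x) \<partial>std_normal)"
      by (simp add: sum_divide_distrib[symmetric])
  qed
  also have "\<dots> = (\<integral>\<^sup>+t. ennreal (gam_density (real n / 2) t) * (\<integral>\<^sup>+x. F (sqrt (2 * t) * x) \<partial>std_normal) \<partial>lborel)"
  proof -
    have "(\<lambda>t. \<integral>\<^sup>+x. F (sqrt (2 * t) * x) \<partial>std_normal) \<in> borel_measurable borel" by measurable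
    from nn_integral_half_norm_sq[OF finite_lessThan[of n] _ this] show ?thesis
      using n by (simp add: lessThan_empty_iff)
  qed
  finally show ?thesis .
qed

section \<open>Moments of the inner product\<close>

lemma nn_integral_gam_density_power:
  assumes a: "a > 0"
  shows "(\<integral>\<^sup>+t. ennreal (gam_density a t) * ennreal (t ^ k) \<partial>lborel) = ennreal (pochhammer a k)"
proof -
  have G: "Gamma a > 0" "Gamma (a + real k) > 0" using a by (auto intro!: Gamma_real_pos)
  have "(\<integral>\<^sup>+t. ennreal (gam_density a t) * ennreal (t ^ k) \<partial>lborel)
    = (\<integral>\<^sup>+t. ennreal (1 / Gamma a) * ennreal (indicator {0..} t * t powr (a + real k - 1) / exp t) \<partial>lborel)"
  proof (intro nn_integral_cong_AE, use AE_lborel_singleton[of "0::real"] in eventually_elim)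
    fix t :: real assume "t \<noteq> 0"
    then consider "t < 0" | "t > 0" by linarith
    then show "ennreal (gam_density a t) * ennreal (t ^ k)
      = ennreal (1 / Gamma a) * ennreal (indicator {0..} t * t powr (a + real k - 1) / exp t)"
    proof cases
      case 2
      have "t powr (a + real k - 1) = t powr (a - 1) * t ^ k"
        using 2 by (simp add: powr_realpow[symmetric] powr_add[symmetric] algebra_simps)
      then show ?thesis using 2 G
        by (simp add: gam_density_def ennreal_mult'[symmetric] exp_minus field_simps)
    qed (simp add: gam_density_def)
  qed
  also have "\<dots> = ennreal (1 / Gamma a) * ennreal (Gamma (a + real k))"
    using a by (subst nn_integral_cmult) (auto simp: Gamma_conv_nn_integral_real)
  also have "\<dots> = ennreal (Gamma (a + real k) / Gamma a)"
    using G by (simp add: ennreal_mult'[symmetric])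
  also have "Gamma (a + real k) / Gamma a = pochhammer a k"
    using a by (subst pochhammer_Gamma) (auto elim!: nonpos_Ints_cases)
  finally show ?thesis .
qed

lemma integral_linear_form_odd:
  assumes I: "finite I" "I \<noteq> {}" and a: "\<And>i. i \<in> I \<Longrightarrow> a i \<noteq> 0" and "odd m"
  shows "(\<integral>v. (\<Sum>i\<in>I. a i * v i) ^ m \<partial>gaussian_vector I) = 0"
proof -
  let ?\<sigma> = "sqrt (\<Sum>i\<in>I. (a i)\<^sup>2)"
  have [measurable]: "(\<lambda>v. \<Sum>i\<in>I. a i * v i) \<in> borel_measurable (gaussian_vector I)"
    by (intro borel_measurable_sum borel_measurable_times borel_measurable_const measurable_gaussian_vector_component)
  have eq: "distr (gaussian_vector I) borel (\<lambda>v. \<Sum>i\<in>I. a i * v i) = distr std_normal borel (\<lambda>x. ?\<sigma> * x)"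
  proof (rule measure_eqI)
    fix B assume "B \<in> sets (distr (gaussian_vector I) borel (\<lambda>v. \<Sum>i\<in>I. a i * v i))"
    then have [measurable]: "B \<in> sets borel" by simp
    have "emeasure (distr (gaussian_vector I) borel (\<lambda>v. \<Sum>i\<in>I. a i * v i)) B
      = (\<integral>\<^sup>+v. indicator B (\<Sum>i\<in>I. a i * v i) \<partial>gaussian_vector I)"
      using nn_integral_distr[of "\<lambda>v. \<Sum>i\<in>I. a i * v i" "gaussian_vector I" borel "indicator B"] by simp
    also have "\<dots> = (\<integral>\<^sup>+x. indicator B (?\<sigma> * x) \<partial>std_normal)"
      using nn_integral_linear_form[OF I a, where F = "indicator B"] by simp
    also have "\<dots> = emeasure (distr std_normal borel (\<lambda>x. ?\<sigma> * x)) B"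
      using nn_integral_distr[of "\<lambda>x. ?\<sigma> * x" std_normal borel "indicator B"] by simp
    finally show "emeasure (distr (gaussian_vector I) borel (\<lambda>v. \<Sum>i\<in>I. a i * v i)) B
      = emeasure (distr std_normal borel (\<lambda>x. ?\<sigma> * x)) B" .
  qed simp
  have "(\<integral>v. (\<Sum>i\<in>I. a i * v i) ^ m \<partial>gaussian_vector I)
    = (\<integral>s. s ^ m \<partial>distr (gaussian_vector I) borel (\<lambda>v. \<Sum>i\<in>I. a i * v i))"
    by (rule integral_distr[symmetric]) auto
  also have "\<dots> = (\<integral>x. (?\<sigma> * x) ^ m \<partial>std_normal)"
    unfolding eq by (rule integral_distr) auto
  also have "\<dots> = ?\<sigma> ^ m * (\<integral>x. x ^ m \<partial>std_normal)"
    by (simp add: power_mult_distrib)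
  also have "(\<integral>x. x ^ m \<partial>std_normal) = 0"
  proof -
    obtain k where "m = 2 * k + 1" using \<open>odd m\<close> by (rule oddE)
    then show ?thesis using integral_std_normal_moment_odd[of k] by (subst integral_density) auto
  qed
  finally show ?thesis by simp
qed

lemma inner_pair_moment_odd:
  assumes n: "n > 0" and "odd m"
  shows "(\<integral>w. inner_pair n w ^ m \<partial>gauss_pair n) = 0"
proof -
  let ?G = "gaussian_vector {..<n}"
  interpret pair_prob_space ?G ?G
    by (simp add: pair_prob_space_def pair_sigma_finite_def prob_space_imp_sigma_finite prob_space_gaussian_vector)
  have "(\<integral>w. inner_pair n w ^ m \<partial>gauss_pair n) = (\<integral>v. (\<integral>v'. inner_pair n (v, v') ^ m \<partial>?G) \<partial>?G)"
    by (rule integral_fst'[symmetric]) (intro all_moments_integrable P.all_moments_power all_moments_inner_pair)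
  also have "\<dots> = (\<integral>v. 0 \<partial>?G)"
  proof (rule integral_cong_AE)
    show "AE v in ?G. (\<integral>v'. inner_pair n (v, v') ^ m \<partial>?G) = 0"
      using AE_gaussian_vector_nonzero[OF finite_lessThan[of n]]
    proof eventually_elim
      fix v :: "nat \<Rightarrow> real" assume "\<forall>i\<in>{..<n}. v i \<noteq> 0"
      then show "(\<integral>v'. inner_pair n (v, v') ^ m \<partial>?G) = 0"
        using integral_linear_form_odd[of "{..<n}" v m] n assms by (auto simp: inner_pair_def lessThan_empty_iff)
    qed
  qed auto
  finally show ?thesis by simp
qed

text \<open>The left side is the double factorial \<open>(2m - 1)!!\<close>, the Gaussian moment of
  order \<open>2 * m\<close>. As \<open>(2m)! / m!\<close> is a product of \<open>m\<close> factors
  of at most \<open>2 * m\<close>, dividing by \<open>2 ^ m\<close> gives the bound.\<close>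

lemma fact_double_le: "fact (2 * m) / (2 ^ m * fact m) \<le> (real m) ^ m"
proof -
  have "fact (2 * m) div fact (2 * m - m) \<le> (2 * m) ^ m" by (rule fact_div_fact_le_pow) simp
  moreover have "fact m dvd (fact (2 * m) :: nat)" by (rule fact_dvd) simp
  ultimately have "fact (2 * m) \<le> (2 * m) ^ m * (fact m :: nat)"
    by (metis add_diff_cancel_left' dvd_div_mult_self mult_2 mult_le_mono1)
  then have "real (fact (2 * m)) \<le> real ((2 * m) ^ m * fact m)" by (simp only: of_nat_le_iff)
  then show ?thesis by (simp add: power_mult_distrib divide_simps mult_ac)
qed

lemma pochhammer_le_power:
  fixes a :: real assumes "a \<ge> 0" shows "pochhammer a m \<le> (a + real m) ^ m"
proof -
  have "pochhammer a m = (\<Prod>i<m. a + real i)" by (simp add: pochhammer_prod atLeast0LessThan)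
  also have "\<dots> \<le> (\<Prod>i<m. a + real m)" using assms by (intro prod_mono) auto
  finally show ?thesis by simp
qed

text \<open>The inner product is a Gaussian with random variance \<open>2 * t\<close>, so its moment
  is the Gaussian moment of order \<open>2 * m\<close> times the Gamma mean of
  \<open>(2 * t) ^ m\<close>, and Gamma moments are rising factorials.\<close>

lemma inner_pair_moment_even:
  assumes n: "n > 0"
  shows "(\<integral>w. inner_pair n w ^ (2 * m) \<partial>gauss_pair n)
    = fact (2 * m) / (2 ^ m * fact m) * (2 ^ m * pochhammer (real n / 2) m)"
proof -
  let ?c = "fact (2 * m) / (2 ^ m * fact m) :: real"
  have c: "(\<integral>\<^sup>+x. ennreal (x ^ (2 * m)) \<partial>std_normal) = ennreal ?c"
  proof -
    have "has_bochner_integral std_normal (\<lambda>x. x ^ (2 * m)) ?c"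
      using std_normal_moment_even[of m] by (subst has_bochner_integral_density) auto
    then show ?thesis by (subst nn_integral_eq_integral) (auto simp: has_bochner_integral_iff)
  qed
  have "(\<integral>\<^sup>+w. ennreal (inner_pair n w ^ (2 * m)) \<partial>gauss_pair n)
    = (\<integral>\<^sup>+t. ennreal (gam_density (real n / 2) t) * (\<integral>\<^sup>+x. ennreal ((sqrt (2 * t) * x) ^ (2 * m)) \<partial>std_normal) \<partial>lborel)"
    by (rule nn_integral_inner_pair[OF n, of "\<lambda>s. ennreal (s ^ (2 * m))"]) measurable
  also have "\<dots> = (\<integral>\<^sup>+t. ennreal (2 ^ m * ?c) * (ennreal (gam_density (real n / 2) t) * ennreal (t ^ m)) \<partial>lborel)"
  proof (intro nn_integral_cong)
    fix t :: real
    show "ennreal (gam_density (real n / 2) t) * (\<integral>\<^sup>+x. ennreal ((sqrt (2 * t) * x) ^ (2 * m)) \<partial>std_normal)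
      = ennreal (2 ^ m * ?c) * (ennreal (gam_density (real n / 2) t) * ennreal (t ^ m))"
    proof (cases "t > 0")
      case True
      then have "(sqrt (2 * t) * x) ^ (2 * m) = (2 * t) ^ m * x ^ (2 * m)" for x
        by (simp add: power_mult_distrib power_mult)
      then have "(\<integral>\<^sup>+x. ennreal ((sqrt (2 * t) * x) ^ (2 * m)) \<partial>std_normal) = ennreal ((2 * t) ^ m) * ennreal ?c"
        using True c by (simp add: ennreal_mult nn_integral_cmult)
      then have h: "(\<integral>\<^sup>+x. ennreal ((sqrt (2 * t) * x) ^ (2 * m)) \<partial>std_normal) = ennreal ((2 * t) ^ m) * ennreal ?c" .
      have e: "ennreal u * (ennreal v * ennreal w) = ennreal (u * (v * w))" if "0 \<le> u" "0 \<le> v" "0 \<le> w" for u v w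
        using that by (simp add: ennreal_mult)
      have "ennreal (gam_density (real n / 2) t) * (\<integral>\<^sup>+x. ennreal ((sqrt (2 * t) * x) ^ (2 * m)) \<partial>std_normal)
        = ennreal (gam_density (real n / 2) t * ((2 * t) ^ m * ?c))"
        unfolding h using True n by (intro e gam_density_nonneg) auto
      also have "gam_density (real n / 2) t * ((2 * t) ^ m * ?c) = (2 ^ m * ?c) * (gam_density (real n / 2) t * t ^ m)"
        by (simp add: power_mult_distrib)
      also have "ennreal \<dots> = ennreal (2 ^ m * ?c) * (ennreal (gam_density (real n / 2) t) * ennreal (t ^ m))"
        using True n by (subst ennreal_mult) (auto simp: ennreal_mult gam_density_nonneg)
      finally show ?thesis .
    qed (simp add: gam_density_def)
  qed
  also have "\<dots> = ennreal (2 ^ m * ?c) * ennreal (pochhammer (real n / 2) m)"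
    using n by (subst nn_integral_cmult) (auto simp: nn_integral_gam_density_power)
  also have "\<dots> = ennreal (2 ^ m * ?c * pochhammer (real n / 2) m)"
    by (rule ennreal_mult'[symmetric]) auto
  also have "2 ^ m * ?c * pochhammer (real n / 2) m = ?c * (2 ^ m * pochhammer (real n / 2) m)"
    by (simp only: mult_ac)
  finally have "(\<integral>\<^sup>+w. ennreal (inner_pair n w ^ (2 * m)) \<partial>gauss_pair n) = ennreal (?c * (2 ^ m * pochhammer (real n / 2) m))" .
  moreover have "integrable (gauss_pair n) (\<lambda>w. inner_pair n w ^ (2 * m))"
  proof -
    interpret prob_space "gauss_pair n" by (rule prob_space_gauss_pair)
    show ?thesis by (intro all_moments_integrable all_moments_power all_moments_inner_pair)
  qed
  moreover have "0 \<le> ?c * (2 ^ m * pochhammer (real n / 2) m)"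
    using n by (intro mult_nonneg_nonneg pochhammer_nonneg) auto
  ultimately show ?thesis
    by (subst (asm) nn_integral_eq_integral) (auto simp: ennreal_inj)
qed

text \<open>For \<open>k = 2 * m\<close> the hypothesis \<open>k \<le> n\<close> bounds
  \<open>n + 2 * m\<close> by \<open>2 * n\<close>, so the moment is at most
  \<open>m ^ m * (2 * n) ^ m\<close>. Odd moments vanish by symmetry, so the same bound serves both
  parities.\<close>

lemma inner_pair_moment_bounds:
  assumes n: "n > 0" and k0: "k > 0" and k: "k \<le> n"
  shows "0 \<le> (\<integral>w. inner_pair n w ^ k \<partial>gauss_pair n)"
    and "(\<integral>w. inner_pair n w ^ k \<partial>gauss_pair n) \<le> (real k * real n) powr (real k / 2)"
proof -
  have "0 \<le> (\<integral>w. inner_pair n w ^ k \<partial>gauss_pair n) \<and> (\<integral>w. inner_pair n w ^ k \<partial>gauss_pair n) \<le> (real k * real n) powr (real k / 2)"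
  proof (cases "even k")
    case False
    then show ?thesis using inner_pair_moment_odd[OF n] by simp
  next
    case True
    then obtain m where m: "k = 2 * m" by (rule evenE)
    have "2 ^ m * pochhammer (real n / 2) m \<le> 2 ^ m * (real n / 2 + real m) ^ m"
      by (intro mult_left_mono pochhammer_le_power) auto
    also have "\<dots> = (real n + 2 * real m) ^ m" by (simp add: power_mult_distrib[symmetric] algebra_simps)
    also have "\<dots> \<le> (2 * real n) ^ m" using k by (intro power_mono) (auto simp: m)
    finally have 1: "2 ^ m * pochhammer (real n / 2) m \<le> (2 * real n) ^ m" .
    have "fact (2 * m) / (2 ^ m * fact m) * (2 ^ m * pochhammer (real n / 2) m) \<le> real m ^ m * (2 * real n) ^ m"
      using n by (intro mult_mono 1 fact_double_le mult_nonneg_nonneg pochhammer_nonneg) auto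
    also have "\<dots> = (real k * real n) ^ m" by (simp add: m power_mult_distrib mult_ac)
    also have "\<dots> \<le> (real k * real n) powr (real k / 2)"
    proof (cases "m = 0")
      case False
      then show ?thesis using n by (simp add: m powr_realpow)
    qed (use m k0 in simp)
    finally have "fact (2 * m) / (2 ^ m * fact m) * (2 ^ m * pochhammer (real n / 2) m) \<le> (real k * real n) powr (real k / 2)" .
    moreover have "0 \<le> fact (2 * m) / (2 ^ m * fact m) * (2 ^ m * pochhammer (real n / 2) m)"
      using n by (intro mult_nonneg_nonneg pochhammer_nonneg) auto
    moreover have "(\<integral>w. inner_pair n w ^ k \<partial>gauss_pair n) = fact (2 * m) / (2 ^ m * fact m) * (2 ^ m * pochhammer (real n / 2) m)"
      using inner_pair_moment_even[OF n, of m] by (simp only: m)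
    ultimately show ?thesis by (simp only: simp_thms)
  qed
  then show "0 \<le> (\<integral>w. inner_pair n w ^ k \<partial>gauss_pair n)"
    and "(\<integral>w. inner_pair n w ^ k \<partial>gauss_pair n) \<le> (real k * real n) powr (real k / 2)" by auto
qed

section \<open>Two-sided tail estimates at the level \<open>exp (- D)\<close>\<close>

abbreviation gamma_law :: "real \<Rightarrow> real measure" where
  "gamma_law a \<equiv> density lborel (\<lambda>t. ennreal (gam_density a t))"

lemma AE_gamma_law_pos: "AE t in gamma_law a. 0 < t"
  by (subst AE_density) (auto simp: gam_density_def intro!: AE_I2 split: if_splits)

lemma gamma_law_moment:
  assumes a: "a > 0"
  shows "integrable (gamma_law a) (\<lambda>t. t ^ k)" "(\<integral>t. t ^ k \<partial>gamma_law a) = pochhammer a k"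
proof -
  have nn: "(\<integral>\<^sup>+t. ennreal (t ^ k) \<partial>gamma_law a) = ennreal (pochhammer a k)"
    by (subst nn_integral_density) (auto simp: nn_integral_gam_density_power[OF a])
  have ae: "AE t in gamma_law a. 0 \<le> t ^ k"
    using AE_gamma_law_pos[of a] by eventually_elim simp
  show "integrable (gamma_law a) (\<lambda>t. t ^ k)"
    by (rule integrableI_nonneg[OF _ ae]) (auto simp: nn)
  show "(\<integral>t. t ^ k \<partial>gamma_law a) = pochhammer a k"
    using pochhammer_nonneg[OF a] by (subst integral_eq_nn_integral[OF _ ae]) (auto simp: nn)
qed

lemma prob_space_gamma_law: "a > 0 \<Longrightarrow> prob_space (gamma_law a)"
  using nn_integral_gam_density_power[of a 0] by (intro prob_spaceI) (simp add: emeasure_density)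

text \<open>Chebyshev's inequality: mean and variance of this law are both \<open>a\<close>.\<close>

lemma gamma_law_half_mean:
  assumes a: "a > 0"
  shows "measure (gamma_law a) {t. a / 2 \<le> t} \<ge> 1 - 4 / a"
proof -
  interpret prob_space "gamma_law a" by (rule prob_space_gamma_law[OF a])
  have e1: "expectation (\<lambda>t. t) = a" using gamma_law_moment(2)[OF a, of 1] by simp
  have i1: "integrable (gamma_law a) (\<lambda>t. t)" and i2: "integrable (gamma_law a) (\<lambda>t. t\<^sup>2)"
    using gamma_law_moment(1)[OF a, of 1] gamma_law_moment(1)[OF a, of 2] by simp_all
  have "variance (\<lambda>t. t) = a"
    using gamma_law_moment(2)[OF a, of 2] by (subst variance_eq[OF i1 i2])
      (simp add: e1 numeral_2_eq_2 pochhammer_rec power2_eq_square algebra_simps)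
  then have "prob {t \<in> space (gamma_law a). a / 2 \<le> \<bar>t - expectation (\<lambda>t. t)\<bar>} \<le> a / (a / 2)\<^sup>2"
    using Chebyshev_inequality[of "\<lambda>t. t" "a / 2"] i2 a by simp
  also have "a / (a / 2)\<^sup>2 = 4 / a" using a by (simp add: power2_eq_square field_simps)
  finally have 1: "prob {t. a / 2 \<le> \<bar>t - a\<bar>} \<le> 4 / a" by (simp add: e1)
  have "prob (space (gamma_law a) - {t. a / 2 \<le> t}) \<le> prob {t. a / 2 \<le> \<bar>t - a\<bar>}"
    using a by (intro finite_measure_mono) (auto simp: abs_if)
  then show ?thesis using 1 prob_compl[of "{t. a / 2 \<le> t}"] by simp
qed

text \<open>Markov's inequality for the moment of order \<open>2 * D\<close>, available since
  \<open>2 * D \<le> n\<close>. The constant 3 in the level makes the quotient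
  \<open>(2/9) ^ D\<close>, which is below \<open>exp (- D)\<close> because \<open>e\<close> is at
  most 3.\<close>

lemma inner_pair_tail_le:
  assumes D: "D > 0" and n: "2 * D \<le> n"
  shows "measure (gauss_pair n) {w \<in> space (gauss_pair n). 3 * sqrt (real n * real D) < \<bar>inner_pair n w\<bar>} \<le> exp (- real D)"
proof -
  interpret prob_space "gauss_pair n" by (rule prob_space_gauss_pair)
  define s where "s = 3 * sqrt (real n * real D)"
  have s: "s > 0" using D n by (simp add: s_def)
  have s2: "s\<^sup>2 = 9 * (real n * real D)" by (simp add: s_def power_mult_distrib)
  have int: "integrable (gauss_pair n) (\<lambda>w. inner_pair n w ^ (2 * D))"
    by (intro all_moments_integrable all_moments_power all_moments_inner_pair)
  have "prob {w \<in> space (gauss_pair n). s < \<bar>inner_pair n w\<bar>}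
    \<le> prob {w \<in> space (gauss_pair n). inner_pair n w ^ (2 * D) \<ge> s ^ (2 * D)}"
  proof (rule finite_measure_mono)
    show "{w \<in> space (gauss_pair n). s < \<bar>inner_pair n w\<bar>} \<subseteq> {w \<in> space (gauss_pair n). inner_pair n w ^ (2 * D) \<ge> s ^ (2 * D)}"
    proof (intro subsetI CollectI conjI)
      fix w assume "w \<in> {w \<in> space (gauss_pair n). s < \<bar>inner_pair n w\<bar>}"
      then have "s ^ (2 * D) \<le> \<bar>inner_pair n w\<bar> ^ (2 * D)" using s by (intro power_mono) auto
      then show "inner_pair n w ^ (2 * D) \<ge> s ^ (2 * D)" by (simp add: power_even_abs)
    qed auto
  qed measurable
  also have "\<dots> \<le> expectation (\<lambda>w. inner_pair n w ^ (2 * D)) / s ^ (2 * D)"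
    using s int by (intro integral_Markov_inequality_measure[where A = "{}"]) auto
  also have "\<dots> \<le> (real (2 * D) * real n) powr (real (2 * D) / 2) / s ^ (2 * D)"
    using inner_pair_moment_bounds(2)[of n "2 * D"] D n s by (intro divide_right_mono) auto
  also have "\<dots> = (2 / 9) ^ D"
  proof -
    have "(real (2 * D) * real n) powr (real (2 * D) / 2) = (2 * (real n * real D)) ^ D"
      using D n by (simp add: powr_realpow mult_ac)
    moreover have "s ^ (2 * D) = (9 * (real n * real D)) ^ D" by (simp add: power_mult s2)
    ultimately show ?thesis using D n by (simp add: power_divide[symmetric])
  qed
  also have "\<dots> \<le> exp (- 1) ^ D"
  proof (rule power_mono)
    show "2 / 9 \<le> exp (- 1 :: real)" using exp_le by (simp add: exp_minus field_simps)
  qed simp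
  also have "\<dots> = exp (- real D)" by (simp add: exp_of_nat_mult[symmetric])
  finally show ?thesis by (simp add: s_def)
qed

text \<open>Only the two unit intervals just beyond \<open>\<tau>\<close> and
  \<open>- \<tau>\<close> are kept; there the density is at least its value at
  \<open>\<tau> + 1\<close>.\<close>

lemma std_normal_tail_ge:
  assumes \<tau>: "\<tau> \<ge> 0"
  shows "emeasure std_normal {x. \<tau> < \<bar>x\<bar>} \<ge> ennreal (2 * std_normal_density (\<tau> + 1))"
proof -
  let ?c = "std_normal_density (\<tau> + 1)"
  have c: "?c \<ge> 0" by (simp add: normal_density_nonneg)
  have "ennreal (2 * ?c) = ennreal ?c * emeasure lborel {\<tau><..\<tau>+1} + ennreal ?c * emeasure lborel {-\<tau>-1..<-\<tau>}"
    using c by (simp add: ennreal_plus[symmetric] del: ennreal_plus)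
  also have "\<dots> = (\<integral>\<^sup>+x. ennreal ?c * indicator {\<tau><..\<tau>+1} x + ennreal ?c * indicator {-\<tau>-1..<-\<tau>} x \<partial>lborel)"
    by (subst nn_integral_add) (auto simp: nn_integral_cmult_indicator)
  also have "\<dots> \<le> (\<integral>\<^sup>+x. ennreal (std_normal_density x) * indicator {x. \<tau> < \<bar>x\<bar>} x \<partial>lborel)"
  proof (intro nn_integral_mono)
    fix x :: real
    have "?c \<le> std_normal_density x" if "\<bar>x\<bar> \<le> \<tau> + 1"
    proof -
      have "\<bar>x\<bar>\<^sup>2 \<le> (\<tau> + 1)\<^sup>2" using that by (intro power_mono) auto
      then show ?thesis by (simp add: std_normal_density_def divide_right_mono)
    qed
    then show "ennreal ?c * indicator {\<tau><..\<tau>+1} x + ennreal ?c * indicator {-\<tau>-1..<-\<tau>} x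
      \<le> ennreal (std_normal_density x) * indicator {x. \<tau> < \<bar>x\<bar>} x"
      using \<tau> by (auto simp: indicator_def intro!: ennreal_leI)
  qed
  also have "\<dots> = emeasure std_normal {x. \<tau> < \<bar>x\<bar>}"
    by (subst emeasure_density) auto
  finally show ?thesis .
qed

text \<open>The divisor 200 makes the exponent \<open>(\<tau> + 1)^2 / 2\<close> at most
  \<open>D / 50 + 1/2\<close>, so a factor \<open>exp (49/50 * D - 1/2)\<close> is left against
  \<open>sqrt (2 * pi)\<close>. The tightest case is \<open>D = 1\<close>, where this factor is
  \<open>exp (48/100)\<close>; its quadratic Taylor bound is sharp enough.\<close>

lemma std_normal_density_lower:
  assumes D: "D \<ge> 1"
  shows "99/100 * (2 * std_normal_density (sqrt (2 * D) / 200 + 1)) > exp (- D)"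
proof -
  define \<tau> where "\<tau> = sqrt (2 * D) / 200"
  have t2: "\<tau>\<^sup>2 = D / 20000" using D by (simp add: \<tau>_def power_divide)
  have "D \<le> D * D" using D by simp
  then have "sqrt (2 * D) \<le> 2 * D"
    using D by (intro real_le_lsqrt) (auto simp: power2_eq_square)
  then have t1: "\<tau> \<le> D / 100" using D by (simp add: \<tau>_def)
  have "(\<tau> + 1)\<^sup>2 / 2 = \<tau>\<^sup>2 / 2 + \<tau> + 1/2" by (simp add: power2_eq_square algebra_simps)
  also have "\<dots> \<le> D / 50 + 1/2" using t1 D by (simp add: t2)
  finally have ex: "(\<tau> + 1)\<^sup>2 / 2 \<le> D / 50 + 1/2" .
  have sq: "sqrt (2 * pi) \<le> sqrt 8" using pi_less_4 by (intro real_sqrt_le_mono) simp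
  have s8: "sqrt 8 \<le> (2829 / 1000 :: real)" by (rule real_le_lsqrt) (auto simp: power2_eq_square)
  have e: "exp (49/50 * D - 1/2) \<ge> 1 + 48/100 + (48/100)\<^sup>2 / (2::real)"
  proof -
    have "1 + 48/100 + (48/100)\<^sup>2 / (2::real) \<le> exp (48/100)" by (rule exp_lower_Taylor_quadratic) simp
    also have "\<dots> \<le> exp (49/50 * D - 1/2)" using D by simp
    finally show ?thesis .
  qed
  have "exp (- D) * sqrt (2 * pi) \<le> exp (- D) * (2829 / 1000)"
    by (intro mult_left_mono order_trans[OF sq s8]) simp
  also have "\<dots> < exp (- D) * (99/100 * 2 * (1 + 48/100 + (48/100)\<^sup>2 / 2))"
    by (simp add: power2_eq_square)
  also have "\<dots> \<le> exp (- D) * (99/100 * 2 * exp (49/50 * D - 1/2))"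
    using e by (intro mult_left_mono) auto
  also have "\<dots> = 99/100 * 2 * exp (- (D / 50 + 1/2))"
    by (simp add: exp_add[symmetric])
  also have "\<dots> \<le> 99/100 * 2 * exp (- ((\<tau> + 1)\<^sup>2 / 2))" using ex by simp
  finally have "exp (- D) < 99/100 * 2 * exp (- ((\<tau> + 1)\<^sup>2 / 2)) / sqrt (2 * pi)"
    by (simp add: pos_less_divide_eq)
  then show ?thesis by (simp add: std_normal_density_def \<tau>_def)
qed

text \<open>With probability at least 99/100 the Gamma variable is at least half its mean; this is
  where \<open>n \<ge> 800\<close> enters. On that event the conditional standard deviation is at
  least \<open>sqrt (n / 2)\<close>, so the level is at most
  \<open>\<tau> = sqrt (2 * D) / 200\<close> standard deviations.\<close>

lemma inner_pair_tail_gt: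
  assumes D: "D > 0" and n: "n \<ge> 800"
  shows "measure (gauss_pair n) {w \<in> space (gauss_pair n). sqrt (real n * real D) / 200 < \<bar>inner_pair n w\<bar>} > exp (- real D)"
proof -
  interpret prob_space "gauss_pair n" by (rule prob_space_gauss_pair)
  define s where "s = sqrt (real n * real D) / 200"
  define \<tau> where "\<tau> = sqrt (2 * real D) / 200"
  let ?A = "{w \<in> space (gauss_pair n). s < \<bar>inner_pair n w\<bar>}"
  have A[measurable]: "?A \<in> sets (gauss_pair n)" by measurable
  have s\<tau>: "s = sqrt (real n / 2) * \<tau>" using n by (simp add: s_def \<tau>_def real_sqrt_mult[symmetric])
  define p where "p = 2 * std_normal_density (\<tau> + 1)"
  have p0: "p \<ge> 0" by (simp add: p_def normal_density_nonneg)
  have "ennreal (99/100 * p) \<le> ennreal p * emeasure (gamma_law (real n / 2)) {t. real n / 4 \<le> t}"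
  proof -
    interpret g: prob_space "gamma_law (real n / 2)" using n by (intro prob_space_gamma_law) simp
    have "99/100 \<le> 1 - 4 / (real n / 2)" using n by (simp add: field_simps)
    also have "\<dots> \<le> g.prob {t. real n / 4 \<le> t}" using gamma_law_half_mean[of "real n / 2"] n by simp
    finally have "ennreal (99/100) \<le> emeasure (gamma_law (real n / 2)) {t. real n / 4 \<le> t}"
      by (simp add: g.emeasure_eq_measure)
    then have "ennreal p * ennreal (99/100) \<le> ennreal p * emeasure (gamma_law (real n / 2)) {t. real n / 4 \<le> t}"
      by (intro mult_left_mono) auto
    then show ?thesis using p0 by (simp add: ennreal_mult'[symmetric] mult.commute)
  qed
  also have "\<dots> = (\<integral>\<^sup>+t. ennreal (gam_density (real n / 2) t) * (ennreal p * indicator {t. real n / 4 \<le> t} t) \<partial>lborel)"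
    by (simp add: emeasure_density nn_integral_cmult[symmetric] mult_ac)
  also have "\<dots> \<le> (\<integral>\<^sup>+t. ennreal (gam_density (real n / 2) t) * (\<integral>\<^sup>+x. indicator {y. s < \<bar>y\<bar>} (sqrt (2 * t) * x) \<partial>std_normal) \<partial>lborel)"
  proof (intro nn_integral_mono mult_left_mono)
    fix t :: real
    show "ennreal p * indicator {t. real n / 4 \<le> t} t \<le> (\<integral>\<^sup>+x. indicator {y. s < \<bar>y\<bar>} (sqrt (2 * t) * x) \<partial>std_normal)"
    proof (cases "real n / 4 \<le> t")
      case True
      have "ennreal p \<le> emeasure std_normal {x. \<tau> < \<bar>x\<bar>}"
        unfolding p_def by (rule std_normal_tail_ge) (simp add: \<tau>_def)
      also have "\<dots> = (\<integral>\<^sup>+x. indicator {x. \<tau> < \<bar>x\<bar>} x \<partial>std_normal)" by simp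
      also have "\<dots> \<le> (\<integral>\<^sup>+x. indicator {y. s < \<bar>y\<bar>} (sqrt (2 * t) * x) \<partial>std_normal)"
      proof (intro nn_integral_mono)
        fix x :: real
        have "s < \<bar>sqrt (2 * t) * x\<bar>" if "\<tau> < \<bar>x\<bar>"
        proof -
          have "s < sqrt (real n / 2) * \<bar>x\<bar>" unfolding s\<tau> using that n by (intro mult_strict_left_mono) auto
          also have "\<dots> \<le> sqrt (2 * t) * \<bar>x\<bar>" using True by (intro mult_right_mono real_sqrt_le_mono) auto
          finally show ?thesis using True n by (simp add: abs_mult)
        qed
        then show "indicator {x. \<tau> < \<bar>x\<bar>} x \<le> (indicator {y. s < \<bar>y\<bar>} (sqrt (2 * t) * x) :: ennreal)"
          by (auto simp: indicator_def)
      qed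
      finally show ?thesis using True by simp
    qed simp
  qed simp
  also have "\<dots> = (\<integral>\<^sup>+w. indicator {y. s < \<bar>y\<bar>} (inner_pair n w) \<partial>gauss_pair n)"
    using n by (intro nn_integral_inner_pair[symmetric]) auto
  also have "\<dots> = (\<integral>\<^sup>+w. indicator ?A w \<partial>gauss_pair n)"
    by (intro nn_integral_cong) (auto simp: indicator_def)
  also have "\<dots> = ennreal (prob ?A)" by (simp add: emeasure_eq_measure)
  finally have "99/100 * p \<le> prob ?A" by (simp add: ennreal_le_iff)
  moreover have "exp (- real D) < 99/100 * p"
    unfolding p_def \<tau>_def using D by (intro std_normal_density_lower) simp
  ultimately show ?thesis by (simp add: s_def)
qed

section \<open>The density of the overlap\<close>

text \<open>Up to elementary factors this is the modified Bessel function \<open>K\<^sub>a(2 \<surd>w)\<close>.\<close>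

definition bessel_integrand :: "real \<Rightarrow> real \<Rightarrow> real \<Rightarrow> real" where
  "bessel_integrand a w t = (if 0 < t then t powr (a - 1) * exp (- t - w / t) else 0)"

definition bessel_integral :: "real \<Rightarrow> real \<Rightarrow> real" where
  "bessel_integral a w = (\<integral>t. bessel_integrand a w t \<partial>lborel)"

lemma measurable_bessel_integrand[measurable]: "case_prod (bessel_integrand a) \<in> borel_measurable (borel \<Otimes>\<^sub>M borel)"
  unfolding bessel_integrand_def[abs_def] by measurable

lemma measurable_bessel_integrand2[measurable]: "bessel_integrand a w \<in> borel_measurable borel"
  unfolding bessel_integrand_def[abs_def] by measurable

lemma measurable_bessel_integral[measurable]: "bessel_integral a \<in> borel_measurable borel"
  unfolding bessel_integral_def[abs_def] by measurable

lemma bessel_integrand_nonneg: "0 \<le> bessel_integrand a w t"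
  by (simp add: bessel_integrand_def)

lemma bessel_integrand_le:
  assumes "a > 0" "w \<ge> 0"
  shows "bessel_integrand a w t \<le> Gamma a * gam_density a t"
proof (cases "t > 0")
  case True
  then have "exp (- t - w / t) \<le> exp (- t)" using assms by simp
  then have "t powr (a - 1) * exp (- t - w / t) \<le> t powr (a - 1) * exp (- t)"
    by (rule mult_left_mono) simp
  moreover have "Gamma a \<noteq> 0" using Gamma_real_pos[OF assms(1)] by simp
  ultimately show ?thesis using True by (simp add: bessel_integrand_def gam_density_def)
qed (simp add: bessel_integrand_def gam_density_def)

lemma integrable_gam_density: "a > 0 \<Longrightarrow> integrable lborel (gam_density a)"
  using nn_integral_gam_density_power[of a 0]
  by (intro integrableI_nonneg) (auto simp: gam_density_nonneg)

lemma integrable_bessel_integrand: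
  assumes a: "a > 0" and w: "w \<ge> 0"
  shows "integrable lborel (bessel_integrand a w)"
proof (rule Bochner_Integration.integrable_bound)
  show "integrable lborel (\<lambda>t. Gamma a * gam_density a t)"
    by (intro integrable_mult_right integrable_gam_density a)
  show "AE t in lborel. norm (bessel_integrand a w t) \<le> norm (Gamma a * gam_density a t)"
    using bessel_integrand_le[OF a w] bessel_integrand_nonneg Gamma_real_pos[OF a] gam_density_nonneg[OF a]
    by (intro AE_I2) (simp add: abs_mult less_imp_le)
qed measurable

lemma nn_integral_bessel_integrand:
  assumes "a > 0" "w \<ge> 0"
  shows "(\<integral>\<^sup>+t. ennreal (bessel_integrand a w t) \<partial>lborel) = ennreal (bessel_integral a w)"
  unfolding bessel_integral_def
  by (intro nn_integral_eq_integral integrable_bessel_integrand assms AE_I2 bessel_integrand_nonneg)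

lemma bessel_integral_pos:
  assumes a: "a > 0" and w: "w \<ge> 0"
  shows "0 < bessel_integral a w"
proof -
  have "bessel_integral a w \<noteq> 0"
  proof
    assume "bessel_integral a w = 0"
    then have "AE t in lborel. bessel_integrand a w t = 0"
      using integral_nonneg_eq_0_iff_AE[OF integrable_bessel_integrand[OF a w]]
      by (simp add: bessel_integral_def bessel_integrand_nonneg)
    then have "AE t in lborel. t \<notin> {0<..<1::real}"
      by eventually_elim (auto simp: bessel_integrand_def split: if_splits)
    then have "emeasure lborel {0<..<1::real} = 0"
      by (subst (asm) AE_iff_measurable[where N = "{0<..<1}"]) auto
    then show False by simp
  qed
  moreover have "0 \<le> bessel_integral a w"
    unfolding bessel_integral_def by (intro Bochner_Integration.integral_nonneg bessel_integrand_nonneg)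
  ultimately show ?thesis by simp
qed

text \<open>The three integrands combine to the derivative of
  \<open>t powr a * exp (- t - w / t)\<close>, which tends to 0 at both ends. The condition
  \<open>a > 1\<close> keeps the lowest index positive, so that all integrals converge even for
  \<open>w = 0\<close>.\<close>

lemma bessel_integral_recursion:
  assumes a: "a > 1" and w: "w \<ge> 0"
  shows "bessel_integral (a + 1) w = a * bessel_integral a w + w * bessel_integral (a - 1) w"
proof -
  let ?F = "\<lambda>t. t powr a * exp (- t - w / t)"
  let ?f = "\<lambda>t. a * bessel_integrand a w t + w * bessel_integrand (a - 1) w t - bessel_integrand (a + 1) w t"
  have int: "integrable lborel ?f"
    using a w by (intro Bochner_Integration.integrable_diff Bochner_Integration.integrable_add integrable_mult_right
        integrable_bessel_integrand) auto
  have lim0: "(?F \<longlongrightarrow> 0) (at_right 0)"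
  proof (rule tendsto_sandwich)
    show "\<forall>\<^sub>F t in at_right 0. 0 \<le> ?F t" by simp
    show "\<forall>\<^sub>F t in at_right 0. ?F t \<le> t powr a"
      using eventually_at_right_less[of "0::real"]
    proof eventually_elim
      fix t :: real assume "0 < t"
      then have "0 \<le> w / t" using w by simp
      then have "exp (- t - w / t) \<le> 1" using \<open>0 < t\<close> by (simp del: zero_le_divide_iff divide_nonneg_pos)
      then show "?F t \<le> t powr a" by (simp add: mult_left_le)
    qed
    show "((\<lambda>t. t powr a) \<longlongrightarrow> 0) (at_right 0)"
      by (rule tendsto_zero_powrI[OF tendsto_ident_at tendsto_const])
         (use a eventually_at_right_less[of "0::real"] in \<open>auto elim!: eventually_mono\<close>)
  qed simp
  have liminf: "(?F \<longlongrightarrow> 0) at_top"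
  proof (rule tendsto_sandwich)
    show "\<forall>\<^sub>F t in at_top. 0 \<le> ?F t" by simp
    show "\<forall>\<^sub>F t in at_top. ?F t \<le> t ^ nat \<lceil>a\<rceil> / exp t"
      using eventually_gt_at_top[of "1::real"]
    proof eventually_elim
      fix t :: real assume t: "1 < t"
      have "t powr a \<le> t powr real (nat \<lceil>a\<rceil>)" using t by (intro powr_mono real_nat_ceiling_ge) simp
      also have "\<dots> = t ^ nat \<lceil>a\<rceil>" using t by (simp add: powr_realpow)
      finally have "t powr a * exp (- t - w / t) \<le> t ^ nat \<lceil>a\<rceil> * exp (- t)"
        using t w by (intro mult_mono) auto
      then show "?F t \<le> t ^ nat \<lceil>a\<rceil> / exp t" by (simp add: exp_minus field_simps)
    qed
    show "((\<lambda>t::real. t ^ nat \<lceil>a\<rceil> / exp t) \<longlongrightarrow> 0) at_top" using tendsto_power_div_exp_0[of "nat \<lceil>a\<rceil>"] by simp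
  qed simp
  have "(LBINT t=ereal 0..\<infinity>. ?f t) = 0 - 0"
  proof (rule interval_integral_FTC_integrable)
    fix t assume "ereal 0 < ereal t"
    then have t: "t > 0" by simp
    have "((\<lambda>t. t powr a * exp (- t - w / t)) has_real_derivative
        (a * t powr (a - 1)) * exp (- t - w / t) + t powr a * (exp (- t - w / t) * (- 1 + w / t\<^sup>2))) (at t)"
    proof (rule DERIV_cong[OF DERIV_mult[OF has_real_derivative_powr[OF t]]])
      show "((\<lambda>t. exp (- t - w / t)) has_real_derivative exp (- t - w / t) * (- 1 + w / t\<^sup>2)) (at t)"
        using t by (auto intro!: derivative_eq_intros simp: power2_eq_square)
    qed (simp add: mult.commute)
    also have "(a * t powr (a - 1)) * exp (- t - w / t) + t powr a * (exp (- t - w / t) * (- 1 + w / t\<^sup>2)) = ?f t"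
    proof -
      have "t powr (a - 1 - 1) = t powr a / t\<^sup>2"
        using t powr_diff[of t a 2] by (simp add: powr_numeral)
      then show ?thesis using t by (simp add: bessel_integrand_def algebra_simps)
    qed
    finally show "(?F has_vector_derivative ?f t) (at t)"
      by (simp add: has_real_derivative_iff_has_vector_derivative)
    \<comment> \<open>\<open>bessel_integrand\<close> is defined by cases, so continuity is checked
      on the closed formula that agrees with it near \<open>t > 0\<close>.\<close>
    let ?g = "\<lambda>t. a * (t powr (a - 1) * exp (- t - w / t)) + w * (t powr (a - 1 - 1) * exp (- t - w / t)) - t powr (a + 1 - 1) * exp (- t - w / t)"
    have "isCont ?g t" using t by (intro continuous_intros) auto
    moreover have "\<forall>\<^sub>F x in nhds t. ?f x = ?g x"
      using eventually_nhds_in_open[of "{0<..}" t] t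
      by (auto elim!: eventually_mono simp: bessel_integrand_def)
    ultimately show "isCont ?f t" by (simp only: isCont_cong[where f = ?f and g = ?g])
  next
    show "set_integrable lborel (einterval (ereal 0) \<infinity>) ?f"
      unfolding set_integrable_def using int by (intro integrable_mult_indicator) auto
    show "((?F \<circ> real_of_ereal) \<longlongrightarrow> 0) (at_right (ereal 0))" using lim0 by (simp add: ereal_tendsto_simps)
    show "((?F \<circ> real_of_ereal) \<longlongrightarrow> 0) (at_left \<infinity>)" using liminf by (simp add: ereal_tendsto_simps)
  qed simp
  moreover have "(LBINT t=ereal 0..\<infinity>. ?f t) = (\<integral>t. ?f t \<partial>lborel)"
    unfolding interval_lebesgue_integral_def set_lebesgue_integral_def
    by (auto simp: einterval_def bessel_integrand_def intro!: Bochner_Integration.integral_cong)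
  moreover have "(\<integral>t. ?f t \<partial>lborel) = a * bessel_integral a w + w * bessel_integral (a - 1) w - bessel_integral (a + 1) w"
    using integrable_bessel_integrand[of a w] integrable_bessel_integrand[of "a - 1" w] integrable_bessel_integrand[of "a + 1" w] a w
    by (simp add: bessel_integral_def)
  ultimately show ?thesis by simp
qed

text \<open>The recursion at index \<open>a - 1\<close> with its nonnegative last term dropped.
  Together with the next bound it controls the ratio of neighbouring integrals, which up to sign is
  the logarithmic derivative of \<open>bessel_integral a\<close>.\<close>

lemma bessel_ratio_upper:
  assumes a: "a > 2" and w: "w \<ge> 0"
  shows "(a - 1) * bessel_integral (a - 1) w \<le> bessel_integral a w"
proof -
  have "0 \<le> w * bessel_integral (a - 1 - 1) w"
    using a w bessel_integral_pos[of "a - 1 - 1" w] by simp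
  then show ?thesis using bessel_integral_recursion[of "a - 1" w] a w by simp
qed

text \<open>The recursion at \<open>a - 1\<close> again, its last term now estimated by the previous
  bound at the same index; hence the stronger condition on \<open>a\<close>.\<close>

lemma bessel_ratio_lower:
  assumes a: "a > 3" and w: "w \<ge> 0"
  shows "bessel_integral a w \<le> (a - 1 + w / (a - 2)) * bessel_integral (a - 1) w"
proof -
  have "(a - 2) * bessel_integral (a - 2) w \<le> bessel_integral (a - 1) w"
    using bessel_ratio_upper[of "a - 1" w] a w by simp
  then have "w * bessel_integral (a - 2) w \<le> w * (bessel_integral (a - 1) w / (a - 2))"
    using a w by (intro mult_left_mono) (simp_all add: field_simps)
  then show ?thesis using bessel_integral_recursion[of "a - 1" w] a w by (simp add: algebra_simps)
qed

section \<open>Differentiation of the Bessel integral in its argument\<close>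

lemma DERIV_quadratic_remainder:
  fixes f :: "real \<Rightarrow> real"
  assumes x: "x > 0" and bound: "\<And>y. y \<ge> 0 \<Longrightarrow> \<bar>f y - f x - (y - x) * L\<bar> \<le> C * (y - x)\<^sup>2"
  shows "(f has_real_derivative L) (at x)"
  unfolding has_field_derivative_iff
proof (rule LIM_zero_cancel, rule Lim_null_comparison)
  have "\<forall>\<^sub>F y in at x. 0 \<le> y \<and> y \<noteq> x"
    using x eventually_at_in_open[of "{0<..}" x] by (auto elim!: eventually_mono)
  then show "\<forall>\<^sub>F y in at x. norm ((f y - f x) / (y - x) - L) \<le> C * \<bar>y - x\<bar>"
  proof eventually_elim
    fix y assume y: "0 \<le> y \<and> y \<noteq> x"
    have "\<bar>(f y - f x) / (y - x) - L\<bar> = \<bar>f y - f x - (y - x) * L\<bar> / \<bar>y - x\<bar>"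
    proof -
      have "(f y - f x) / (y - x) - L = (f y - f x - (y - x) * L) / (y - x)"
        using y by (simp add: diff_divide_distrib)
      then show ?thesis by (simp only: abs_divide)
    qed
    also have "\<dots> \<le> C * (y - x)\<^sup>2 / \<bar>y - x\<bar>" using y bound[of y] by (intro divide_right_mono) auto
    also have "\<dots> = C * \<bar>y - x\<bar>"
    proof -
      have "(y - x)\<^sup>2 = \<bar>y - x\<bar> * \<bar>y - x\<bar>" by (simp add: power2_eq_square)
      then have "C * (y - x)\<^sup>2 / \<bar>y - x\<bar> = C * (\<bar>y - x\<bar> * \<bar>y - x\<bar>) / \<bar>y - x\<bar>" by (simp only:)
      then show ?thesis using y by (simp del: abs_mult_self_eq)
    qed
    finally show "norm ((f y - f x) / (y - x) - L) \<le> C * \<bar>y - x\<bar>" by simp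
  qed
  have "((\<lambda>y. C * \<bar>y - x\<bar>) \<longlongrightarrow> C * \<bar>x - x\<bar>) (at x)" by (intro tendsto_intros)
  then show "((\<lambda>y. C * \<bar>y - x\<bar>) \<longlongrightarrow> 0) (at x)" by simp
qed

text \<open>A Taylor remainder whose constant does not depend on the two points, so that it can be
  integrated over \<open>t\<close> with points \<open>w / t\<close> and
  \<open>y / t\<close>.\<close>

lemma exp_minus_second_order:
  fixes x y :: real
  assumes "x \<ge> 0" "y \<ge> 0"
  shows "\<bar>exp (- y) - exp (- x) + (y - x) * exp (- x)\<bar> \<le> (y - x)\<^sup>2"
proof -
  define d where "d = y - x"
  have eq: "exp (- y) - exp (- x) + (y - x) * exp (- x) = exp (- x) * (exp (- d) - 1 + d)"
    by (simp add: d_def exp_diff exp_minus field_simps)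
  have nonneg: "0 \<le> exp (- d) - 1 + d" using exp_ge_add_one_self[of "- d"] by simp
  have "exp (- x) * (exp (- d) - 1 + d) \<le> d\<^sup>2"
  proof (cases "d \<ge> 0")
    case True
    have "exp (- d) \<le> 1 / (1 + d)" using exp_ge_add_one_self[of d] True by (simp add: exp_minus field_simps)
    also have "\<dots> \<le> 1 - d + d\<^sup>2"
    proof -
      have "1 \<le> (1 - d + d\<^sup>2) * (1 + d)" using True by (simp add: algebra_simps power2_eq_square)
      then show ?thesis using True by (simp add: divide_le_eq)
    qed
    finally have "exp (- d) - 1 + d \<le> d\<^sup>2" by simp
    moreover have "exp (- x) \<le> 1" using assms by simp
    ultimately have "exp (- x) * (exp (- d) - 1 + d) \<le> 1 * d\<^sup>2" using nonneg by (intro mult_mono) auto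
    then show ?thesis by simp
  next
    case False
    \<comment> \<open>Here \<open>y \<ge> 0\<close> enters: it gives \<open>- x \<le> d\<close>, so
      \<open>exp (- x)\<close> compensates the growth of \<open>exp (- d)\<close> for negative
      \<open>d\<close>.\<close>
    have "exp (- x) \<le> exp d" using assms by (simp add: d_def)
    then have "exp (- x) * (exp (- d) - 1 + d) \<le> exp d * (exp (- d) - 1 + d)" using nonneg by (intro mult_right_mono)
    also have "\<dots> = 1 - exp d * (1 - d)" by (simp add: algebra_simps exp_minus)
    also have "\<dots> \<le> 1 - (1 + d) * (1 - d)"
      using False exp_ge_add_one_self[of d] by (intro diff_left_mono mult_right_mono) auto
    also have "\<dots> = d\<^sup>2" by (simp add: power2_eq_square algebra_simps)
    finally show ?thesis .
  qed
  moreover have "0 \<le> exp (- x) * (exp (- d) - 1 + d)" using nonneg by simp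
  ultimately show ?thesis unfolding eq by (simp add: d_def)
qed

text \<open>Differentiating in \<open>w\<close> lowers the power of \<open>t\<close> by one. The
  second-order remainder lowers it by two and is dominated by the integrand of index
  \<open>a - 2\<close> at \<open>w = 0\<close>, whence \<open>a > 2\<close>.\<close>

lemma DERIV_bessel_integral:
  assumes a: "a > 2" and w: "w > 0"
  shows "(bessel_integral a has_real_derivative - bessel_integral (a - 1) w) (at w)"
proof (rule DERIV_quadratic_remainder[OF w])
  fix y :: real assume y: "y \<ge> 0"
  let ?r = "\<lambda>t. bessel_integrand a y t - bessel_integrand a w t + (y - w) * bessel_integrand (a - 1) w t"
  note int = integrable_bessel_integrand
  have i: "integrable lborel ?r"
    using a w y by (intro Bochner_Integration.integrable_diff Bochner_Integration.integrable_add integrable_mult_right int) auto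
  have "bessel_integral a y - bessel_integral a w - (y - w) * - bessel_integral (a - 1) w = (\<integral>t. ?r t \<partial>lborel)"
    using a w y int[of a y] int[of a w] int[of "a - 1" w] by (simp add: bessel_integral_def)
  then have "\<bar>bessel_integral a y - bessel_integral a w - (y - w) * - bessel_integral (a - 1) w\<bar> = \<bar>\<integral>t. ?r t \<partial>lborel\<bar>"
    by simp
  also have "\<dots> \<le> (\<integral>t. \<bar>?r t\<bar> \<partial>lborel)" by (rule integral_abs_bound)
  also have "\<dots> \<le> (\<integral>t. (y - w)\<^sup>2 * bessel_integrand (a - 2) 0 t \<partial>lborel)"
  proof (rule integral_mono)
    show "integrable lborel (\<lambda>t. \<bar>?r t\<bar>)" by (rule integrable_abs[OF i])
    show "integrable lborel (\<lambda>t. (y - w)\<^sup>2 * bessel_integrand (a - 2) 0 t)"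
      using a by (intro integrable_mult_right int) auto
    fix t :: real
    show "\<bar>?r t\<bar> \<le> (y - w)\<^sup>2 * bessel_integrand (a - 2) 0 t"
    proof (cases "t > 0")
      case True
      have p1: "t powr (a - 1 - 1) = t powr (a - 1) / t" using True powr_diff[of t "a - 1" 1] by simp
      have p2: "t powr (a - 2 - 1) = t powr (a - 1) / t\<^sup>2" using True powr_diff[of t "a - 1" 2] by (simp add: powr_numeral algebra_simps)
      have ex: "exp (- t - v / t) = exp (- t) * exp (- (v / t))" for v by (simp add: exp_add[symmetric])
      have "?r t = t powr (a - 1) * exp (- t) * (exp (- (y / t)) - exp (- (w / t)) + (y / t - w / t) * exp (- (w / t)))"
      proof -
        have "p * (E * Y) - p * (E * Z) + (y - w) * (p / t * (E * Z)) = p * E * (Y - Z + (y / t - w / t) * Z)" for p E Y Z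
          by (simp add: algebra_simps diff_divide_distrib)
        then show ?thesis using True by (simp only: bessel_integrand_def p1 ex if_True)
      qed
      then have "\<bar>?r t\<bar> = t powr (a - 1) * exp (- t) * \<bar>exp (- (y / t)) - exp (- (w / t)) + (y / t - w / t) * exp (- (w / t))\<bar>"
        by (simp add: abs_mult)
      also have "\<dots> \<le> t powr (a - 1) * exp (- t) * (y / t - w / t)\<^sup>2"
        using True y w by (intro mult_left_mono exp_minus_second_order) auto
      also have "\<dots> = (y - w)\<^sup>2 * bessel_integrand (a - 2) 0 t"
        using True p2[simplified] by (simp add: bessel_integrand_def diff_divide_distrib[symmetric] power_divide)
      finally show ?thesis .
    qed (simp add: bessel_integrand_def)
  qed
  also have "\<dots> = bessel_integral (a - 2) 0 * (y - w)\<^sup>2" by (simp add: bessel_integral_def)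
  finally show "\<bar>bessel_integral a y - bessel_integral a w - (y - w) * - bessel_integral (a - 1) w\<bar> \<le> bessel_integral (a - 2) 0 * (y - w)\<^sup>2" .
qed

text \<open>The normal density of variance \<open>2 * t\<close> mixed over the Gamma law of shape
  \<open>n / 2\<close>: its factor \<open>t powr (- 1/2)\<close> lowers the index to
  \<open>(n - 1) / 2\<close>, and its exponent \<open>s^2 / (4 * t)\<close> gives the argument
  \<open>s^2 / 4\<close>.\<close>

definition inner_pair_density :: "nat \<Rightarrow> real \<Rightarrow> real" where
  "inner_pair_density n s = bessel_integral ((real n - 1) / 2) (s\<^sup>2 / 4) / (2 * sqrt pi * Gamma (real n / 2))"

lemma measurable_inner_pair_density[measurable]: "inner_pair_density n \<in> borel_measurable borel"
  unfolding inner_pair_density_def[abs_def] by measurable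

lemma inner_pair_density_pos: "n > 1 \<Longrightarrow> 0 < inner_pair_density n s"
  unfolding inner_pair_density_def
  by (intro divide_pos_pos bessel_integral_pos mult_pos_pos Gamma_real_pos) auto

lemma nn_integral_inner_pair_density:
  fixes F :: "real \<Rightarrow> ennreal"
  assumes n: "n > 1" and [measurable]: "F \<in> borel_measurable borel"
  shows "(\<integral>\<^sup>+w. F (inner_pair n w) \<partial>gauss_pair n) = (\<integral>\<^sup>+s. F s * ennreal (inner_pair_density n s) \<partial>lborel)"
proof -
  let ?a = "(real n - 1) / 2"
  let ?c = "1 / (2 * sqrt pi * Gamma (real n / 2))"
  have G: "Gamma (real n / 2) > 0" using n by (intro Gamma_real_pos) simp
  have c: "?c > 0" using G by simp
  have "(\<integral>\<^sup>+w. F (inner_pair n w) \<partial>gauss_pair n)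
    = (\<integral>\<^sup>+t. ennreal (gam_density (real n / 2) t) * (\<integral>\<^sup>+x. F (sqrt (2 * t) * x) \<partial>std_normal) \<partial>lborel)"
    using n by (intro nn_integral_inner_pair) auto
  also have "\<dots> = (\<integral>\<^sup>+t. (\<integral>\<^sup>+s. F s * ennreal (?c * bessel_integrand ?a (s\<^sup>2 / 4) t) \<partial>lborel) \<partial>lborel)"
  proof (intro nn_integral_cong)
    fix t :: real
    show "ennreal (gam_density (real n / 2) t) * (\<integral>\<^sup>+x. F (sqrt (2 * t) * x) \<partial>std_normal)
      = (\<integral>\<^sup>+s. F s * ennreal (?c * bessel_integrand ?a (s\<^sup>2 / 4) t) \<partial>lborel)"
    proof (cases "t > 0")
      case True
      define \<sigma> where "\<sigma> = sqrt (2 * t)"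
      have \<sigma>: "\<sigma> > 0" "\<sigma>\<^sup>2 = 2 * t" using True by (auto simp: \<sigma>_def)
      have g: "0 \<le> gam_density (real n / 2) t" using n by (simp add: gam_density_nonneg)
      have "(\<integral>\<^sup>+s. F s * ennreal (?c * bessel_integrand ?a (s\<^sup>2 / 4) t) \<partial>lborel)
        = ennreal \<sigma> * (\<integral>\<^sup>+x. F (\<sigma> * x) * ennreal (?c * bessel_integrand ?a ((\<sigma> * x)\<^sup>2 / 4) t) \<partial>lborel)"
        using \<sigma> by (subst nn_integral_real_affine[of _ \<sigma> 0]) auto
      also have "\<dots> = (\<integral>\<^sup>+x. F (\<sigma> * x) * ennreal (\<sigma> * (?c * bessel_integrand ?a ((\<sigma> * x)\<^sup>2 / 4) t)) \<partial>lborel)"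
      proof -
        have "ennreal \<sigma> * (y * ennreal u) = y * ennreal (\<sigma> * u)" for y u
          using \<sigma> by (simp add: ennreal_mult' mult_ac)
        then show ?thesis by (subst nn_integral_cmult[symmetric]) auto
      qed
      also have "\<dots> = (\<integral>\<^sup>+x. ennreal (gam_density (real n / 2) t) * (ennreal (std_normal_density x) * F (\<sigma> * x)) \<partial>lborel)"
      proof (intro nn_integral_cong)
        fix x :: real
        have "t powr (?a - 1) * \<sigma> = sqrt 2 * t powr (real n / 2 - 1)"
        proof -
          have "\<sigma> = sqrt 2 * t powr (1/2)" using True by (simp add: \<sigma>_def real_sqrt_mult powr_half_sqrt)
          moreover have "t powr (?a - 1) * t powr (1/2) = t powr (real n / 2 - 1)"
            by (simp add: powr_add[symmetric] diff_divide_distrib)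
          ultimately show ?thesis by simp
        qed
        moreover have "exp (- t - (\<sigma> * x)\<^sup>2 / 4 / t) = exp (- t) * exp (- x\<^sup>2 / 2)"
          using True by (simp add: power_mult_distrib \<sigma> exp_add[symmetric])
        moreover have "sqrt 2 / (2 * sqrt pi) = 1 / sqrt (2 * pi)"
          by (simp add: real_sqrt_mult field_simps)
        ultimately have "\<sigma> * (?c * bessel_integrand ?a ((\<sigma> * x)\<^sup>2 / 4) t) = gam_density (real n / 2) t * std_normal_density x"
        proof -
          assume A: "t powr (?a - 1) * \<sigma> = sqrt 2 * t powr (real n / 2 - 1)"
            "exp (- t - (\<sigma> * x)\<^sup>2 / 4 / t) = exp (- t) * exp (- x\<^sup>2 / 2)" "sqrt 2 / (2 * sqrt pi) = 1 / sqrt (2 * pi)"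
          have "\<sigma> * (?c * bessel_integrand ?a ((\<sigma> * x)\<^sup>2 / 4) t)
            = (t powr (?a - 1) * \<sigma>) * exp (- t - (\<sigma> * x)\<^sup>2 / 4 / t) / (2 * sqrt pi) / Gamma (real n / 2)"
            using True by (simp add: bessel_integrand_def)
          also have "\<dots> = (sqrt 2 / (2 * sqrt pi)) * (t powr (real n / 2 - 1) * exp (- t) / Gamma (real n / 2)) * exp (- x\<^sup>2 / 2)"
            unfolding A(1,2) by simp
          also have "\<dots> = gam_density (real n / 2) t * std_normal_density x"
            unfolding A(3) using True by (simp add: gam_density_def std_normal_density_def)
          finally show ?thesis .
        qed
        then show "F (\<sigma> * x) * ennreal (\<sigma> * (?c * bessel_integrand ?a ((\<sigma> * x)\<^sup>2 / 4) t))
          = ennreal (gam_density (real n / 2) t) * (ennreal (std_normal_density x) * F (\<sigma> * x))"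
          using g by (simp only: ennreal_mult') (simp only: mult_ac)
      qed
      also have "\<dots> = ennreal (gam_density (real n / 2) t) * (\<integral>\<^sup>+x. F (\<sigma> * x) \<partial>std_normal)"
        by (simp add: nn_integral_cmult nn_integral_density)
      finally show ?thesis by (simp only: \<sigma>_def)
    qed (simp add: gam_density_def bessel_integrand_def)
  qed
  also have "\<dots> = (\<integral>\<^sup>+s. (\<integral>\<^sup>+t. F s * ennreal (?c * bessel_integrand ?a (s\<^sup>2 / 4) t) \<partial>lborel) \<partial>lborel)"
    by (rule lborel_pair.Fubini') measurable
  also have "\<dots> = (\<integral>\<^sup>+s. F s * ennreal (inner_pair_density n s) \<partial>lborel)"
  proof (intro nn_integral_cong)
    fix s :: real
    have "(\<integral>\<^sup>+t. F s * ennreal (?c * bessel_integrand ?a (s\<^sup>2 / 4) t) \<partial>lborel)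
      = F s * (ennreal ?c * (\<integral>\<^sup>+t. ennreal (bessel_integrand ?a (s\<^sup>2 / 4) t) \<partial>lborel))"
      using c by (simp add: nn_integral_cmult ennreal_mult' del: times_divide_eq_left)
    also have "\<dots> = F s * (ennreal ?c * ennreal (bessel_integral ?a (s\<^sup>2 / 4)))"
      using n by (subst nn_integral_bessel_integrand) auto
    also have "ennreal ?c * ennreal (bessel_integral ?a (s\<^sup>2 / 4)) = ennreal (inner_pair_density n s)"
      using c by (subst ennreal_mult'[symmetric]) (auto simp: inner_pair_density_def)
    finally show "(\<integral>\<^sup>+t. F s * ennreal (?c * bessel_integrand ?a (s\<^sup>2 / 4) t) \<partial>lborel) = F s * ennreal (inner_pair_density n s)" .
  qed
  finally show ?thesis .
qed

text \<open>The law of the inner product on the positive axis, transported by the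
  \<open>r\<close>-th power; it carries half of the total mass.\<close>

definition power_density :: "nat \<Rightarrow> nat \<Rightarrow> real \<Rightarrow> real" where
  "power_density n r q = q powr (1 / real r - 1) / real r * inner_pair_density n (q powr (1 / real r))"

text \<open>For even \<open>r\<close> both signs of the inner product land on the positive axis,
  hence the factor 2; for odd \<open>r\<close> the law stays symmetric.\<close>

definition overlap_pdf :: "nat \<Rightarrow> nat \<Rightarrow> real \<Rightarrow> real" where
  "overlap_pdf n r q = (if q > 0 then (if even r then 2 else 1) * power_density n r q
     else if q < 0 \<and> odd r then power_density n r (- q) else 0)"

lemma measurable_power_density[measurable]: "power_density n r \<in> borel_measurable borel"
  unfolding power_density_def[abs_def] by measurable

lemma measurable_overlap_pdf[measurable]: "overlap_pdf n r \<in> borel_measurable borel"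
  unfolding overlap_pdf_def[abs_def] by measurable

lemma power_density_nonneg: "n > 1 \<Longrightarrow> 0 \<le> power_density n r q"
  by (simp add: power_density_def less_imp_le[OF inner_pair_density_pos])

lemma overlap_pdf_nonneg: "n > 1 \<Longrightarrow> 0 \<le> overlap_pdf n r q"
  by (simp add: overlap_pdf_def power_density_nonneg)

lemma nn_integral_inner_pair_power_half:
  fixes F :: "real \<Rightarrow> real"
  assumes n: "n > 1" and r: "r > 0" and [measurable]: "F \<in> borel_measurable borel"
    and F: "\<And>x. 0 \<le> F x"
  shows "(\<integral>\<^sup>+s. ennreal (F (s ^ r) * inner_pair_density n s) * indicator {0..} s \<partial>lborel)
    = (\<integral>\<^sup>+q. ennreal (F q * power_density n r q) * indicator {0..} q \<partial>lborel)"
proof -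
  have "(\<integral>\<^sup>+q. ennreal (F q * power_density n r q) * indicator {0..} q \<partial>lborel)
    = (\<integral>\<^sup>+s. ennreal ((F (1 * s ^ r) * power_density n r (1 * s ^ r)) * (1 * real r * s ^ (r - 1))) * indicator {0..} s \<partial>lborel)"
    using r by (intro nn_integral_power_substitution) auto
  also have "\<dots> = (\<integral>\<^sup>+s. ennreal (F (s ^ r) * inner_pair_density n s) * indicator {0..} s \<partial>lborel)"
  proof (intro nn_integral_cong_AE, use AE_lborel_singleton[of "0::real"] in eventually_elim)
    fix s :: real assume "s \<noteq> 0"
    then consider "s < 0" | "s > 0" by linarith
    then show "ennreal ((F (1 * s ^ r) * power_density n r (1 * s ^ r)) * (1 * real r * s ^ (r - 1))) * indicator {0..} s
      = ennreal (F (s ^ r) * inner_pair_density n s) * indicator {0..} s"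
    proof cases
      case 2
      have 1: "(s ^ r) powr (1 / real r) = s" using 2 r by (simp add: powr_realpow[symmetric] powr_powr)
      have "(s ^ r) powr (1 / real r - 1) * s ^ (r - 1) = s powr (real r * (1 / real r - 1) + real (r - 1))"
        using 2 r by (simp add: powr_realpow[symmetric] powr_powr powr_add)
      also have "real r * (1 / real r - 1) + real (r - 1) = 0" using r by (simp add: of_nat_diff algebra_simps)
      finally have "(s ^ r) powr (1 / real r - 1) * s ^ (r - 1) = 1" using 2 by simp
      then have "power_density n r (s ^ r) * (real r * s ^ (r - 1)) = inner_pair_density n s"
        unfolding power_density_def 1 using r by (simp add: field_simps)
      then show ?thesis by (simp add: mult.assoc)
    qed simp
  qed
  finally show ?thesis by simp
qed

lemma nn_integral_overlap_pdf:
  fixes F :: "real \<Rightarrow> real"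
  assumes n: "n > 1" and r: "r > 0" and [measurable]: "F \<in> borel_measurable borel"
    and F: "\<And>x. 0 \<le> F x"
  shows "(\<integral>\<^sup>+w. ennreal (F (inner_pair n w ^ r)) \<partial>gauss_pair n) = (\<integral>\<^sup>+q. ennreal (F q * overlap_pdf n r q) \<partial>lborel)"
proof -
  let ?g = "inner_pair_density n" and ?b = "power_density n r"
  have ev: "?g (- s) = ?g s" for s by (simp add: inner_pair_density_def)
  have g0: "0 \<le> ?g s" for s using inner_pair_density_pos[OF n] by (simp add: less_imp_le)
  have b0: "0 \<le> ?b s" for s by (rule power_density_nonneg[OF n])
  have "(\<integral>\<^sup>+w. ennreal (F (inner_pair n w ^ r)) \<partial>gauss_pair n) = (\<integral>\<^sup>+s. ennreal (F (s ^ r)) * ennreal (?g s) \<partial>lborel)"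
    using n by (intro nn_integral_inner_pair_density) auto
  also have "\<dots> = (\<integral>\<^sup>+s. ennreal (F (s ^ r) * ?g s) \<partial>lborel)" using F by (simp add: ennreal_mult')
  also have "\<dots> = (\<integral>\<^sup>+s. ennreal (F (s ^ r) * ?g s) * indicator {0..} s \<partial>lborel)
      + (\<integral>\<^sup>+s. ennreal (F ((- s) ^ r) * ?g (- s)) * indicator {0..} s \<partial>lborel)"
    by (rule nn_integral_split_sign) measurable
  also have "(\<integral>\<^sup>+s. ennreal (F (s ^ r) * ?g s) * indicator {0..} s \<partial>lborel)
      = (\<integral>\<^sup>+q. ennreal (F q * ?b q) * indicator {0..} q \<partial>lborel)"
    by (rule nn_integral_inner_pair_power_half[OF n r assms(3) F])
  \<comment> \<open>The density of the inner product is even, so the negative half-line is a second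
    copy of the positive one; for odd \<open>r\<close> the test function gets reflected.\<close>
  also have "(\<integral>\<^sup>+s. ennreal (F ((- s) ^ r) * ?g (- s)) * indicator {0..} s \<partial>lborel)
      = (\<integral>\<^sup>+q. ennreal ((if even r then F q else F (- q)) * ?b q) * indicator {0..} q \<partial>lborel)"
    using nn_integral_inner_pair_power_half[OF n r, of "if even r then F else (\<lambda>q. F (- q))"] F
    by (cases "even r") (simp_all add: ev)
  also have "(\<integral>\<^sup>+q. ennreal (F q * ?b q) * indicator {0..} q \<partial>lborel)
      + (\<integral>\<^sup>+q. ennreal ((if even r then F q else F (- q)) * ?b q) * indicator {0..} q \<partial>lborel)
     = (\<integral>\<^sup>+q. ennreal (F q * overlap_pdf n r q) * indicator {0..} q \<partial>lborel)
      + (\<integral>\<^sup>+q. ennreal (F (- q) * overlap_pdf n r (- q)) * indicator {0..} q \<partial>lborel)"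
  proof (cases "even r")
    case True
    have "(\<integral>\<^sup>+q. ennreal (F q * ?b q) * indicator {0..} q \<partial>lborel) + (\<integral>\<^sup>+q. ennreal (F q * ?b q) * indicator {0..} q \<partial>lborel)
      = (\<integral>\<^sup>+q. ennreal (F q * ?b q) * indicator {0..} q + ennreal (F q * ?b q) * indicator {0..} q \<partial>lborel)"
      by (rule nn_integral_add[symmetric]) auto
    also have "\<dots> = (\<integral>\<^sup>+q. ennreal (F q * overlap_pdf n r q) * indicator {0..} q \<partial>lborel)"
      using AE_lborel_singleton[of "0::real"] True F b0
      by (intro nn_integral_cong_AE)
         (auto elim!: eventually_mono simp: overlap_pdf_def indicator_def ennreal_plus[symmetric] simp del: ennreal_plus)
    moreover have "(\<integral>\<^sup>+q. ennreal (F (- q) * overlap_pdf n r (- q)) * indicator {0..} q \<partial>lborel) = (\<integral>\<^sup>+q. 0 \<partial>(lborel :: real measure))"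
      using True by (intro nn_integral_cong) (auto simp: overlap_pdf_def indicator_def)
    ultimately show ?thesis using True by simp
  next
    case False
    have "(\<integral>\<^sup>+q. ennreal (F q * ?b q) * indicator {0..} q \<partial>lborel) = (\<integral>\<^sup>+q. ennreal (F q * overlap_pdf n r q) * indicator {0..} q \<partial>lborel)"
      using AE_lborel_singleton[of "0::real"] False
      by (intro nn_integral_cong_AE) (auto elim!: eventually_mono simp: overlap_pdf_def indicator_def)
    moreover have "(\<integral>\<^sup>+q. ennreal (F (- q) * ?b q) * indicator {0..} q \<partial>lborel) = (\<integral>\<^sup>+q. ennreal (F (- q) * overlap_pdf n r (- q)) * indicator {0..} q \<partial>lborel)"
      using AE_lborel_singleton[of "0::real"] False
      by (intro nn_integral_cong_AE) (auto elim!: eventually_mono simp: overlap_pdf_def indicator_def)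
    ultimately show ?thesis using False by simp
  qed
  also have "\<dots> = (\<integral>\<^sup>+q. ennreal (F q * overlap_pdf n r q) \<partial>lborel)"
    by (rule nn_integral_split_sign[symmetric]) measurable
  finally show ?thesis .
qed

text \<open>The derivative is kept as the density times its logarithmic derivative, since the latter
  is what the potential sees. The condition \<open>n > 5\<close> is \<open>a > 2\<close>, the range
  of \<open>DERIV_bessel_integral\<close>.\<close>

lemma DERIV_overlap_pdf:
  assumes n: "n > 5" and r: "r > 0" and q: "q > 0"
  defines "a \<equiv> (real n - 1) / 2" and "w \<equiv> q powr (2 / real r) / 4"
  shows "((\<lambda>q. overlap_pdf n r q) has_real_derivative
    - overlap_pdf n r q * ((1 - 1 / real r) / q + q powr (2 / real r - 1) / (2 * real r) * (bessel_integral (a - 1) w / bessel_integral a w))) (at q)"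
proof -
  define C where "C = (if even r then 2 else 1) / real r / (2 * sqrt pi * Gamma (real n / 2))"
  have pdf: "overlap_pdf n r x = C * (x powr (1 / real r - 1) * bessel_integral a (x powr (2 / real r) / 4))" if "x > 0" for x
  proof -
    have "(x powr (1 / real r))\<^sup>2 = x powr (2 / real r)"
      using that by (simp add: power2_eq_square powr_add[symmetric])
    then show ?thesis using that by (simp add: overlap_pdf_def power_density_def inner_pair_density_def C_def a_def)
  qed
  have w: "w > 0" using q by (simp add: w_def)
  have a: "a > 2" using n by (simp add: a_def)
  have I: "bessel_integral a w > 0" using a w by (intro bessel_integral_pos) auto
  have d1: "((\<lambda>x. x powr (2 / real r) / 4) has_real_derivative (2 / real r) * q powr (2 / real r - 1) / 4) (at q)"
    using has_real_derivative_powr[OF q, of "2 / real r"] by (rule DERIV_cdivide)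
  have d2: "((\<lambda>x. bessel_integral a (x powr (2 / real r) / 4)) has_real_derivative
      - bessel_integral (a - 1) w * ((2 / real r) * q powr (2 / real r - 1) / 4)) (at q)"
    using DERIV_chain2[OF DERIV_bessel_integral[OF a w, unfolded w_def] d1] by (simp add: w_def)
  have d3: "((\<lambda>x. C * (x powr (1 / real r - 1) * bessel_integral a (x powr (2 / real r) / 4))) has_real_derivative
      C * ((1 / real r - 1) * q powr (1 / real r - 1 - 1) * bessel_integral a w
        + - bessel_integral (a - 1) w * ((2 / real r) * q powr (2 / real r - 1) / 4) * q powr (1 / real r - 1))) (at q)"
    using DERIV_cmult[OF DERIV_mult[OF has_real_derivative_powr[OF q, of "1 / real r - 1"] d2], of C] by (simp add: w_def)
  have "q powr (1 / real r - 1 - 1) = q powr (1 / real r - 1) / q" using q powr_diff[of q "1 / real r - 1" 1] by simp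
  moreover have "C * ((1 / \<rho> - 1) * (p / q) * b + - b' * ((2 / \<rho>) * u / 4) * p)
      = - (C * (p * b)) * ((1 - 1 / \<rho>) / q + u / (2 * \<rho>) * (b' / b))" if "b > 0" "\<rho> > 0" for \<rho> p b b' u :: real
    using that q by (simp add: field_simps)
  ultimately have "C * ((1 / real r - 1) * q powr (1 / real r - 1 - 1) * bessel_integral a w
        + - bessel_integral (a - 1) w * ((2 / real r) * q powr (2 / real r - 1) / 4) * q powr (1 / real r - 1))
     = - (C * (q powr (1 / real r - 1) * bessel_integral a w)) * ((1 - 1 / real r) / q + q powr (2 / real r - 1) / (2 * real r) * (bessel_integral (a - 1) w / bessel_integral a w))"
    using I r by simp
  then have d4: "((\<lambda>x. C * (x powr (1 / real r - 1) * bessel_integral a (x powr (2 / real r) / 4))) has_real_derivative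
      - overlap_pdf n r q * ((1 - 1 / real r) / q + q powr (2 / real r - 1) / (2 * real r) * (bessel_integral (a - 1) w / bessel_integral a w))) (at q)"
    using d3 pdf[OF q] by (simp only: w_def)
  show ?thesis
    by (rule has_field_derivative_transform_within_open[OF d4, of "{0<..}"]) (use q pdf in auto)
qed

lemma overlap_pdf_pos:
  assumes "n > 1" "r > 0" "q > 0" shows "0 < overlap_pdf n r q"
  using assms inner_pair_density_pos[OF assms(1)] by (simp add: overlap_pdf_def power_density_def)

section \<open>The tensor prior\<close>

lemma finite_tensor_index: "finite (tensor_index n r)"
  unfolding tensor_index_def by (intro finite_PiE) auto

lemma measurable_tensor_power: "tensor_power n r \<in> measurable (gaussian_vector {..<n}) (\<Pi>\<^sub>M j\<in>tensor_index n r. borel)"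
  unfolding tensor_power_def[abs_def]
proof (rule measurable_restrict)
  fix j assume j: "j \<in> tensor_index n r"
  show "(\<lambda>v. \<Prod>k<r. v (j k)) \<in> borel_measurable (gaussian_vector {..<n})"
    using j by (intro borel_measurable_prod measurable_gaussian_vector_component) (auto simp: tensor_index_def)
qed

lemma sets_tensor_prior: "sets (tensor_prior n r) = sets (\<Pi>\<^sub>M j\<in>tensor_index n r. borel)"
  by (simp add: tensor_prior_def)

lemma prob_space_tensor_prior: "prob_space (tensor_prior n r)"
  unfolding tensor_prior_def
  by (rule prob_space.prob_space_distr[OF prob_space_gaussian_vector measurable_tensor_power])

lemma all_moments_tensor_prior:
  assumes j: "j \<in> tensor_index n r"
  shows "all_moments (tensor_prior n r) (\<lambda>x. x j)"
  unfolding tensor_prior_def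
proof (rule all_moments_distr[OF measurable_tensor_power])
  interpret G: prob_space "gaussian_vector {..<n}" by (rule prob_space_gaussian_vector)
  have "all_moments (gaussian_vector {..<n}) (\<lambda>v. \<Prod>k<r. v (j k))"
    using j by (intro G.all_moments_prod all_moments_gaussian_vector) (auto simp: tensor_index_def)
  then show "all_moments (gaussian_vector {..<n}) (\<lambda>v. tensor_power n r v j)"
    using j by (simp add: tensor_power_def)
  show "(\<lambda>x. x j) \<in> borel_measurable (\<Pi>\<^sub>M j\<in>tensor_index n r. borel)"
    using j by (rule measurable_component_singleton)
qed

lemma additive_model_tensor: "lam \<ge> 0 \<Longrightarrow> additive_model (tensor_index n r) (tensor_prior n r) lam"
  by (intro additive_model.intro finite_tensor_index prob_space_tensor_prior sets_tensor_prior all_moments_tensor_prior)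

text \<open>Expanding the \<open>r\<close>-fold product of the sum over coordinates yields one
  summand per multi-index.\<close>

lemma overlap_tensor_power:
  "overlap (tensor_index n r) (tensor_power n r v, tensor_power n r v') = inner_pair n (v, v') ^ r"
proof -
  have "inner_pair n (v, v') ^ r = (\<Prod>k<r. \<Sum>i<n. v i * v' i)" by (simp add: inner_pair_def)
  also have "\<dots> = (\<Sum>j\<in>tensor_index n r. \<Prod>k<r. v (j k) * v' (j k))"
    unfolding tensor_index_def by (rule prod_sum_PiE) auto
  also have "\<dots> = overlap (tensor_index n r) (tensor_power n r v, tensor_power n r v')"
    by (simp add: overlap_def tensor_power_def prod.distrib)
  finally show ?thesis ..
qed

section \<open>The law of the overlap under the tensor prior\<close>

lemma measurable_overlap:
  assumes "finite J"
  shows "overlap J \<in> borel_measurable ((\<Pi>\<^sub>M j\<in>J. borel) \<Otimes>\<^sub>M (\<Pi>\<^sub>M j\<in>J. borel))"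
  unfolding overlap_def by measurable

lemma tensor_prior_pair:
  "tensor_prior n r \<Otimes>\<^sub>M tensor_prior n r = distr (gauss_pair n)
     ((\<Pi>\<^sub>M j\<in>tensor_index n r. borel) \<Otimes>\<^sub>M (\<Pi>\<^sub>M j\<in>tensor_index n r. borel))
     (\<lambda>(v, v'). (tensor_power n r v, tensor_power n r v'))"
  unfolding tensor_prior_def
  by (intro pair_measure_distr measurable_tensor_power prob_space_imp_sigma_finite
      prob_space.prob_space_distr[OF prob_space_gaussian_vector measurable_tensor_power])

lemma measurable_tensor_pair:
  "(\<lambda>(v, v'). (tensor_power n r v, tensor_power n r v')) \<in> measurable (gauss_pair n)
     ((\<Pi>\<^sub>M j\<in>tensor_index n r. borel) \<Otimes>\<^sub>M (\<Pi>\<^sub>M j\<in>tensor_index n r. borel))"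
proof -
  note [measurable] = measurable_tensor_power
  show ?thesis by measurable
qed

lemma distr_overlap_tensor:
  "distr (tensor_prior n r \<Otimes>\<^sub>M tensor_prior n r) borel (overlap (tensor_index n r))
    = distr (gauss_pair n) borel (\<lambda>w. inner_pair n w ^ r)"
  unfolding tensor_prior_pair
  by (subst distr_distr[OF measurable_overlap[OF finite_tensor_index] measurable_tensor_pair])
     (auto intro!: distr_cong simp: overlap_tensor_power comp_def)

lemma measurable_overlap_tensor:
  "overlap (tensor_index n r) \<in> borel_measurable (tensor_prior n r \<Otimes>\<^sub>M tensor_prior n r)"
  unfolding tensor_prior_pair using measurable_overlap[OF finite_tensor_index] by simp

lemma overlap_moment_tensor:
  "(\<integral>w. overlap (tensor_index n r) w ^ k \<partial>(tensor_prior n r \<Otimes>\<^sub>M tensor_prior n r))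
    = (\<integral>w. inner_pair n w ^ (r * k) \<partial>gauss_pair n)"
proof -
  have "(\<integral>w. overlap (tensor_index n r) w ^ k \<partial>(tensor_prior n r \<Otimes>\<^sub>M tensor_prior n r))
    = (\<integral>s. s ^ k \<partial>distr (tensor_prior n r \<Otimes>\<^sub>M tensor_prior n r) borel (overlap (tensor_index n r)))"
    by (rule integral_distr[symmetric, OF measurable_overlap_tensor]) auto
  also have "\<dots> = (\<integral>w. (inner_pair n w ^ r) ^ k \<partial>gauss_pair n)"
    unfolding distr_overlap_tensor by (rule integral_distr) auto
  finally show ?thesis by (simp add: power_mult)
qed

lemma measure_overlap_tensor:
  "measure (tensor_prior n r \<Otimes>\<^sub>M tensor_prior n r)
     {w \<in> space (tensor_prior n r \<Otimes>\<^sub>M tensor_prior n r). \<bar>overlap (tensor_index n r) w\<bar> \<le> y}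
    = measure (gauss_pair n) {w \<in> space (gauss_pair n). \<bar>inner_pair n w\<bar> ^ r \<le> y}"
proof -
  have "measure (tensor_prior n r \<Otimes>\<^sub>M tensor_prior n r)
     {w \<in> space (tensor_prior n r \<Otimes>\<^sub>M tensor_prior n r). \<bar>overlap (tensor_index n r) w\<bar> \<le> y}
    = measure (distr (tensor_prior n r \<Otimes>\<^sub>M tensor_prior n r) borel (overlap (tensor_index n r))) {s. \<bar>s\<bar> \<le> y}"
    by (subst measure_distr[OF measurable_overlap_tensor]) (auto intro!: arg_cong[where f = "measure _"])
  also have "\<dots> = measure (gauss_pair n) {w \<in> space (gauss_pair n). \<bar>inner_pair n w\<bar> ^ r \<le> y}"
    unfolding distr_overlap_tensor
    by (subst measure_distr) (auto intro!: arg_cong[where f = "measure _"] simp: power_abs)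
  finally show ?thesis .
qed

text \<open>The squared norm of the tensor is the overlap of \<open>v\<close> with itself, that is,
  the norm of \<open>v\<close> to the power \<open>2 * r\<close>, and its mean is a Gamma
  moment.\<close>

lemma tpca_second_moment_eq:
  assumes n: "n > 0"
  shows "tpca_second_moment n r = 2 ^ r * pochhammer (real n / 2) r"
proof -
  let ?G = "gaussian_vector {..<n}"
  interpret G: prob_space ?G by (rule prob_space_gaussian_vector)
  have meas: "(\<lambda>x. \<Sum>j\<in>tensor_index n r. (x j :: real)\<^sup>2) \<in> borel_measurable (\<Pi>\<^sub>M j\<in>tensor_index n r. borel)"
    by (intro borel_measurable_sum borel_measurable_power measurable_component_singleton)
  have "tpca_second_moment n r = (\<integral>v. (\<Sum>j\<in>tensor_index n r. (tensor_power n r v j)\<^sup>2) \<partial>?G)"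
    unfolding tpca_second_moment_def second_moment_def tensor_prior_def
    by (rule integral_distr[OF measurable_tensor_power meas])
  also have "\<dots> = (\<integral>v. (\<Sum>i<n. (v i)\<^sup>2) ^ r \<partial>?G)"
  proof (intro Bochner_Integration.integral_cong refl)
    fix v :: "nat \<Rightarrow> real"
    have "(\<Sum>i<n. (v i)\<^sup>2) ^ r = inner_pair n (v, v) ^ r" by (simp add: inner_pair_def power2_eq_square)
    then show "(\<Sum>j\<in>tensor_index n r. (tensor_power n r v j)\<^sup>2) = (\<Sum>i<n. (v i)\<^sup>2) ^ r"
      using overlap_tensor_power[of n r v v] by (simp add: overlap_def power2_eq_square)
  qed
  finally have eq: "tpca_second_moment n r = (\<integral>v. (\<Sum>i<n. (v i)\<^sup>2) ^ r \<partial>?G)" .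
  have int: "integrable ?G (\<lambda>v. (\<Sum>i<n. (v i)\<^sup>2) ^ r)"
    by (intro all_moments_integrable G.all_moments_power G.all_moments_sum all_moments_gaussian_vector)
  have nn: "0 \<le> (\<Sum>i<n. (v i)\<^sup>2) ^ r" for v :: "nat \<Rightarrow> real" by (simp add: sum_nonneg)
  have "ennreal (tpca_second_moment n r) = (\<integral>\<^sup>+v. ennreal ((\<Sum>i<n. (v i)\<^sup>2) ^ r) \<partial>?G)"
    unfolding eq by (rule nn_integral_eq_integral[symmetric, OF int]) (use nn in auto)
  also have "\<dots> = (\<integral>\<^sup>+v. ennreal (2 ^ r * (\<Sum>i<n. (v i)\<^sup>2 / 2) ^ r) \<partial>?G)"
    by (simp add: sum_divide_distrib[symmetric] power_divide)
  also have "\<dots> = (\<integral>\<^sup>+t. ennreal (gam_density (real (card {..<n}) / 2) t) * ennreal (2 ^ r * t ^ r) \<partial>lborel)"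
    using n by (intro nn_integral_half_norm_sq) (auto simp: lessThan_empty_iff)
  also have "\<dots> = (\<integral>\<^sup>+t. ennreal (2 ^ r) * (ennreal (gam_density (real n / 2) t) * ennreal (t ^ r)) \<partial>lborel)"
  proof -
    have "ennreal (2 ^ r * t ^ r) = ennreal (2 ^ r) * ennreal (t ^ r)" for t :: real
      by (rule ennreal_mult') simp
    then show ?thesis by (simp only: mult_ac card_lessThan)
  qed
  also have "\<dots> = ennreal (2 ^ r) * ennreal (pochhammer (real n / 2) r)"
    using n by (subst nn_integral_cmult) (auto simp: nn_integral_gam_density_power)
  also have "\<dots> = ennreal (2 ^ r * pochhammer (real n / 2) r)"
    by (rule ennreal_mult'[symmetric]) simp
  finally show ?thesis
    using n pochhammer_nonneg[of "real n / 2" r] nn unfolding eq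
    by (subst (asm) ennreal_inj) (auto intro!: Bochner_Integration.integral_nonneg)
qed

lemma tpca_second_moment_bounds:
  assumes n: "n > 0"
  shows "real n ^ r \<le> tpca_second_moment n r" "tpca_second_moment n r \<le> (real n + 2 * real r) ^ r"
proof -
  have "real n ^ r = 2 ^ r * (real n / 2) ^ r" by (simp add: power_divide)
  also have "(real n / 2) ^ r = (\<Prod>i<r. real n / 2)" by simp
  also have "\<dots> \<le> (\<Prod>i<r. real n / 2 + real i)" by (intro prod_mono) auto
  also have "\<dots> = pochhammer (real n / 2) r" by (simp add: pochhammer_prod atLeast0LessThan)
  finally show "real n ^ r \<le> tpca_second_moment n r" by (simp add: tpca_second_moment_eq[OF n])
  have "2 ^ r * pochhammer (real n / 2) r \<le> 2 ^ r * (real n / 2 + real r) ^ r"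
    by (intro mult_left_mono pochhammer_le_power) auto
  also have "\<dots> = (real n + 2 * real r) ^ r" by (simp add: power_mult_distrib[symmetric] algebra_simps)
  finally show "tpca_second_moment n r \<le> (real n + 2 * real r) ^ r" by (simp add: tpca_second_moment_eq[OF n])
qed

text \<open>Both tail estimates transfer to the infimum: the upper level is itself admissible, and
  the strict lower tail bound keeps every admissible \<open>y\<close> above the lower level.\<close>

lemma overlap_quantile_bounds:
  assumes D: "D > 0" and n: "n \<ge> 800" "2 * D \<le> n" and r: "r > 0"
  shows "(sqrt (real n * real D) / 200) ^ r \<le> overlap_quantile (tensor_index n r) (tensor_prior n r) (real D)"
    and "overlap_quantile (tensor_index n r) (tensor_prior n r) (real D) \<le> (3 * sqrt (real n * real D)) ^ r"
proof -
  interpret prob_space "gauss_pair n" by (rule prob_space_gauss_pair)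
  define Q where "Q = {y. prob {w \<in> space (gauss_pair n). \<bar>inner_pair n w\<bar> ^ r \<le> y} \<ge> 1 - exp (- real D)}"
  have q: "overlap_quantile (tensor_index n r) (tensor_prior n r) (real D) = Inf Q"
    by (simp add: overlap_quantile_def Q_def measure_overlap_tensor)
  have pos: "exp (- real D) < 1" using D by simp
  let ?u = "3 * sqrt (real n * real D)" and ?l = "sqrt (real n * real D) / 200"
  have compl: "prob {w \<in> space (gauss_pair n). \<bar>inner_pair n w\<bar> \<le> s} = 1 - prob {w \<in> space (gauss_pair n). s < \<bar>inner_pair n w\<bar>}" for s
    by (subst prob_neg[symmetric]) (auto simp: not_less)
  have up: "?u ^ r \<in> Q"
  proof -
    have "\<bar>inner_pair n w\<bar> ^ r \<le> ?u ^ r" if "\<bar>inner_pair n w\<bar> \<le> ?u" for w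
      using that by (intro power_mono) auto
    then have "{w \<in> space (gauss_pair n). \<bar>inner_pair n w\<bar> \<le> ?u} \<subseteq> {w \<in> space (gauss_pair n). \<bar>inner_pair n w\<bar> ^ r \<le> ?u ^ r}"
      by blast
    then have "prob {w \<in> space (gauss_pair n). \<bar>inner_pair n w\<bar> \<le> ?u} \<le> prob {w \<in> space (gauss_pair n). \<bar>inner_pair n w\<bar> ^ r \<le> ?u ^ r}"
      by (rule finite_measure_mono) measurable
    then show ?thesis using inner_pair_tail_le[OF D n(2)] by (simp add: Q_def compl)
  qed
  have low: "?l ^ r \<le> y" if y: "y \<in> Q" for y
  proof (rule ccontr)
    assume "\<not> ?l ^ r \<le> y"
    then have "{w \<in> space (gauss_pair n). \<bar>inner_pair n w\<bar> ^ r \<le> y} \<subseteq> {w \<in> space (gauss_pair n). \<bar>inner_pair n w\<bar> \<le> ?l}"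
    proof (intro subsetI CollectI conjI)
      fix w assume "\<not> ?l ^ r \<le> y" "w \<in> {w \<in> space (gauss_pair n). \<bar>inner_pair n w\<bar> ^ r \<le> y}"
      then have "\<bar>inner_pair n w\<bar> ^ r < ?l ^ r" by simp
      then have "\<bar>inner_pair n w\<bar> < ?l" by (rule power_less_imp_less_base) simp
      then show "\<bar>inner_pair n w\<bar> \<le> ?l" by simp
    qed auto
    then have "prob {w \<in> space (gauss_pair n). \<bar>inner_pair n w\<bar> ^ r \<le> y} \<le> prob {w \<in> space (gauss_pair n). \<bar>inner_pair n w\<bar> \<le> ?l}"
      by (rule finite_measure_mono) measurable
    also have "\<dots> < 1 - exp (- real D)" unfolding compl using inner_pair_tail_gt[OF D n(1)] by linarith
    finally show False using y by (simp add: Q_def)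
  qed
  show "?l ^ r \<le> overlap_quantile (tensor_index n r) (tensor_prior n r) (real D)"
    unfolding q using up low by (intro cInf_greatest) auto
  show "overlap_quantile (tensor_index n r) (tensor_prior n r) (real D) \<le> ?u ^ r"
    unfolding q using up low by (intro cInf_lower) (auto simp: bdd_below_def)
qed

lemma is_overlap_density_overlap_pdf:
  assumes n: "n > 5" and r: "r > 0"
  shows "is_overlap_density (tensor_index n r) (tensor_prior n r) (overlap_pdf n r)"
proof -
  let ?P = "tensor_prior n r \<Otimes>\<^sub>M tensor_prior n r" and ?o = "overlap (tensor_index n r)"
  have "distr (gauss_pair n) borel (\<lambda>w. inner_pair n w ^ r) = density lborel (\<lambda>q. ennreal (overlap_pdf n r q))"
  proof (rule measure_eqI)
    fix B assume "B \<in> sets (distr (gauss_pair n) borel (\<lambda>w. inner_pair n w ^ r))"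
    then have [measurable]: "B \<in> sets borel" by simp
    have "emeasure (distr (gauss_pair n) borel (\<lambda>w. inner_pair n w ^ r)) B
      = (\<integral>\<^sup>+w. indicator B (inner_pair n w ^ r) \<partial>gauss_pair n)"
      using nn_integral_distr[of "\<lambda>w. inner_pair n w ^ r" "gauss_pair n" borel "indicator B"] by simp
    also have "\<dots> = (\<integral>\<^sup>+w. ennreal (indicator B (inner_pair n w ^ r)) \<partial>gauss_pair n)"
      by (simp add: ennreal_indicator)
    also have "\<dots> = (\<integral>\<^sup>+q. ennreal (indicator B q * overlap_pdf n r q) \<partial>lborel)"
      using n r by (intro nn_integral_overlap_pdf) auto
    also have "\<dots> = emeasure (density lborel (\<lambda>q. ennreal (overlap_pdf n r q))) B"
      by (subst emeasure_density) (auto intro!: nn_integral_cong simp: indicator_def)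
    finally show "emeasure (distr (gauss_pair n) borel (\<lambda>w. inner_pair n w ^ r)) B
      = emeasure (density lborel (\<lambda>q. ennreal (overlap_pdf n r q))) B" .
  qed simp
  then have "distr ?P lborel ?o = density lborel (\<lambda>q. ennreal (overlap_pdf n r q))"
    using distr_overlap_tensor[of n r] by (simp cong: distr_cong)
  then have "distributed ?P lborel ?o (\<lambda>q. ennreal (overlap_pdf n r q))"
    unfolding distributed_def using measurable_overlap_tensor[of n r] by simp
  moreover have "overlap_pdf n r differentiable_on {0<..}"
    unfolding differentiable_on_def real_differentiable_def
    using has_field_derivative_at_within[OF DERIV_overlap_pdf[OF n r]] by blast
  ultimately show ?thesis
    using n by (auto simp: is_overlap_density_def intro!: overlap_pdf_nonneg)
qed

text \<open>Two versions agree almost everywhere, and their difference is continuous on the positive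
  axis, so a point of disagreement would give an interval of positive length. This identifies the
  density picked by \<open>SOME\<close> with the explicit one.\<close>

lemma is_overlap_density_unique:
  assumes P: "prob_space P" and f: "is_overlap_density J P f" and g: "is_overlap_density J P g" and q: "q > 0"
  shows "f q = g q"
proof (rule ccontr)
  assume ne: "f q \<noteq> g q"
  interpret PP: prob_space "P \<Otimes>\<^sub>M P" by (intro prob_space_pair P)
  have "AE x in lborel. ennreal (f x) = ennreal (g x)"
    using f g unfolding is_overlap_density_def by (intro PP.distributed_unique) auto
  then have ae: "AE x in lborel. f x = g x"
    by eventually_elim (use f g in \<open>simp add: is_overlap_density_def\<close>)
  have cont: "continuous_on {0<..} (\<lambda>x. f x - g x)"
    using f g unfolding is_overlap_density_def
    by (intro continuous_on_diff differentiable_imp_continuous_on) auto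
  have "open ({0<..} \<inter> (\<lambda>x. f x - g x) -` (- {0}))"
    by (rule continuous_open_preimage[OF cont]) auto
  moreover have "q \<in> {0<..} \<inter> (\<lambda>x. f x - g x) -` (- {0})" using ne q by auto
  ultimately obtain e where e: "e > 0" "ball q e \<subseteq> {0<..} \<inter> (\<lambda>x. f x - g x) -` (- {0})"
    by (meson open_contains_ball)
  have "AE x in lborel. x \<notin> {q - e<..<q + e}"
    using ae
  proof eventually_elim
    fix x assume "f x = g x"
    then have "x \<notin> ball q e" using e(2) by auto
    then show "x \<notin> {q - e<..<q + e}" by (auto simp: dist_real_def)
  qed
  then have "emeasure lborel {q - e<..<q + e} = 0"
    by (subst (asm) AE_iff_measurable[where N = "{q - e<..<q + e}"]) auto
  then show False using e(1) by simp
qed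

text \<open>The chosen density equals \<open>overlap_pdf\<close> on a whole neighbourhood of
  \<open>q\<close>, so the derivatives agree too. The parameter \<open>lam\<close> enters only as
  the summand \<open>- lam\<close>; thus \<open>lam\<close> plus the slope depends on the prior and
  \<open>D\<close> alone.\<close>

lemma tpca_FP_slope_eq:
  fixes n r D :: nat and lam :: real
  assumes n: "n > 5" and r: "r > 0"
  defines "q \<equiv> overlap_quantile (tensor_index n r) (tensor_prior n r) (real D)"
    and "a \<equiv> (real n - 1) / 2"
  assumes q: "q > 0"
  shows "tpca_FP_slope n r D lam = - lam + ((1 - 1 / real r) / q
    + q powr (2 / real r - 1) / (2 * real r)
      * (bessel_integral (a - 1) (q powr (2 / real r) / 4) / bessel_integral a (q powr (2 / real r) / 4)))"
proof -
  let ?R = "(1 - 1 / real r) / q + q powr (2 / real r - 1) / (2 * real r)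
      * (bessel_integral (a - 1) (q powr (2 / real r) / 4) / bessel_integral a (q powr (2 / real r) / 4))"
  let ?J = "tensor_index n r" and ?P = "tensor_prior n r"
  have dens: "is_overlap_density ?J ?P (overlap_density ?J ?P)"
    unfolding overlap_density_def by (rule someI[of "is_overlap_density ?J ?P", OF is_overlap_density_overlap_pdf[OF n r]])
  have eq: "overlap_density ?J ?P x = overlap_pdf n r x" if "x > 0" for x
    by (rule is_overlap_density_unique[OF prob_space_tensor_prior dens is_overlap_density_overlap_pdf[OF n r] that])
  have pos: "overlap_pdf n r q > 0" using n r q by (intro overlap_pdf_pos) auto
  have "((\<lambda>x. - lam * x - ln (overlap_pdf n r x)) has_real_derivative
      - lam - inverse (overlap_pdf n r q) * (- overlap_pdf n r q * ?R)) (at q)"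
    using DERIV_diff[OF DERIV_cmult[OF DERIV_ident] DERIV_chain2[OF DERIV_ln[OF pos] DERIV_overlap_pdf[OF n r q]], of "- lam"]
    by (simp add: a_def)
  moreover have "- lam - inverse (overlap_pdf n r q) * (- overlap_pdf n r q * ?R) = - lam + ?R"
    using pos by (simp add: field_simps)
  ultimately have "((\<lambda>x. - lam * x - ln (overlap_pdf n r x)) has_real_derivative - lam + ?R) (at q)" by (simp only:)
  then have "(franz_parisi ?J ?P lam has_real_derivative - lam + ?R) (at q)"
    by (rule has_field_derivative_transform_within_open[of _ _ _ "{0<..}"]) (use q eq in \<open>auto simp: franz_parisi_def\<close>)
  then show ?thesis unfolding tpca_FP_slope_def q_def[symmetric] by (rule DERIV_imp_deriv)
qed

section \<open>Bounds for tensor PCA\<close>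

text \<open>A single term of the exponential series at \<open>k\<close> is at most its sum.\<close>

lemma power_div_fact_le: "real k ^ k / fact k \<le> 3 ^ k"
proof -
  have sums: "(\<lambda>i. real k ^ i / fact i) sums exp (real k)"
    using exp_converges[of "real k"] by (simp add: scaleR_conv_of_real divide_inverse mult.commute)
  have "real k ^ k / fact k = (\<Sum>i\<in>{k}. real k ^ i / fact i)" by simp
  also have "\<dots> \<le> (\<Sum>i. real k ^ i / fact i)"
    by (rule sum_le_suminf[OF sums_summable[OF sums]]) auto
  also have "\<dots> = exp (real k)" by (rule sums_unique[OF sums, symmetric])
  also have "\<dots> = exp 1 ^ k" by (simp add: exp_of_nat_mult[symmetric])
  also have "\<dots> \<le> 3 ^ k" using exp_le by (intro power_mono) auto
  finally show ?thesis .
qed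

lemma geometric_ninth: "(\<Sum>k\<le>D. (1/9 :: real) ^ k) \<le> 9/8"
proof -
  have "(\<Sum>k<Suc D. (1/9 :: real) ^ k) = (1 - (1/9) ^ Suc D) / (1 - 1/9)"
    by (rule sum_gp_strict[THEN trans]) simp
  also have "\<dots> \<le> 9/8" by simp
  finally show ?thesis by (simp only: lessThan_Suc_atMost)
qed

text \<open>The power of \<open>2 * r\<close> cancels the one in the moment bounds. The factor 27 is
  3 times 9: the 3 pays for \<open>k ^ k / k!\<close>, and the ratio 1/9 makes the geometric series
  from \<open>k = 1\<close> at most 1/8, as \<open>MMSE_ge\<close> demands.\<close>

definition snr_const :: "nat \<Rightarrow> real" where
  "snr_const r = 1 / (27 * (2 * real r) powr (real r / 2))"

lemma snr_const_pos: "r > 0 \<Longrightarrow> 0 < snr_const r"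
  by (simp add: snr_const_def)

text \<open>The powers of \<open>n\<close> cancel and \<open>(k / D) powr (r / 2)\<close> remains.
  As \<open>k \<le> D\<close> and \<open>r \<ge> 2\<close>, this is at most \<open>k / D\<close>,
  which offsets the factor \<open>D\<close> in front and leaves \<open>k / 27\<close>. The 2 in
  \<open>2 * r * k\<close> leaves room for moments of order \<open>k + 1\<close>, which is at most
  \<open>2 * k\<close>.\<close>

lemma tensor_term_bound:
  assumes r: "r \<ge> 2" and k: "0 < k" "k \<le> D" and n: "n > 0"
    and lam: "0 \<le> lam" "lam \<le> snr_const r * (real n * real D) powr (- real r / 2)"
  shows "(lam * real D * (2 * real r * real k * real n) powr (real r / 2)) ^ k / fact k \<le> (1/9) ^ k"
proof -
  let ?h = "real r / 2"
  let ?x = "lam * real D * (2 * real r * real k * real n) powr ?h"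
  have D: "real D > 0" using k by simp
  have "(2 * real r * real k * real n) powr ?h = (2 * real r) powr ?h * (real k / real D) powr ?h * (real n * real D) powr ?h"
  proof -
    have "2 * real r * real k * real n = (2 * real r) * (real k / real D) * (real n * real D)" using D by simp
    then show ?thesis by (simp only: powr_mult)
  qed
  then have "snr_const r * (real n * real D) powr (- real r / 2) * real D * (2 * real r * real k * real n) powr ?h
      = snr_const r * real D * ((2 * real r) powr ?h * (real k / real D) powr ?h)
        * ((real n * real D) powr (- real r / 2) * (real n * real D) powr ?h)"
    by (simp only: mult_ac)
  also have "(real n * real D) powr (- real r / 2) * (real n * real D) powr ?h = 1"
    using n D by (simp add: powr_add[symmetric])
  also have "snr_const r * real D * ((2 * real r) powr ?h * (real k / real D) powr ?h) * 1
      \<le> snr_const r * real D * ((2 * real r) powr ?h * (real k / real D))"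
  proof -
    have "(real k / real D) powr ?h \<le> (real k / real D) powr 1"
      using k D r by (intro powr_mono') auto
    then have "(real k / real D) powr ?h \<le> real k / real D" using k by simp
    then show ?thesis unfolding mult_1_right
      using snr_const_pos[of r] r D by (intro mult_left_mono) auto
  qed
  also have "\<dots> = real k / 27" using D r by (simp add: snr_const_def)
  finally have 1: "snr_const r * (real n * real D) powr (- real r / 2) * real D * (2 * real r * real k * real n) powr ?h \<le> real k / 27" .
  have "?x \<le> snr_const r * (real n * real D) powr (- real r / 2) * real D * (2 * real r * real k * real n) powr ?h"
    using lam by (intro mult_right_mono) auto
  with 1 have x: "?x \<le> real k / 27" by linarith
  have "?x ^ k / fact k \<le> (real k / 27) ^ k / fact k"
    using x lam by (intro divide_right_mono power_mono) auto
  also have "\<dots> = (1/27) ^ k * (real k ^ k / fact k)" by (simp add: power_divide)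
  also have "\<dots> \<le> (1/27) ^ k * 3 ^ k" by (intro mult_left_mono power_div_fact_le) auto
  also have "\<dots> = (1/9) ^ k" by (simp add: power_mult_distrib[symmetric])
  finally show ?thesis .
qed

text \<open>Moments of the inner product up to order \<open>r * (D + 1)\<close> occur, which
  accounts for the condition on \<open>n\<close>. The error has the size of its term
  \<open>k = 0\<close>; the further terms decay geometrically.\<close>

lemma tpca_MMSE_ge:
  assumes r: "r \<ge> 2" and D: "D > 0" and n: "r * (D + 1) \<le> n"
    and lam: "0 \<le> lam" "lam \<le> snr_const r * (real n * real D) powr (- real r / 2)"
  shows "tpca_second_moment n r - 8 * (2 * real r) powr (real r / 2) * (real D * real n) powr (real r / 2) \<le> tpca_MMSE n r D lam"
proof -
  interpret additive_model "tensor_index n r" "tensor_prior n r" lam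
    using lam by (intro additive_model_tensor)
  let ?h = "real r / 2"
  have "2 * 2 \<le> r * (D + 1)" using r D by (intro mult_le_mono) auto
  then have n0: "n > 0" using n by linarith
  have ov: "overlap_moment k \<le> ((2 * real r * real k * real n) powr ?h) ^ k" 
    "overlap_moment k \<le> ((real r * real k * real n) powr ?h) ^ k" if k: "0 < k" "k \<le> D + 1" for k
  proof -
    have rk: "r * k \<le> n" using mult_le_mono2[OF k(2), of r] n by linarith
    have "overlap_moment k \<le> (real (r * k) * real n) powr (real (r * k) / 2)"
      unfolding overlap_moment_def overlap_moment_tensor
      using k r rk n0 by (intro inner_pair_moment_bounds) auto
    also have "\<dots> = ((real r * real k * real n) powr ?h) ^ k"
      using k r n0 by (simp add: powr_powr powr_realpow[symmetric] mult_ac)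
    finally show *: "overlap_moment k \<le> ((real r * real k * real n) powr ?h) ^ k" .
    also have "\<dots> \<le> ((2 * real r * real k * real n) powr ?h) ^ k"
      by (intro power_mono powr_mono2) auto
    finally show "overlap_moment k \<le> ((2 * real r * real k * real n) powr ?h) ^ k" .
  qed
  have "(\<Sum>k=1..D. (lam * real D) ^ k / fact k * overlap_moment k) \<le> (\<Sum>k=1..D. (1/9) ^ k)"
  proof (intro sum_mono)
    fix k assume k: "k \<in> {1..D}"
    have "(lam * real D) ^ k / fact k * overlap_moment k
      \<le> (lam * real D) ^ k / fact k * ((2 * real r * real k * real n) powr ?h) ^ k"
      using k lam by (intro mult_left_mono ov(1)) auto
    also have "\<dots> = (lam * real D * (2 * real r * real k * real n) powr ?h) ^ k / fact k"
      by (simp add: power_mult_distrib)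
    also have "\<dots> \<le> (1/9) ^ k"
      using k by (intro tensor_term_bound r n0 lam) auto
    finally show "(lam * real D) ^ k / fact k * overlap_moment k \<le> (1/9) ^ k" .
  qed
  also have "\<dots> = (\<Sum>k\<le>D. (1/9) ^ k) - 1"
  proof -
    have "{..D} = insert 0 {1..D}" by auto
    then show ?thesis by simp
  qed
  also have "\<dots> \<le> 1/8" using geometric_ninth[of D] by simp
  finally have small: "(\<Sum>k=1..D. (lam * real D) ^ k / fact k * overlap_moment k) \<le> 1/8" .
  let ?X = "(2 * real r) powr ?h * (real D * real n) powr ?h"
  have X: "(real r * real (Suc k) * real n) powr ?h \<le> ?X" if "k \<le> D" for k
  proof -
    have "real r * real (Suc k) * real n \<le> real r * (2 * real D) * real n"
      using that D by (intro mult_mono) auto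
    then have "(real r * real (Suc k) * real n) powr ?h \<le> (real r * (2 * real D) * real n) powr ?h"
      by (intro powr_mono2) auto
    also have "\<dots> = ?X" by (simp add: powr_mult[symmetric] mult_ac)
    finally show ?thesis .
  qed
  have "(\<Sum>k\<le>D. lam ^ k / fact k * overlap_moment (Suc k)) \<le> (\<Sum>k\<le>D. ?X * (1/9) ^ k)"
  proof (intro sum_mono)
    fix k assume k: "k \<in> {..D}"
    let ?p = "(real r * real (Suc k) * real n) powr ?h"
    have "lam ^ k / fact k * overlap_moment (Suc k) \<le> lam ^ k / fact k * ?p ^ Suc k"
      using k lam by (intro mult_left_mono ov(2)) auto
    also have "\<dots> = ?p * ((lam * ?p) ^ k / fact k)" by (simp add: power_mult_distrib)
    \<comment> \<open>One factor of the moment bound of order \<open>k + 1\<close> is taken out as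
      \<open>?X\<close>. The other \<open>k\<close> factors go into
      \<open>tensor_term_bound\<close>, after replacing \<open>k + 1\<close> by \<open>2 * k\<close>
      and inserting \<open>real D\<close>, which is at least 1. The first replacement fails for
      \<open>k = 0\<close>, hence the case distinction.\<close>
    also have "\<dots> \<le> ?X * (1/9) ^ k"
    proof (cases "k = 0")
      case True then show ?thesis using X[of k] by simp
    next
      case False
      have "?p \<le> (2 * real r * real k * real n) powr ?h"
      proof (intro powr_mono2)
        have "real r * real (Suc k) * real n \<le> real r * (2 * real k) * real n"
          using False by (intro mult_mono) auto
        then show "real r * real (Suc k) * real n \<le> 2 * real r * real k * real n" by (simp add: mult_ac)
      qed auto
      also have "\<dots> \<le> real D * (2 * real r * real k * real n) powr ?h"
        using D by (simp add: mult_le_cancel_right1)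
      finally have "lam * ?p \<le> lam * real D * (2 * real r * real k * real n) powr ?h"
        using lam by (simp add: mult_left_mono mult.assoc)
      then have "(lam * ?p) ^ k / fact k \<le> (lam * real D * (2 * real r * real k * real n) powr ?h) ^ k / fact k"
        using lam by (intro divide_right_mono power_mono) auto
      also have "\<dots> \<le> (1/9) ^ k"
        using k False by (intro tensor_term_bound r n0 lam) auto
      finally show ?thesis using X[of k] k lam by (intro mult_mono) auto
    qed
    finally show "lam ^ k / fact k * overlap_moment (Suc k) \<le> ?X * (1/9) ^ k" .
  qed
  also have "\<dots> = ?X * (\<Sum>k\<le>D. (1/9) ^ k)" by (rule sum_distrib_left[symmetric])
  also have "\<dots> \<le> ?X * (9/8)" by (intro mult_left_mono geometric_ninth) auto
  also have "\<dots> \<le> 2 * ?X" by simp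
  finally have "(\<Sum>k\<le>D. lam ^ k / fact k * overlap_moment (Suc k)) \<le> 2 * ?X" .
  then show ?thesis using MMSE_ge[OF D small]
    unfolding tpca_MMSE_def tpca_second_moment_def by simp
qed

lemma tpca_MMSE_le_trivial: "lam \<ge> 0 \<Longrightarrow> tpca_MMSE n r D lam \<le> tpca_MMSE_trivial n r"
  unfolding tpca_MMSE_def tpca_MMSE_trivial_def
  by (intro additive_model.MMSE_le_trivial additive_model_tensor)

lemma tpca_MMSE_trivial_le: "tpca_MMSE_trivial n r \<le> tpca_second_moment n r"
  unfolding tpca_MMSE_trivial_def MMSE_trivial_def tpca_second_moment_def
  by (simp add: sum_nonneg)

text \<open>With \<open>z\<close> of order \<open>sqrt (n * D)\<close> and the Bessel ratio
  \<open>\<rho>\<close> of order \<open>1 / n\<close>, the numerator of \<open>R\<close> has order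
  \<open>D\<close>, since \<open>z^2 * \<rho>\<close> does; its denominator \<open>q\<close> has
  order \<open>(n * D) powr (r / 2)\<close>.\<close>

lemma slope_bounds:
  fixes n r D :: nat
  assumes n: "n \<ge> 800" "2 * D \<le> n" and r: "r > 0" and D: "D > 0"
  obtains R where "\<And>lam. tpca_FP_slope n r D lam = - lam + R"
    and "R \<le> 20 * 200 ^ r * real D * (real n * real D) powr (- real r / 2)"
    and "real D * (real n * real D) powr (- real r / 2) / (400000 * real r * 3 ^ r) \<le> R"
proof -
  define q where "q = overlap_quantile (tensor_index n r) (tensor_prior n r) (real D)"
  define u where "u = sqrt (real n * real D)"
  define a where "a = (real n - 1) / 2"
  define z where "z = q powr (1 / real r)"
  define w where "w = z\<^sup>2 / 4"
  define \<rho> where "\<rho> = bessel_integral (a - 1) w / bessel_integral a w"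
  define R where "R = (1 - 1 / real r) / q + q powr (2 / real r - 1) / (2 * real r) * \<rho>"
  have u: "u > 0" using n D by (simp add: u_def)
  have u2: "u\<^sup>2 = real n * real D" by (simp add: u_def)
  have ql: "(u / 200) ^ r \<le> q" and qu: "q \<le> (3 * u) ^ r"
    unfolding q_def u_def using overlap_quantile_bounds[OF D n r] by auto
  have q: "q > 0" using ql u by (smt (verit) divide_pos_pos zero_less_power)
  have z: "z > 0" using q by (simp add: z_def)
  have zr: "z ^ r = q" using q r by (simp add: z_def powr_realpow[symmetric] powr_powr)
  \<comment> \<open>Roots are taken by comparing \<open>r\<close>-th powers, with \<open>r\<close>
    in the form \<open>Suc (r - 1)\<close>.\<close>
  have zl: "u / 200 \<le> z"
    using ql z by (intro power_le_imp_le_base[of "u/200" "r - 1" z]) (use r zr in simp_all)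
  have zu: "z \<le> 3 * u"
    using qu u by (intro power_le_imp_le_base[of z "r - 1" "3 * u"]) (use r zr in simp_all)
  have z2: "q powr (2 / real r) = z\<^sup>2"
    using q by (simp add: z_def power2_eq_square powr_add[symmetric])
  have R: "R = ((1 - 1 / real r) + z\<^sup>2 / (2 * real r) * \<rho>) / q"
    using q by (simp add: R_def powr_diff z2 add_divide_distrib)
  have slope: "tpca_FP_slope n r D lam = - lam + R" for lam
    using tpca_FP_slope_eq[of n r D lam] n r q unfolding q_def[symmetric] a_def[symmetric]
    by (simp add: R_def \<rho>_def z2 w_def)
  have z2u: "z\<^sup>2 \<le> 9 * (real n * real D)"
    using power_mono[OF zu, of 2] z by (simp add: power_mult_distrib u2)
  have z2l: "real n * real D / 40000 \<le> z\<^sup>2"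
    using power_mono[OF zl, of 2] u by (simp add: power_divide u2)
  have a: "a > 3" using n by (simp add: a_def)
  have w: "w \<ge> 0" by (simp add: w_def)
  have I: "bessel_integral a w > 0" "bessel_integral (a - 1) w > 0"
    using a w by (auto intro: bessel_integral_pos)
  have \<rho>u: "\<rho> \<le> 4 / real n"
  proof -
    have "\<rho> \<le> 1 / (a - 1)" using bessel_ratio_upper[of a w] a w I by (simp add: \<rho>_def field_simps)
    also have "\<dots> \<le> 4 / real n" using n by (simp add: a_def field_simps)
    finally show ?thesis .
  qed
  have \<rho>l: "1 / (5 * real n) \<le> \<rho>"
  proof -
    \<comment> \<open>This uses \<open>2 * D \<le> n\<close>: then \<open>w\<close>, of order
      \<open>n * D\<close>, is at most of order \<open>n^2\<close>, and dividing by
      \<open>a - 2\<close> leaves order \<open>n\<close>.\<close>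
    have "w / (a - 2) \<le> 4 * real n"
    proof -
      have "w \<le> 9 * (real n * real D) / 4" using z2u by (simp add: w_def)
      also have "\<dots> \<le> 9 * (real n * (real n / 2)) / 4" using n by (intro divide_right_mono mult_left_mono) auto
      also have "\<dots> \<le> 4 * real n * (a - 2)"
      proof -
        have "9 * (real n / 2) / 4 \<le> 4 * (a - 2)"
          proof -
            have "800 \<le> real n" using n by simp
            then show ?thesis unfolding a_def by (simp add: field_simps)
          qed
        then have "real n * (9 * (real n / 2) / 4) \<le> real n * (4 * (a - 2))" by (intro mult_left_mono) auto
        then show ?thesis by (simp add: mult_ac)
      qed
      finally show ?thesis using a by (simp add: divide_le_eq)
    qed
    moreover have "a - 1 \<le> real n" by (simp add: a_def field_simps)
    ultimately have "a - 1 + w / (a - 2) \<le> 5 * real n" by linarith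
    then have "(a - 1 + w / (a - 2)) * bessel_integral (a - 1) w \<le> 5 * real n * bessel_integral (a - 1) w"
      using I by (intro mult_right_mono) auto
    then have "bessel_integral a w \<le> 5 * real n * bessel_integral (a - 1) w"
      using bessel_ratio_lower[OF a w] by linarith
    then show ?thesis using I n by (simp add: \<rho>_def field_simps)
  qed
  have ur: "u ^ r = (real n * real D) powr (real r / 2)"
    using u n D by (simp add: u_def powr_half_sqrt[symmetric] powr_powr powr_realpow[symmetric])
  have uinv: "1 / u ^ r = (real n * real D) powr (- real r / 2)"
    using powr_minus_divide[of "real n * real D" "real r / 2"] by (simp add: ur)
  \<comment> \<open>The bounds \<open>9 * n * D\<close> for \<open>z^2\<close> and
    \<open>4 / n\<close> for \<open>\<rho>\<close> contribute \<open>18 * D\<close>; the summand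
    \<open>1 - 1 / r\<close> is at most \<open>D\<close>.\<close>
  have "R \<le> (20 * real D) / q"
    unfolding R
  proof (intro divide_right_mono)
    have "z\<^sup>2 / (2 * real r) * \<rho> \<le> (9 * (real n * real D)) / (2 * 1) * (4 / real n)"
    proof (intro mult_mono \<rho>u frac_le)
      show "0 \<le> \<rho>" using I by (simp add: \<rho>_def)
    qed (use z2u r in auto)
    also have "\<dots> = 18 * real D" using n by simp
    finally have "z\<^sup>2 / (2 * real r) * \<rho> \<le> 18 * real D" .
    show "1 - 1 / real r + z\<^sup>2 / (2 * real r) * \<rho> \<le> 20 * real D"
    proof -
      have "real D \<ge> 1" "1 / real r \<ge> 0" using D by auto
      then show ?thesis using \<open>z\<^sup>2 / (2 * real r) * \<rho> \<le> 18 * real D\<close> by linarith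
    qed
  qed (use q in simp)
  also have "\<dots> \<le> (20 * real D) / (u / 200) ^ r"
    using ql u D by (intro divide_left_mono mult_pos_pos) (auto simp: q)
  also have "\<dots> = 20 * 200 ^ r * real D * (1 / u ^ r)" by (simp add: power_divide)
  finally have Ru: "R \<le> 20 * 200 ^ r * real D * (real n * real D) powr (- real r / 2)" by (simp only: uinv)
  \<comment> \<open>The constant is the product of \<open>200^2\<close> from the quantile, 2 from
    the derivative and 5 from \<open>\<rho>l\<close>.\<close>
  have "real D / (400000 * real r) \<le> 1 - 1 / real r + z\<^sup>2 / (2 * real r) * \<rho>"
  proof -
    have "real D / (400000 * real r) = (real n * real D / 40000) / (2 * real r) * (1 / (5 * real n))"
      using n by simp
    also have "\<dots> \<le> z\<^sup>2 / (2 * real r) * \<rho>"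
      using z2l \<rho>l n by (intro mult_mono divide_right_mono) auto
    also have "\<dots> \<le> 1 - 1 / real r + z\<^sup>2 / (2 * real r) * \<rho>" using r by simp
    finally show ?thesis .
  qed
  then have "real D / (400000 * real r) / q \<le> R"
    unfolding R using q by (intro divide_right_mono) auto
  moreover have "real D / (400000 * real r) / (3 * u) ^ r \<le> real D / (400000 * real r) / q"
    using qu q u by (intro divide_left_mono) auto
  moreover have "real D / (400000 * real r) / (3 * u) ^ r = real D * (1 / u ^ r) / (400000 * real r * 3 ^ r)"
    by (simp add: power_mult_distrib)
  ultimately have Rl: "real D * (real n * real D) powr (- real r / 2) / (400000 * real r * 3 ^ r) \<le> R"
    by (simp only: uinv)
  show ?thesis by (rule that[OF slope Ru Rl])
qed

section \<open>Soft asymptotics\<close>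

text \<open>Both functions are compared through the common \<open>u\<close>, and the exponents of
  the logarithm add up. Symmetry is the special case treated next.\<close>

lemma soft_Theta_cross:
  assumes f: "f \<in> soft_Theta u" and v: "v \<in> soft_Theta u"
  shows "f \<in> soft_Theta v"
proof -
  obtain k1 where f1: "f \<in> O(\<lambda>n. u n * ln (real n) ^ k1)" and f2: "f \<in> \<Omega>(\<lambda>n. u n / ln (real n) ^ k1)"
    using f by (auto simp: soft_Theta_def)
  obtain k2 where v1: "v \<in> O(\<lambda>n. u n * ln (real n) ^ k2)" and v2: "v \<in> \<Omega>(\<lambda>n. u n / ln (real n) ^ k2)"
    using v by (auto simp: soft_Theta_def)
  \<comment> \<open>\<open>ln (real n)\<close> vanishes at \<open>n = 0\<close> and
    \<open>n = 1\<close>, so its powers can be cancelled only eventually.\<close>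
  have ln0: "\<forall>\<^sub>F n in sequentially. ln (real n) \<noteq> 0"
    using eventually_gt_at_top[of "1::nat"] by eventually_elim simp
  have "u \<in> \<Theta>(\<lambda>n. (u n / ln (real n) ^ k2) * ln (real n) ^ k2)"
    by (rule bigthetaI_cong) (use ln0 in eventually_elim, simp)
  also have "(\<lambda>n. (u n / ln (real n) ^ k2) * ln (real n) ^ k2) \<in> O(\<lambda>n. v n * ln (real n) ^ k2)"
    using v2 by (intro landau_o.big.mult_right) (simp add: bigomega_iff_bigo)
  finally have u1: "u \<in> O(\<lambda>n. v n * ln (real n) ^ k2)" .
  have "f \<in> O(\<lambda>n. v n * ln (real n) ^ k2 * ln (real n) ^ k1)"
    by (rule landau_o.big_trans[OF f1]) (rule landau_o.big.mult_right[OF u1])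
  then have A: "f \<in> O(\<lambda>n. v n * ln (real n) ^ (k1 + k2))" by (simp add: power_add mult_ac)
  have "(\<lambda>n. v n / ln (real n) ^ (k1 + k2)) \<in> O(\<lambda>n. u n * ln (real n) ^ k2 / ln (real n) ^ (k1 + k2))"
    unfolding divide_inverse using v1 by (rule landau_o.big.mult_right)
  also have "(\<lambda>n. u n * ln (real n) ^ k2 / ln (real n) ^ (k1 + k2)) \<in> \<Theta>(\<lambda>n. u n / ln (real n) ^ k1)"
    by (rule bigthetaI_cong) (use ln0 in eventually_elim, simp add: power_add)
  also have "(\<lambda>n. u n / ln (real n) ^ k1) \<in> O(f)" using f2 by (simp add: bigomega_iff_bigo)
  finally have B: "f \<in> \<Omega>(\<lambda>n. v n / ln (real n) ^ (k1 + k2))" by (simp add: bigomega_iff_bigo)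
  show ?thesis unfolding soft_Theta_def using A B by blast
qed

lemma soft_Theta_sym: "f \<in> soft_Theta g \<Longrightarrow> g \<in> soft_Theta f"
proof -
  have "g \<in> soft_Theta g" unfolding soft_Theta_def by (auto intro!: exI[of _ 0])
  then show "f \<in> soft_Theta g \<Longrightarrow> g \<in> soft_Theta f" by (rule soft_Theta_cross)
qed

lemma soft_Theta_mult_right:
  assumes "f \<in> soft_Theta u"
  shows "(\<lambda>n. f n * v n) \<in> soft_Theta (\<lambda>n. u n * v n)"
proof -
  obtain k where f1: "f \<in> O(\<lambda>n. u n * ln (real n) ^ k)" and f2: "f \<in> \<Omega>(\<lambda>n. u n / ln (real n) ^ k)"
    using assms by (auto simp: soft_Theta_def)
  have "(\<lambda>n. f n * v n) \<in> O(\<lambda>n. (u n * ln (real n) ^ k) * v n)" by (rule landau_o.big.mult_right[OF f1])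
  moreover have "(\<lambda>n. f n * v n) \<in> \<Omega>(\<lambda>n. (u n / ln (real n) ^ k) * v n)" by (rule landau_omega.big.mult_right[OF f2])
  ultimately show ?thesis unfolding soft_Theta_def by (auto intro!: exI[of _ k] simp: mult_ac)
qed

lemma soft_Theta_cmult:
  assumes "c > 0" and "\<forall>\<^sub>F n in sequentially. f n = c * g n"
  shows "f \<in> soft_Theta g"
proof -
  have "f \<in> \<Theta>(\<lambda>n. c * g n)" using assms(2) by (rule bigthetaI_cong)
  then have "f \<in> \<Theta>(g)" using assms(1) by simp
  then show ?thesis unfolding soft_Theta_def
    by (auto intro!: exI[of _ 0] dest: bigthetaD1 bigthetaD2)
qed

text \<open>Since \<open>D n \<ge> 1\<close>, the power is at most 1; a polylogarithmic upper bound
  on \<open>D\<close> turns into a polylogarithmic lower bound on the negative power.\<close>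

lemma soft_Theta_polylog_powr:
  fixes D :: "nat \<Rightarrow> nat"
  assumes D: "\<And>n. D n > 0" and soft: "(\<lambda>n. real (D n)) \<in> soft_O (\<lambda>n. 1)" and b: "b \<ge> 0"
  shows "(\<lambda>n. u n * real (D n) powr (- b)) \<in> soft_Theta u"
proof -
  obtain k where "(\<lambda>n. real (D n)) \<in> O(\<lambda>n. ln (real n) ^ k)" using soft by (auto simp: soft_O_def)
  then obtain C where C: "C > 0" and ev: "\<forall>\<^sub>F n in sequentially. real (D n) \<le> C * \<bar>ln (real n) ^ k\<bar>"
    by (elim landau_o.bigE) auto
  define j where "j = nat \<lceil>b\<rceil>"
  have "(\<lambda>n. u n * real (D n) powr (- b)) \<in> O(\<lambda>n. u n * ln (real n) ^ (k * j))"
  proof (rule landau_o.bigI[of 1])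
    show "\<forall>\<^sub>F n in sequentially. norm (u n * real (D n) powr (- b)) \<le> 1 * norm (u n * ln (real n) ^ (k * j))"
      using eventually_gt_at_top[of "3::nat"]
    proof eventually_elim
      fix n :: nat assume n: "n > 3"
      have "exp 1 \<le> real n" using exp_le n by linarith
      then have "1 \<le> ln (real n)" using n by (subst ln_ge_iff) auto
      then have "1 \<le> ln (real n) ^ (k * j)" by (rule one_le_power)
      moreover have "real (D n) powr (- b) \<le> 1" using powr_mono[of "- b" 0 "real (D n)"] D[of n] b by simp
      ultimately have "\<bar>u n\<bar> * real (D n) powr (- b) \<le> \<bar>u n\<bar> * ln (real n) ^ (k * j)"
        by (intro mult_left_mono) linarith+
      then show "norm (u n * real (D n) powr (- b)) \<le> 1 * norm (u n * ln (real n) ^ (k * j))"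
        using \<open>1 \<le> ln (real n) ^ (k * j)\<close> by (simp add: abs_mult)
    qed
  qed simp
  moreover have "(\<lambda>n. u n / ln (real n) ^ (k * j)) \<in> O(\<lambda>n. u n * real (D n) powr (- b))"
  proof (rule landau_o.bigI[of "C ^ j"])
    show "\<forall>\<^sub>F n in sequentially. norm (u n / ln (real n) ^ (k * j)) \<le> C ^ j * norm (u n * real (D n) powr (- b))"
      using ev eventually_gt_at_top[of "3::nat"]
    proof eventually_elim
      fix n :: nat assume n: "n > 3" and le: "real (D n) \<le> C * \<bar>ln (real n) ^ k\<bar>"
      have "exp 1 \<le> real n" using exp_le n by linarith
      then have ln1: "1 \<le> ln (real n)" using n by (subst ln_ge_iff) auto
      define L where "L = ln (real n) ^ (k * j)"
      have L: "L > 0" using ln1 by (simp add: L_def)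
      have D0: "real (D n) \<ge> 1" using D[of n] by simp
      have "real (D n) powr b \<le> real (D n) powr real j" using D0 by (intro powr_mono) (auto simp: j_def real_nat_ceiling_ge)
      also have "\<dots> = real (D n) ^ j" using D0 by (simp add: powr_realpow)
      also have "\<dots> \<le> (C * \<bar>ln (real n) ^ k\<bar>) ^ j" using le by (intro power_mono) auto
      also have "\<dots> = C ^ j * L" using ln1 by (simp add: L_def power_mult_distrib power_mult)
      finally have *: "real (D n) powr b \<le> C ^ j * L" .
      have "1 / L \<le> C ^ j * real (D n) powr (- b)"
        using * L D0 by (simp add: powr_minus field_simps)
      then have "\<bar>u n\<bar> * (1 / L) \<le> \<bar>u n\<bar> * (C ^ j * real (D n) powr (- b))" by (intro mult_left_mono) auto
      then show "norm (u n / ln (real n) ^ (k * j)) \<le> C ^ j * norm (u n * real (D n) powr (- b))"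
        unfolding L_def[symmetric] using L by (simp add: abs_mult mult_ac)
    qed
  qed (use C in simp)
  ultimately show ?thesis unfolding soft_Theta_def by (auto simp: bigomega_iff_bigo)
qed

lemma eventually_ln_ge: "\<forall>\<^sub>F n in sequentially. C \<le> ln (real n)"
proof -
  have "filterlim (\<lambda>n. ln (real n)) at_top sequentially"
    by (rule filterlim_compose[OF ln_at_top filterlim_real_sequentially])
  then show ?thesis by (simp add: filterlim_at_top)
qed

text \<open>Collects the side conditions of the bounds for fixed \<open>n\<close>. Those relating
  \<open>D\<close> and \<open>n\<close> follow from \<open>D n \<le> sqrt n\<close> together with
  \<open>2 * (r + 1) \<le> sqrt n\<close>, which turns the relevant multiples of
  \<open>sqrt n\<close> into at most \<open>n\<close>.\<close>

lemma eventually_degree_small: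
  fixes D :: "nat \<Rightarrow> nat"
  assumes "(\<lambda>n. real (D n)) \<in> o(\<lambda>n. sqrt (real n) / ln (real n) ^ 2)"
  shows "\<forall>\<^sub>F n in sequentially. n \<ge> 800 \<and> 2 * D n \<le> n \<and> r * (D n + 1) \<le> n \<and> real (D n) \<le> sqrt (real n)"
proof -
  have "\<forall>\<^sub>F n in sequentially. norm (real (D n)) \<le> 1 * norm (sqrt (real n) / ln (real n) ^ 2)"
    by (rule landau_o.smallD[OF assms]) simp
  moreover have "\<forall>\<^sub>F n in sequentially. 1 \<le> ln (real n)" by (rule eventually_ln_ge)
  ultimately show ?thesis
    using eventually_ge_at_top[of "800 :: nat"] eventually_ge_at_top[of "4 * (r + 1)\<^sup>2"]
  proof eventually_elim
    fix n assume 1: "norm (real (D n)) \<le> 1 * norm (sqrt (real n) / ln (real n) ^ 2)" "1 \<le> ln (real n)"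
      and n: "800 \<le> n" "4 * (r + 1)\<^sup>2 \<le> n"
    have "(ln (real n))\<^sup>2 \<ge> 1" using 1(2) by (intro one_le_power)
    then have "sqrt (real n) / ln (real n) ^ 2 \<le> sqrt (real n)" by (simp add: divide_le_eq mult_le_cancel_left1)
    then have D: "real (D n) \<le> sqrt (real n)" using 1(1) by simp
    have s: "real (2 * (r + 1)) \<le> sqrt (real n)"
    proof (rule real_le_rsqrt)
      have "real (4 * (r + 1)\<^sup>2) \<le> real n" using n(2) by (simp only: of_nat_le_iff)
      then show "(real (2 * (r + 1)))\<^sup>2 \<le> real n" by (simp add: power2_eq_square algebra_simps)
    qed
    have sq: "sqrt (real n) * sqrt (real n) = real n" by simp
    have s1: "1 \<le> sqrt (real n)" using n by simp
    have "real (2 * D n) \<le> 2 * sqrt (real n)" using D by simp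
    also have "\<dots> \<le> sqrt (real n) * sqrt (real n)" using s by (intro mult_right_mono) auto
    finally have "2 * D n \<le> n" unfolding sq by (simp only: of_nat_le_iff)
    moreover have "r * (D n + 1) \<le> n"
    proof -
      have "real (r * (D n + 1)) \<le> real r * (2 * sqrt (real n))"
      proof -
        have "real (D n + 1) \<le> 2 * sqrt (real n)" using D s1 unfolding of_nat_add of_nat_1 by linarith
        then show ?thesis unfolding of_nat_mult by (intro mult_left_mono) auto
      qed
      also have "real r * (2 * sqrt (real n)) = (2 * real r) * sqrt (real n)" by simp
      also have "\<dots> \<le> sqrt (real n) * sqrt (real n)"
        using s by (intro mult_right_mono) auto
      finally show ?thesis unfolding sq by (simp only: of_nat_le_iff)
    qed
    ultimately show "n \<ge> 800 \<and> 2 * D n \<le> n \<and> r * (D n + 1) \<le> n \<and> real (D n) \<le> sqrt (real n)"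
      using n D by blast
  qed
qed

lemma ratio_tendsto_1:
  fixes M sm X :: "nat \<Rightarrow> real"
  assumes "\<forall>\<^sub>F n in sequentially. real n ^ r - B * X n \<le> M n"
    and "\<forall>\<^sub>F n in sequentially. M n \<le> (real n + 2 * real r) ^ r"
    and X: "(\<lambda>n. X n / real n ^ r) \<longlonglongrightarrow> 0"
  shows "(\<lambda>n. M n / real n ^ r) \<longlonglongrightarrow> 1"
proof (rule tendsto_sandwich)
  show "\<forall>\<^sub>F n in sequentially. 1 - B * (X n / real n ^ r) \<le> M n / real n ^ r"
    using assms(1) eventually_gt_at_top[of "0::nat"]
  proof eventually_elim
    fix n :: nat assume *: "real n ^ r - B * X n \<le> M n" "0 < n"
    have "1 - B * (X n / real n ^ r) = (real n ^ r - B * X n) / real n ^ r" using * by (simp add: diff_divide_distrib)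
    also have "\<dots> \<le> M n / real n ^ r" using * by (intro divide_right_mono) auto
    finally show "1 - B * (X n / real n ^ r) \<le> M n / real n ^ r" .
  qed
  show "\<forall>\<^sub>F n in sequentially. M n / real n ^ r \<le> (1 + 2 * real r / real n) ^ r"
    using assms(2) eventually_gt_at_top[of "0::nat"]
  proof eventually_elim
    fix n :: nat assume *: "M n \<le> (real n + 2 * real r) ^ r" "0 < n"
    have "M n / real n ^ r \<le> (real n + 2 * real r) ^ r / real n ^ r" using * by (intro divide_right_mono) auto
    also have "\<dots> = (1 + 2 * real r / real n) ^ r" using * by (simp add: power_divide[symmetric] add_divide_distrib)
    finally show "M n / real n ^ r \<le> (1 + 2 * real r / real n) ^ r" .
  qed
  have "(\<lambda>n. 1 - B * (X n / real n ^ r)) \<longlonglongrightarrow> 1 - B * 0" by (intro tendsto_intros X)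
  then show "(\<lambda>n. 1 - B * (X n / real n ^ r)) \<longlonglongrightarrow> 1" by simp
  have "(\<lambda>n. (1 + 2 * real r / real n) ^ r) \<longlonglongrightarrow> (1 + 0) ^ r"
    by (intro tendsto_intros lim_const_over_n)
  then show "(\<lambda>n. (1 + 2 * real r / real n) ^ r) \<longlonglongrightarrow> 1" by simp
qed

text \<open>As \<open>D \<le> sqrt n\<close>, the numerator is at most
  \<open>n powr (3 * r / 4)\<close>, so the quotient is at most
  \<open>n powr (- r / 4)\<close>.\<close>

lemma tensor_error_negligible:
  fixes D :: "nat \<Rightarrow> nat"
  assumes r: "r \<ge> 2" and D: "\<forall>\<^sub>F n in sequentially. real (D n) \<le> sqrt (real n)"
  shows "(\<lambda>n. (real (D n) * real n) powr (real r / 2) / real n ^ r) \<longlonglongrightarrow> 0"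
proof (rule tendsto_sandwich)
  show "\<forall>\<^sub>F n in sequentially. 0 \<le> (real (D n) * real n) powr (real r / 2) / real n ^ r" by simp
  show "\<forall>\<^sub>F n in sequentially. (real (D n) * real n) powr (real r / 2) / real n ^ r \<le> real n powr (- real r / 4)"
    using D eventually_gt_at_top[of "0::nat"]
  proof eventually_elim
    fix n :: nat assume D: "real (D n) \<le> sqrt (real n)" and n: "0 < n"
    have "(real (D n) * real n) powr (real r / 2) \<le> (sqrt (real n) * real n) powr (real r / 2)"
      using D by (intro powr_mono2 mult_right_mono) auto
    also have "sqrt (real n) * real n = real n powr (3/2)"
      using n powr_add[of "real n" "1/2" 1] by (simp add: powr_half_sqrt)
    also have "(real n powr (3/2)) powr (real r / 2) = real n powr (- real r / 4) * real n ^ r"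
      using n by (simp add: powr_powr powr_realpow[symmetric] powr_add[symmetric])
    finally show "(real (D n) * real n) powr (real r / 2) / real n ^ r \<le> real n powr (- real r / 4)"
      using n by (simp add: divide_le_eq)
  qed
  show "(\<lambda>n. real n powr (- real r / 4)) \<longlonglongrightarrow> 0"
    using r by (intro tendsto_neg_powr filterlim_real_sequentially) auto
qed simp

text \<open>The common core of the first and the last claim of the theorem: the SNR enters only
  through the threshold on \<open>mu\<close>. The two-sided error is measured from the second
  moment, which exceeds \<open>n ^ r\<close> by an amount of order \<open>n ^ (r - 1)\<close>; for
  \<open>r > 2\<close> and small \<open>D\<close> this is more than the allowed error, so relative
  to \<open>n ^ r\<close> the bound is one-sided.\<close>

lemma tpca_low_degree_hardness:
  fixes D :: "nat \<Rightarrow> nat" and mu M :: "nat \<Rightarrow> real"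
  assumes r: "r \<ge> 2" and D_pos: "\<And>n. D n > 0"
    and D_small: "(\<lambda>n. real (D n)) \<in> o(\<lambda>n. sqrt (real n) / ln (real n) ^ 2)"
    and mu: "\<forall>\<^sub>F n in sequentially. 0 \<le> mu n \<and> mu n \<le> snr_const r * (real n * real (D n)) powr (- real r / 2)"
    and M: "\<And>n. M n = tpca_MMSE n r (D n) (mu n)"
  shows "\<exists>e \<in> soft_O (\<lambda>n. (real (D n) * real n) powr (real r / 2)).
           \<forall>\<^sub>F n in sequentially. M n \<ge> real n ^ r - e n"
    and "(\<lambda>n. tpca_second_moment n r - M n) \<in> soft_O (\<lambda>n. (real (D n) * real n) powr (real r / 2))"
    and "(\<lambda>n. M n / real n ^ r) \<longlonglongrightarrow> 1"
    and "(\<lambda>n. tpca_MMSE_trivial n r / real n ^ r) \<longlonglongrightarrow> 1"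
proof -
  let ?X = "\<lambda>n. (real (D n) * real n) powr (real r / 2)"
  define B where "B = 8 * (2 * real r) powr (real r / 2)"
  have sm: "\<forall>\<^sub>F n in sequentially. tpca_second_moment n r - B * ?X n \<le> M n \<and> M n \<le> tpca_MMSE_trivial n r
      \<and> tpca_MMSE_trivial n r \<le> tpca_second_moment n r \<and> real n ^ r \<le> tpca_second_moment n r
      \<and> tpca_second_moment n r \<le> (real n + 2 * real r) ^ r"
    using eventually_degree_small[OF D_small, of r] mu
  proof eventually_elim
    fix n assume n: "n \<ge> 800 \<and> 2 * D n \<le> n \<and> r * (D n + 1) \<le> n \<and> real (D n) \<le> sqrt (real n)"
      and lam: "0 \<le> mu n \<and> mu n \<le> snr_const r * (real n * real (D n)) powr (- real r / 2)"
    have n0: "n > 0" using n by linarith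
    show "tpca_second_moment n r - B * ?X n \<le> M n \<and> M n \<le> tpca_MMSE_trivial n r
      \<and> tpca_MMSE_trivial n r \<le> tpca_second_moment n r \<and> real n ^ r \<le> tpca_second_moment n r
      \<and> tpca_second_moment n r \<le> (real n + 2 * real r) ^ r"
      unfolding M B_def using tpca_MMSE_ge[OF r D_pos, of n n "mu n"] tpca_MMSE_le_trivial[of "mu n" n r "D n"]
        tpca_MMSE_trivial_le[of n r] tpca_second_moment_bounds[OF n0, of r] n lam by blast
  qed
  have O: "(\<lambda>n. B * ?X n) \<in> soft_O ?X"
    unfolding soft_O_def by (auto intro!: exI[of _ 0])
  have low: "\<forall>\<^sub>F n in sequentially. real n ^ r - B * ?X n \<le> M n"
    using sm by eventually_elim linarith
  show "\<exists>e \<in> soft_O ?X. \<forall>\<^sub>F n in sequentially. M n \<ge> real n ^ r - e n"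
    by (rule bexI[of _ "\<lambda>n. B * ?X n"]) (rule low, rule O)
  have "(\<lambda>n. tpca_second_moment n r - M n) \<in> O(?X)"
  proof (rule landau_o.bigI[of "B"])
    show "B > 0" using r by (simp add: B_def)
    show "\<forall>\<^sub>F n in sequentially. norm (tpca_second_moment n r - M n) \<le> B * norm (?X n)"
      using sm by eventually_elim simp
  qed
  then show "(\<lambda>n. tpca_second_moment n r - M n) \<in> soft_O ?X"
    unfolding soft_O_def by (auto intro!: exI[of _ 0])
  have "\<forall>\<^sub>F n in sequentially. real (D n) \<le> sqrt (real n)"
    using eventually_degree_small[OF D_small, of r] by eventually_elim blast
  note X = tensor_error_negligible[OF r this]
  show "(\<lambda>n. M n / real n ^ r) \<longlonglongrightarrow> 1"
    by (rule ratio_tendsto_1[OF low _ X]) (use sm in eventually_elim, linarith)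
  show "(\<lambda>n. tpca_MMSE_trivial n r / real n ^ r) \<longlonglongrightarrow> 1"
    by (rule ratio_tendsto_1[OF _ _ X, of B]) (use sm in eventually_elim, linarith)+
qed

lemma asymp_equiv_of_common_ratio:
  fixes f g h :: "nat \<Rightarrow> real"
  assumes f: "(\<lambda>n. f n / h n) \<longlonglongrightarrow> 1" and g: "(\<lambda>n. g n / h n) \<longlonglongrightarrow> 1"
  shows "f \<sim>[sequentially] g"
proof -
  have "f \<sim>[sequentially] h" "g \<sim>[sequentially] h" using f g by (auto intro: asymp_equivI')
  then show ?thesis by (blast intro: asymp_equiv_trans asymp_equiv_symI)
qed

text \<open>The slope is \<open>- lam + R\<close> with \<open>R\<close> of the exact order
  \<open>n powr (- r / 2) * D powr (1 - r / 2)\<close>, so a positive \<open>lam\<close> with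
  nonnegative slope is at most of that order. It agrees with \<open>n powr (- r / 2)\<close> up to
  logarithms when \<open>r = 2\<close> or \<open>D\<close> is polylogarithmic, which explains the
  case distinction in the second claim.\<close>

theorem theorem3p1:
  fixes r :: nat and D :: "nat \<Rightarrow> nat" and lam_ALG :: "nat \<Rightarrow> real"
  assumes r: "r \<ge> 2"
    and D_pos: "\<And>n. D n > 0"
    and D_small: "(\<lambda>n. real (D n)) \<in> o(\<lambda>n. sqrt (real n) / ln (real n) ^ 2)"
    and lam_ALG: "lam_ALG \<in> soft_Theta (\<lambda>n. real n powr (- real r / 2))"
  shows
    "(\<forall>lam M :: nat \<Rightarrow> real.
        (\<forall>n. lam n > 0) \<longrightarrow>
        (\<forall>n. M n = tpca_MMSE n r (D n)
                (1 / (real (D n) powr (3/2) * ln (real n) ^ (r + 1))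
                   * (lam n + tpca_FP_slope n r (D n) (lam n)))) \<longrightarrow>
           (\<exists>e \<in> soft_O (\<lambda>n. (real (D n) * real n) powr (real r / 2)).
              \<forall>\<^sub>F n in sequentially. M n \<ge> real n ^ r - e n) \<and>
           (\<lambda>n. tpca_second_moment n r - M n)
              \<in> soft_O (\<lambda>n. (real (D n) * real n) powr (real r / 2)) \<and>
           (\<lambda>n. real n ^ r) \<sim>[sequentially] M \<and>
           M \<sim>[sequentially] (\<lambda>n. tpca_MMSE_trivial n r))
   \<and> (\<exists>lam :: nat \<Rightarrow> real. (\<forall>n. lam n > 0) \<and>
        lam \<in> soft_Theta (\<lambda>n. real n powr (- real r / 2) * real (D n) powr (1 - real r / 2)) \<and>
        (r = 2 \<or> (\<lambda>n. real (D n)) \<in> soft_O (\<lambda>n. 1) \<longrightarrow>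
           lam \<in> soft_Theta (\<lambda>n. real n powr (- real r / 2)) \<and> lam \<in> soft_Theta lam_ALG) \<and>
        (\<forall>\<^sub>F n in sequentially. tpca_FP_slope n r (D n) (lam n) \<ge> 0))
   \<and> (\<exists>mu :: nat \<Rightarrow> real. (\<forall>n. mu n > 0) \<and>
        mu \<in> soft_Theta (\<lambda>n. lam_ALG n / real (D n) powr (real r / 2)) \<and>
        (\<exists>eps :: nat \<Rightarrow> real. eps \<longlonglongrightarrow> 0 \<and>
           (\<forall>\<^sub>F n in sequentially.
              tpca_MMSE n r (D n) (mu n) \<ge> (1 + eps n) * tpca_MMSE_trivial n r)))"
proof (intro conjI allI impI)
  let ?Y = "\<lambda>n. (real n * real (D n)) powr (- real r / 2)"
  have r0: "r > 0" using r by simp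
  {
    fix lam M :: "nat \<Rightarrow> real"
    assume M: "\<forall>n. M n = tpca_MMSE n r (D n)
                (1 / (real (D n) powr (3/2) * ln (real n) ^ (r + 1))
                   * (lam n + tpca_FP_slope n r (D n) (lam n)))"
    \<comment> \<open>The effective SNR. The parameter \<open>lam n\<close> cancels in it, so its
      sign and size are those of the rescaled \<open>R\<close>.\<close>
    define mu where "mu n = 1 / (real (D n) powr (3/2) * ln (real n) ^ (r + 1)) * (lam n + tpca_FP_slope n r (D n) (lam n))" for n
    have M': "M n = tpca_MMSE n r (D n) (mu n)" for n using M by (simp add: mu_def)
    have "\<forall>\<^sub>F n in sequentially. 0 \<le> mu n \<and> mu n \<le> snr_const r * ?Y n"
      using eventually_degree_small[OF D_small, of r] eventually_ln_ge[of 1] eventually_ln_ge[of "20 * 200 ^ r / snr_const r"]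
    proof eventually_elim
      fix n assume n: "n \<ge> 800 \<and> 2 * D n \<le> n \<and> r * (D n + 1) \<le> n \<and> real (D n) \<le> sqrt (real n)"
        and l1: "1 \<le> ln (real n)" and l2: "20 * 200 ^ r / snr_const r \<le> ln (real n)"
      obtain R where R: "\<And>lam. tpca_FP_slope n r (D n) lam = - lam + R"
        and Ru: "R \<le> 20 * 200 ^ r * real (D n) * ?Y n"
        and Rl: "real (D n) * ?Y n / (400000 * real r * 3 ^ r) \<le> R"
        by (rule slope_bounds[of n "D n" r]) (use n r0 D_pos in auto)
      define L where "L = ln (real n) ^ (r + 1)"
      have L: "ln (real n) \<le> L" unfolding L_def using l1 by (rule self_le_power) simp
      then have L0: "L > 0" using l1 by linarith
      have D1: "real (D n) \<ge> 1" using D_pos[of n] by simp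
      have mu: "mu n = R / (real (D n) powr (3/2) * L)" by (simp add: mu_def R L_def)
      have "0 \<le> real (D n) * ?Y n / (400000 * real r * 3 ^ r)" by simp
      then have R0: "0 \<le> R" using Rl by linarith
      \<comment> \<open>Bounding \<open>D powr (3/2)\<close> from below by \<open>D\<close> suffices
        to cancel the factor \<open>D\<close> in the upper bound on \<open>R\<close>.\<close>
      have "mu n \<le> R / (real (D n) * L)"
      proof -
        have "real (D n) powr 1 \<le> real (D n) powr (3/2)" using D1 by (intro powr_mono) auto
        then show ?thesis unfolding mu using R0 D1 L0 by (intro divide_left_mono mult_right_mono mult_pos_pos) auto
      qed
      also have "\<dots> \<le> (20 * 200 ^ r * real (D n) * ?Y n) / (real (D n) * L)"
        using Ru D1 L0 by (intro divide_right_mono) auto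
      also have "\<dots> = (20 * 200 ^ r / L) * ?Y n" using D1 by simp
      \<comment> \<open>A single factor \<open>ln n\<close> of \<open>L\<close> eventually exceeds
        the ratio of the constant in \<open>slope_bounds\<close> to
        \<open>snr_const r\<close>.\<close>
      also have "\<dots> \<le> snr_const r * ?Y n"
      proof (intro mult_right_mono)
        have "20 * 200 ^ r / snr_const r \<le> L" using l2 L by linarith
        then show "20 * 200 ^ r / L \<le> snr_const r" using L0 snr_const_pos[OF r0] by (simp add: field_simps)
      qed simp
      finally show "0 \<le> mu n \<and> mu n \<le> snr_const r * ?Y n"
        unfolding mu using R0 L0 by simp
    qed
    note hard = tpca_low_degree_hardness[OF r D_pos D_small this M']
    show "\<exists>e \<in> soft_O (\<lambda>n. (real (D n) * real n) powr (real r / 2)).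
              \<forall>\<^sub>F n in sequentially. M n \<ge> real n ^ r - e n" by (rule hard(1))
    show "(\<lambda>n. tpca_second_moment n r - M n) \<in> soft_O (\<lambda>n. (real (D n) * real n) powr (real r / 2))" by (rule hard(2))
    have "(\<lambda>n. real n ^ r / real n ^ r) \<longlonglongrightarrow> 1"
      by (rule tendsto_eventually) (use eventually_gt_at_top[of "0::nat"] in eventually_elim, simp)
    then show "(\<lambda>n. real n ^ r) \<sim>[sequentially] M" by (rule asymp_equiv_of_common_ratio[OF _ hard(3)])
    show "M \<sim>[sequentially] (\<lambda>n. tpca_MMSE_trivial n r)" by (rule asymp_equiv_of_common_ratio[OF hard(3,4)])
  }
  let ?u = "\<lambda>n. real n powr (- real r / 2)"
  have Y: "?Y n = ?u n * real (D n) powr (- (real r / 2))" for n by (simp add: powr_mult)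
  show "\<exists>lam :: nat \<Rightarrow> real. (\<forall>n. lam n > 0) \<and>
        lam \<in> soft_Theta (\<lambda>n. ?u n * real (D n) powr (1 - real r / 2)) \<and>
        (r = 2 \<or> (\<lambda>n. real (D n)) \<in> soft_O (\<lambda>n. 1) \<longrightarrow>
           lam \<in> soft_Theta ?u \<and> lam \<in> soft_Theta lam_ALG) \<and>
        (\<forall>\<^sub>F n in sequentially. tpca_FP_slope n r (D n) (lam n) \<ge> 0)"
  proof -
    \<comment> \<open>The constant of the lower bound in \<open>slope_bounds\<close>, so that
      eventually \<open>lam n \<le> R\<close>.\<close>
    define c where "c = 1 / (400000 * real r * 3 ^ r)"
    \<comment> \<open>At \<open>n = 0\<close> the formula would give 0, since
      \<open>0 powr x = 0\<close>; the value 1 keeps \<open>lam\<close> positive everywhere.\<close>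
    define lam where "lam n = (if n = 0 then 1 else c * (real (D n) * ?Y n))" for n
    have c: "c > 0" using r0 by (simp add: c_def)
    have pos: "lam n > 0" for n using c D_pos[of n] by (simp add: lam_def)
    have DY: "real (D n) * ?Y n = ?u n * real (D n) powr (1 - real r / 2)" for n
    proof -
      have "real (D n) powr (1 + - (real r / 2)) = real (D n) powr 1 * real (D n) powr (- (real r / 2))"
        by (rule powr_add)
      then show ?thesis unfolding Y using D_pos[of n] by simp
    qed
    have th: "lam \<in> soft_Theta (\<lambda>n. ?u n * real (D n) powr (1 - real r / 2))"
      by (rule soft_Theta_cmult[OF c], use eventually_gt_at_top[of "0::nat"] in eventually_elim)
         (simp only: lam_def DY, simp)
    have th': "lam \<in> soft_Theta ?u" if "r = 2 \<or> (\<lambda>n. real (D n)) \<in> soft_O (\<lambda>n. 1)"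
      using that
    proof
      assume "r = 2"
      then have "?u n * real (D n) powr (1 - real r / 2) = ?u n" for n using D_pos[of n] by simp
      then have "(\<lambda>n. ?u n * real (D n) powr (1 - real r / 2)) = ?u" by (intro ext)
      then show ?thesis using th by simp
    next
      assume "(\<lambda>n. real (D n)) \<in> soft_O (\<lambda>n. 1)"
      then have "(\<lambda>n. ?u n * real (D n) powr (- (real r / 2 - 1))) \<in> soft_Theta ?u"
        using r by (intro soft_Theta_polylog_powr D_pos) auto
      then have "(\<lambda>n. ?u n * real (D n) powr (1 - real r / 2)) \<in> soft_Theta ?u" by simp
      then show ?thesis using soft_Theta_cross[OF th] soft_Theta_sym by blast
    qed
    have "\<forall>\<^sub>F n in sequentially. tpca_FP_slope n r (D n) (lam n) \<ge> 0"
      using eventually_degree_small[OF D_small, of r]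
    proof eventually_elim
      fix n assume n: "n \<ge> 800 \<and> 2 * D n \<le> n \<and> r * (D n + 1) \<le> n \<and> real (D n) \<le> sqrt (real n)"
      obtain R where R: "\<And>lam. tpca_FP_slope n r (D n) lam = - lam + R"
        and "R \<le> 20 * 200 ^ r * real (D n) * ?Y n" and Rl: "real (D n) * ?Y n / (400000 * real r * 3 ^ r) \<le> R"
        by (rule slope_bounds[of n "D n" r]) (use n r0 D_pos in auto)
      have "lam n = real (D n) * ?Y n / (400000 * real r * 3 ^ r)" using n by (simp add: lam_def c_def)
      then show "tpca_FP_slope n r (D n) (lam n) \<ge> 0" using R Rl by simp
    qed
    then show ?thesis
      using pos th th' soft_Theta_cross[OF th' lam_ALG] by (intro exI[of _ lam]) blast
  qed
  show "\<exists>mu :: nat \<Rightarrow> real. (\<forall>n. mu n > 0) \<and>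
        mu \<in> soft_Theta (\<lambda>n. lam_ALG n / real (D n) powr (real r / 2)) \<and>
        (\<exists>eps :: nat \<Rightarrow> real. eps \<longlonglongrightarrow> 0 \<and>
           (\<forall>\<^sub>F n in sequentially.
              tpca_MMSE n r (D n) (mu n) \<ge> (1 + eps n) * tpca_MMSE_trivial n r))"
  proof -
    define mu where "mu n = (if n = 0 then 1 else snr_const r * ?Y n)" for n
    have pos: "mu n > 0" for n using snr_const_pos[OF r0] D_pos[of n] by (simp add: mu_def)
    have th: "mu \<in> soft_Theta (\<lambda>n. ?u n * real (D n) powr (- (real r / 2)))"
      by (rule soft_Theta_cmult[OF snr_const_pos[OF r0]], use eventually_gt_at_top[of "0::nat"] in eventually_elim)
         (simp only: mu_def Y, simp)
    have "(\<lambda>n. lam_ALG n * real (D n) powr (- (real r / 2))) \<in> soft_Theta (\<lambda>n. ?u n * real (D n) powr (- (real r / 2)))"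
      by (rule soft_Theta_mult_right[OF lam_ALG])
    then have "mu \<in> soft_Theta (\<lambda>n. lam_ALG n * real (D n) powr (- (real r / 2)))"
      by (rule soft_Theta_cross[OF th])
    then have th': "mu \<in> soft_Theta (\<lambda>n. lam_ALG n / real (D n) powr (real r / 2))"
      by (simp only: powr_minus_divide times_divide_eq_right mult_1_right)
    define M where "M n = tpca_MMSE n r (D n) (mu n)" for n
    have ev: "\<forall>\<^sub>F n in sequentially. 0 \<le> mu n \<and> mu n \<le> snr_const r * ?Y n"
      using eventually_gt_at_top[of "0::nat"] by eventually_elim (use snr_const_pos[OF r0] in \<open>simp add: mu_def\<close>)
    note hard = tpca_low_degree_hardness[OF r D_pos D_small ev M_def]
    have "(\<lambda>n. (M n / real n ^ r) / (tpca_MMSE_trivial n r / real n ^ r)) \<longlonglongrightarrow> 1 / 1"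
      by (intro tendsto_divide hard(3,4)) simp
    then have "(\<lambda>n. (M n / real n ^ r) / (tpca_MMSE_trivial n r / real n ^ r) - 1) \<longlonglongrightarrow> 1 / 1 - 1"
      by (intro tendsto_diff tendsto_const)
    then have eps: "(\<lambda>n. (M n / real n ^ r) / (tpca_MMSE_trivial n r / real n ^ r) - 1) \<longlonglongrightarrow> 0" by simp
    have "\<forall>\<^sub>F n in sequentially. tpca_MMSE_trivial n r / real n ^ r > 0"
      using order_tendstoD(1)[OF hard(4), of 0] by simp
    \<comment> \<open>With \<open>eps\<close> taken as the ratio of the two errors minus 1, the
      inequality is an equality as soon as the trivial error is positive.\<close>
    then have "\<forall>\<^sub>F n in sequentially. M n \<ge> (1 + ((M n / real n ^ r) / (tpca_MMSE_trivial n r / real n ^ r) - 1)) * tpca_MMSE_trivial n r"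
      using eventually_gt_at_top[of "0::nat"] by eventually_elim auto
    then show ?thesis unfolding M_def using pos th' eps[unfolded M_def] by blast
  qed
qed

end
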